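(* Let $0<\Delta\le1$ and $s\ge2$. If $(u_0,v_0)\in E_{\Delta,s+1}\oplus E_{\Delta,s+1}$, then there exists $T_\Delta>0$ such that the Cauchy problem $$\begin{cases}u_t+\beta uu_x+(1-\partial_x^2)^{-1}\partial_x\left[-\alpha u+\frac{3-\beta}{2}u^2+\frac{\beta}{2}u_x^2+v+\frac12 v^2\right]=0,\\ v_t+u_x+(uv)_x=0,\\ u(0,x)=u_0(x),\\ v(0,x)=v_0(x)\end{cases}$$ has a unique solution which is a holomorphic function valued in $E_{\Delta d,s+1}\oplus E_{\Delta d,s+1}$ in the disk $D(0,T_\Delta(1-d))$ for every $d\in(0,1)$.
   Context: $\alpha,\beta$ are the real constants appearing in the system (a generalized two-component Camassa-Holm system) and $D(0,a)=\{t\in\mathbb{C}:|t|<a\}$. The spaces $L^2(\mathbb{R})$, $\mathcal{C}^\infty(\mathbb{R})$ and their subspaces consist of real-valued functions on $\mathbb{R}$. $H^s=H^s(\mathbb{R})$ has norm $\|f\|_s=\|(1+\xi^2)^{s/2}\hat f(\xi)\|_{L^2}$. For $0<\delta\le1$ and $s\ge2$, $$\|f\|_{(\delta,s)}=\sup_{k\ge0}\frac{\delta^k(k+1)^2\|f^{(k)}\|_s}{k!},\qquad E_{\delta,s}=\{f\in\mathcal{C}^\infty(\mathbb{R}):\|f\|_{(\delta,s)}<\infty\},$$ which is a Banach space.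
   Formalization: Since a holomorphic function of complex t with real-valued values would be constant, the solution takes values in the complexification of the spaces E; the initial data are real, the solution is real-valued at real times, and uniqueness holds among all complexified holomorphic solutions. *)

theory Defs
  imports "HOL-Analysis.Analysis"
begin

section \<open>Square-integrable functions and the Fourier--Plancherel transform\<close>

definition L2_fun :: "(real \<Rightarrow> complex) \<Rightarrow> bool" where
  "L2_fun f \<longleftrightarrow> f \<in> borel_measurable lborel \<and> integrable lborel (\<lambda>x. (cmod (f x))\<^sup>2)"

definition fourier_trunc :: "nat \<Rightarrow> (real \<Rightarrow> complex) \<Rightarrow> real \<Rightarrow> complex" where
  "fourier_trunc n f \<xi> =
     complex_of_real (1 / sqrt (2 * pi)) *
     (LINT x:{- real n..real n}|lborel. exp (- (\<i> * complex_of_real (x * \<xi>))) * f x)"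

text \<open>The transform of an L2 function is the L2 limit of the transforms of its truncations
  (unitary normalization, for which \<open>\<partial>\<^sub>x\<close> becomes multiplication by \<open>\<i> \<xi>\<close>).
  It is determined only almost everywhere; \<open>fourier_L2\<close> picks a representative,
  and everything below depends only on its almost-everywhere class.\<close>

definition is_fourier_L2 :: "(real \<Rightarrow> complex) \<Rightarrow> (real \<Rightarrow> complex) \<Rightarrow> bool" where
  "is_fourier_L2 f g \<longleftrightarrow> L2_fun g \<and>
     (\<lambda>n. \<integral>\<^sup>+ \<xi>. ennreal ((cmod (fourier_trunc n f \<xi> - g \<xi>))\<^sup>2) \<partial>lborel) \<longlonglongrightarrow> 0"

definition fourier_L2 :: "(real \<Rightarrow> complex) \<Rightarrow> real \<Rightarrow> complex" where
  "fourier_L2 f = (SOME g. is_fourier_L2 f g)"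

section \<open>Sobolev spaces\<close>

definition in_sobolev :: "real \<Rightarrow> (real \<Rightarrow> complex) \<Rightarrow> bool" where
  "in_sobolev s f \<longleftrightarrow> L2_fun f \<and>
     L2_fun (\<lambda>\<xi>. complex_of_real ((1 + \<xi>\<^sup>2) powr (s / 2)) * fourier_L2 f \<xi>)"

definition sobolev_norm :: "real \<Rightarrow> (real \<Rightarrow> complex) \<Rightarrow> real" where
  "sobolev_norm s f =
     sqrt (LINT \<xi>|lborel. (cmod (complex_of_real ((1 + \<xi>\<^sup>2) powr (s / 2)) * fourier_L2 f \<xi>))\<^sup>2)"

section \<open>The spaces of analytic functions\<close>

definition vderiv :: "(real \<Rightarrow> complex) \<Rightarrow> real \<Rightarrow> complex" where
  "vderiv f x = vector_derivative f (at x)"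

definition smooth_fun :: "(real \<Rightarrow> complex) \<Rightarrow> bool" where
  "smooth_fun f \<longleftrightarrow> (\<forall>k x. (vderiv ^^ k) f differentiable (at x))"

definition E_weight :: "real \<Rightarrow> real \<Rightarrow> (real \<Rightarrow> complex) \<Rightarrow> nat \<Rightarrow> real" where
  "E_weight \<delta> s f k =
     \<delta> ^ k * (real k + 1)\<^sup>2 * sobolev_norm s ((vderiv ^^ k) f) / fact k"

definition E_norm :: "real \<Rightarrow> real \<Rightarrow> (real \<Rightarrow> complex) \<Rightarrow> real" where
  "E_norm \<delta> s f = (SUP k. E_weight \<delta> s f k)"

text \<open>A function that is holomorphic in a complex time variable cannot take its values in a
  real Banach space, so two versions of the space are needed: \<open>E_real\<close> is the space of
  real-valued functions, and \<open>E_cplx\<close> is its complexification, i.e. the space of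
  complex-valued functions of finite norm. \<open>bdd_above\<close> says that the supremum defining
  the norm is finite.\<close>

definition E_cplx :: "real \<Rightarrow> real \<Rightarrow> (real \<Rightarrow> complex) set" where
  "E_cplx \<delta> s = {f. smooth_fun f \<and> (\<forall>k. in_sobolev s ((vderiv ^^ k) f)) \<and>
                     bdd_above (range (E_weight \<delta> s f))}"

definition E_real :: "real \<Rightarrow> real \<Rightarrow> (real \<Rightarrow> real) set" where
  "E_real \<delta> s = {f. (\<lambda>x. complex_of_real (f x)) \<in> E_cplx \<delta> s}"

section \<open>Holomorphic functions of time with values in these spaces\<close>

definition E_has_derivative ::
  "real \<Rightarrow> real \<Rightarrow> (complex \<Rightarrow> real \<Rightarrow> complex) \<Rightarrow> (real \<Rightarrow> complex) \<Rightarrow> complex \<Rightarrow> bool" where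
  "E_has_derivative \<delta> s u w t \<longleftrightarrow> w \<in> E_cplx \<delta> s \<and>
     ((\<lambda>\<tau>. E_norm \<delta> s (\<lambda>x. (u \<tau> x - u t x) / (\<tau> - t) - w x)) \<longlongrightarrow> 0) (at t)"

text \<open>Intended for open sets \<open>D\<close> only.\<close>

definition E_holomorphic_on ::
  "real \<Rightarrow> real \<Rightarrow> (complex \<Rightarrow> real \<Rightarrow> complex) \<Rightarrow> complex set \<Rightarrow> bool" where
  "E_holomorphic_on \<delta> s u D \<longleftrightarrow>
     (\<forall>t\<in>D. u t \<in> E_cplx \<delta> s \<and> (\<exists>w. E_has_derivative \<delta> s u w t))"

section \<open>The Cauchy problem\<close>

text \<open>The inverse of \<open>1 - \<partial>\<^sub>x\<^sup>2\<close> with domain the smooth functions in the Sobolev space of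
  order 2, where this operator is injective (on all smooth functions it is not).\<close>

definition helmholtz :: "(real \<Rightarrow> complex) \<Rightarrow> real \<Rightarrow> complex" where
  "helmholtz w x = w x - (vderiv ^^ 2) w x"

definition helmholtz_inv :: "(real \<Rightarrow> complex) \<Rightarrow> real \<Rightarrow> complex" where
  "helmholtz_inv = inv_into {w. smooth_fun w \<and> in_sobolev 2 w} helmholtz"

definition nonlocal_term ::
  "real \<Rightarrow> real \<Rightarrow> (real \<Rightarrow> complex) \<Rightarrow> (real \<Rightarrow> complex) \<Rightarrow> real \<Rightarrow> complex" where
  "nonlocal_term \<alpha> \<beta> u v x =
     - complex_of_real \<alpha> * u x + complex_of_real ((3 - \<beta>) / 2) * (u x)\<^sup>2
     + complex_of_real (\<beta> / 2) * (vderiv u x)\<^sup>2 + v x + 1 / 2 * (v x)\<^sup>2"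

text \<open>The time derivatives below exist, as pointwise complex derivatives, for functions that
  are holomorphic in the sense of \<open>E_holomorphic_on\<close>, because the norms dominate the
  supremum norm.\<close>

definition solves_cauchy_problem ::
  "real \<Rightarrow> real \<Rightarrow> (real \<Rightarrow> real) \<Rightarrow> (real \<Rightarrow> real) \<Rightarrow> complex set \<Rightarrow>
   (complex \<Rightarrow> real \<Rightarrow> complex) \<Rightarrow> (complex \<Rightarrow> real \<Rightarrow> complex) \<Rightarrow> bool" where
  "solves_cauchy_problem \<alpha> \<beta> u\<^sub>0 v\<^sub>0 D u v \<longleftrightarrow>
     (\<forall>t\<in>D. \<forall>x.
        deriv (\<lambda>\<tau>. u \<tau> x) t + complex_of_real \<beta> * u t x * vderiv (u t) x
          + helmholtz_inv (vderiv (nonlocal_term \<alpha> \<beta> (u t) (v t))) x = 0 \<and>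
        deriv (\<lambda>\<tau>. v \<tau> x) t + vderiv (u t) x + vderiv (\<lambda>y. u t y * v t y) x = 0) \<and>
     (\<forall>x. u 0 x = complex_of_real (u\<^sub>0 x)) \<and>
     (\<forall>x. v 0 x = complex_of_real (v\<^sub>0 x))"

text \<open>A pair is holomorphic into the direct sum of two copies of the space if and only if both
  components are holomorphic. The discs in the second clause exhaust \<open>ball 0 T\<close>.\<close>

definition holomorphic_solution ::
  "real \<Rightarrow> real \<Rightarrow> real \<Rightarrow> real \<Rightarrow> (real \<Rightarrow> real) \<Rightarrow> (real \<Rightarrow> real) \<Rightarrow> real \<Rightarrow>
   (complex \<Rightarrow> real \<Rightarrow> complex) \<Rightarrow> (complex \<Rightarrow> real \<Rightarrow> complex) \<Rightarrow> bool" where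
  "holomorphic_solution \<alpha> \<beta> \<Delta> s u\<^sub>0 v\<^sub>0 T u v \<longleftrightarrow>
     solves_cauchy_problem \<alpha> \<beta> u\<^sub>0 v\<^sub>0 (ball 0 T) u v \<and>
     (\<forall>d\<in>{0<..<1}. E_holomorphic_on (\<Delta> * d) (s + 1) u (ball 0 (T * (1 - d))) \<and>
                    E_holomorphic_on (\<Delta> * d) (s + 1) v (ball 0 (T * (1 - d))))"

end

theory Submission
  imports Defs "HOL-Complex_Analysis.Conformal_Mappings" "HOL-Probability.Levy" "HOL-Probability.Sinc_Integral"
begin

text \<open>
  In the spaces \<open>E_cplx \<delta> s\<close> a derivative costs a factor \<open>1 / (\<delta>' - \<delta>)\<close> when the parameter is lowered from
  \<open>\<delta>'\<close> to \<open>\<delta>\<close> (\<open>E_bound_vderiv\<close>). The spaces are algebras (\<open>E_bound_mult\<close>), and \<open>(1 - \<partial>\<^sub>x\<^sup>2)\<^sup>-\<^sup>1 \<partial>\<^sub>x\<close> gains one order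
  of Sobolev regularity (\<open>nonlocal_op\<close>), which pays for the derivatives in \<open>u\<^sub>x\<^sup>2\<close>. With \<open>V = (u, v)\<close> the
  system is therefore an equation \<open>V' = L V + B(V, V)\<close>, where \<open>L\<close> is linear, \<open>B\<close> is bilinear, and both map
  the space of index \<open>d'\<close> to that of index \<open>d < d'\<close> with norm at most \<open>C / (d' - d)\<close>; here the index \<open>d\<close>
  stands for the parameter \<open>\<Delta> d\<close>. Such equations admit a Cauchy--Kovalevskaya theorem.

  For existence, the solution is a power series in time, whose coefficients are given by a recursion. By
  induction, the \<open>n\<close>-th coefficient has norm at most \<open>K (M / (1 - d))\<^sup>n / (n + 1)\<^sup>2\<close> for every index \<open>d\<close>
  (\<open>coeffs_bnd\<close>): the loss of a derivative grows like \<open>n\<close> and is compensated by the division by \<open>n + 1\<close>.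
  The series converges at the index \<open>d\<close> for \<open>|t| < (1 - d) / M\<close>, which is the shape of the discs in the
  theorem (\<open>power_series_solution\<close>). The coefficients are real, hence so is the solution at real times.

  For uniqueness, the difference of two solutions satisfies a linear equation with the same loss. Iterating
  the mean value inequality shows that it vanishes near time 0 (\<open>difference_of_solutions_bnd\<close>), and the
  identity theorem extends this to the disc (\<open>solution_unique\<close>).

  The function spaces are studied on the Fourier side: \<open>f\<close> has norm at most \<open>p\<close> if and only if it is the
  inverse transform of a function \<open>G\<close> all of whose weighted \<open>L\<^sup>2\<close> norms, one for each derivative, are at most
  \<open>p\<close> (\<open>E_bound_iff_spectral\<close>). Derivatives become multiplications, products become convolutions, and
  completeness becomes Minkowski's inequality for series. The passage rests on the existence of the
  transform in \<open>L\<^sup>2\<close>, which follows from a Bessel inequality obtained with Gaussian regularization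
  (\<open>bessel_inequality\<close>, \<open>is_fourier_L2_exists\<close>), and on Fourier inversion, which is derived from Levy's
  uniqueness theorem (\<open>fourier_L2_inv_fourier\<close>, \<open>fourier_inversion\<close>).
\<close>

section \<open>Convolution sums and diagonal summation\<close>

text \<open>The double series converges absolutely by comparison with a product of convergent series, so it
  may be summed along diagonals.\<close>

lemma sums_diagonals:
  fixes f :: "nat \<Rightarrow> nat \<Rightarrow> complex"
  assumes f: "\<And>j k. cmod (f j k) \<le> p j * q k"
    and p: "\<And>j. 0 \<le> p j" "summable p" and q: "\<And>k. 0 \<le> q k" "summable q"
  shows "(\<lambda>n. \<Sum>j\<le>n. f j (n - j)) sums (\<Sum>j. \<Sum>k. f j k)"
proof -
  have q': "(q has_sum suminf q) UNIV"
    using q by (simp add: sums_nonneg_imp_has_sum summable_sums)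
  have p': "(p has_sum suminf p) UNIV"
    using p by (simp add: sums_nonneg_imp_has_sum summable_sums)
  have pq: "(\<lambda>(j,k). p j * q k) summable_on UNIV \<times> UNIV"
  proof (rule summable_on_SigmaI)
    fix j show "((\<lambda>k. case (j,k) of (j,k) \<Rightarrow> p j * q k) has_sum p j * suminf q) UNIV"
      using has_sum_cmult_right[OF q'] by simp
  next
    show "(\<lambda>j. p j * suminf q) summable_on UNIV"
      using p' by (intro summable_on_cmult_left) (auto simp: summable_on_def)
  qed (use p q in auto)
  have ab: "(\<lambda>x. norm (case x of (j,k) \<Rightarrow> f j k)) summable_on UNIV \<times> UNIV"
    by (rule summable_on_comparison_test[OF pq]) (use f in auto)
  hence fs: "(\<lambda>(j,k). f j k) summable_on UNIV \<times> UNIV"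
    by (rule abs_summable_summable)
  have inner: "infsum (f j) UNIV = (\<Sum>k. f j k)" for j
  proof -
    have "(\<lambda>k. norm (f j k)) summable_on UNIV"
      by (rule summable_on_comparison_test[where f = "\<lambda>k. p j * q k"])
         (use f has_sum_cmult_right[OF q', of "p j"] in \<open>auto simp: summable_on_def\<close>)
    hence "f j summable_on UNIV" by (rule abs_summable_summable)
    thus ?thesis
      by (metis has_sum_imp_sums has_sum_infsum sums_unique)
  qed
  have outer: "((\<lambda>j. infsum (f j) UNIV) has_sum infsum (\<lambda>(j,k). f j k) (UNIV \<times> UNIV)) UNIV"
    using has_sum_SigmaD[OF has_sum_infsum[OF fs]] 
    by (smt (verit, best) abs_summable_summable fs has_sum_infsum summable_on_SigmaD1 split_conv has_sum_cong)
  hence tot: "infsum (\<lambda>(j,k). f j k) (UNIV \<times> UNIV) = (\<Sum>j. \<Sum>k. f j k)"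
    using has_sum_imp_sums sums_unique inner by fastforce
  have bij: "bij_betw (\<lambda>(n,j). (j, n - j)) (Sigma UNIV (\<lambda>n::nat. {..n})) (UNIV \<times> UNIV)"
    by (rule bij_betwI[where g = "\<lambda>(j,k). (j+k, j)"]) auto
  have "((\<lambda>(n,j). f j (n - j)) has_sum (\<Sum>j. \<Sum>k. f j k)) (Sigma UNIV (\<lambda>n::nat. {..n}))"
    using has_sum_reindex_bij_betw[OF bij, of "\<lambda>(j,k). f j k"] has_sum_infsum[OF fs] tot
    by (simp add: case_prod_unfold)
  hence "((\<lambda>n. \<Sum>j\<le>n. f j (n - j)) has_sum (\<Sum>j. \<Sum>k. f j k)) UNIV"
    by (rule has_sum_SigmaD) (auto intro!: has_sum_finiteI)
  thus ?thesis by (rule has_sum_imp_sums)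
qed

text \<open>Since \<open>(a + b)\<^sup>2 \<le> 2 a\<^sup>2 + 2 b\<^sup>2\<close> for \<open>a = j + 1\<close> and \<open>b = n - j + 1\<close>, every summand is at
  most \<open>2 / (n + 1)\<^sup>2\<close> times the sum of two terms of the convergent series \<open>\<Sum>j. 1 / (j + 1)\<^sup>2\<close>. This is what the factors \<open>(k + 1)\<^sup>2\<close> in the norms
  are for: they make Leibniz sums and Cauchy products bounded uniformly in their length.\<close>

lemma convolution_inverse_squares:
  "(\<Sum>j\<le>n. 1 / ((real j + 1)\<^sup>2 * (real (n - j) + 1)\<^sup>2)) \<le> 8 / (real n + 1)\<^sup>2"
proof -
  have s2: "(\<Sum>j\<le>n. 1 / (real j + 1)\<^sup>2) \<le> 2" for n
  proof -
    have "(\<Sum>j\<le>n. 1 / (real j + 1)\<^sup>2) \<le> 2 - 1 / (real n + 1)"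
    proof (induction n)
      case (Suc n)
      have "1 / (real n + 2)\<^sup>2 \<le> 1 / ((real n + 1) * (real n + 2))"
        by (intro divide_left_mono) (auto simp: power2_eq_square intro!: mult_right_mono)
      also have "\<dots> = 1 / (real n + 1) - 1 / (real n + 2)" by (simp add: field_simps)
      finally show ?case using Suc by (simp add: algebra_simps)
    qed simp
    also have "\<dots> \<le> 2" by simp
    finally show ?thesis .
  qed
  have "(\<Sum>j\<le>n. 1 / ((real j + 1)\<^sup>2 * (real (n - j) + 1)\<^sup>2))
      \<le> (\<Sum>j\<le>n. (2 / (real n + 1)\<^sup>2) * (1 / (real j + 1)\<^sup>2 + 1 / (real (n - j) + 1)\<^sup>2))"
  proof (rule sum_mono)
    fix j assume "j \<in> {..n}"
    define a b where "a = real j + 1" and "b = real (n - j) + 1"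
    have ab: "a > 0" "b > 0" "a + b = real n + 2" using \<open>j \<in> {..n}\<close> by (auto simp: a_def b_def)
    have "(real n + 1)\<^sup>2 \<le> (a + b)\<^sup>2" using ab by (intro power_mono) auto
    also have "\<dots> \<le> 2 * (a\<^sup>2 + b\<^sup>2)" using sum_squares_bound[of a b] by (simp add: power2_sum)
    finally have "(real n + 1)\<^sup>2 \<le> 2 * (a\<^sup>2 + b\<^sup>2)" .
    hence "(real n + 1)\<^sup>2 / ((real n + 1)\<^sup>2 * (a\<^sup>2 * b\<^sup>2)) \<le> 2 * (a\<^sup>2 + b\<^sup>2) / ((real n + 1)\<^sup>2 * (a\<^sup>2 * b\<^sup>2))"
      by (rule divide_right_mono) simp
    thus "1 / ((real j + 1)\<^sup>2 * (real (n - j) + 1)\<^sup>2)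
       \<le> (2 / (real n + 1)\<^sup>2) * (1 / (real j + 1)\<^sup>2 + 1 / (real (n - j) + 1)\<^sup>2)"
      using ab unfolding a_def[symmetric] b_def[symmetric]
      by (simp add: field_simps)
  qed
  also have "\<dots> = (2 / (real n + 1)\<^sup>2) * ((\<Sum>j\<le>n. 1 / (real j + 1)\<^sup>2) + (\<Sum>j\<le>n. 1 / (real (n - j) + 1)\<^sup>2))"
    by (simp only: sum_distrib_left[symmetric] sum.distrib)
  also have "(\<Sum>j\<le>n. 1 / (real (n - j) + 1)\<^sup>2) = (\<Sum>j\<le>n. 1 / (real j + 1)\<^sup>2)"
    by (rule sum.reindex_bij_witness[of _ "\<lambda>j. n - j" "\<lambda>j. n - j"]) auto
  also have "(2 / (real n + 1)\<^sup>2) * ((\<Sum>j\<le>n. 1 / (real j + 1)\<^sup>2) + (\<Sum>j\<le>n. 1 / (real j + 1)\<^sup>2))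
     \<le> (2 / (real n + 1)\<^sup>2) * (2 + 2)"
    using s2[of n] by (intro mult_left_mono add_mono) auto
  finally show ?thesis by simp
qed

lemma power_ratio_le_3:
  assumes "j \<le> n"
  shows "((real n + 2) / (real n + 1)) ^ j \<le> 3"
proof -
  have "((real n + 2) / (real n + 1)) ^ j \<le> ((real n + 2) / (real n + 1)) ^ (n+1)"
    using assms by (intro power_increasing) auto
  also have "\<dots> = (1 + 1 / real (n+1)) ^ (n+1)" by (simp add: field_simps)
  also have "\<dots> \<le> exp (1 / real (n+1)) ^ (n+1)"
    by (intro power_mono exp_ge_add_one_self) auto
  also have "\<dots> = exp 1" by (subst exp_of_nat_mult[symmetric]) simp
  also have "\<dots> \<le> 3" using exp_le by simp
  finally show ?thesis .
qed

section \<open>Scales of Banach spaces\<close>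

text \<open>A decreasing scale of Banach spaces \<open>X\<^sub>d\<close> of functions, \<open>0 < d < 1\<close>. The predicate
  \<open>bnd d f p\<close> stands for \<open>f \<in> X\<^sub>d\<close> together with \<open>\<parallel>f\<parallel>\<^sub>d \<le> p\<close>. Working with bounds instead of
  norms keeps the membership conditions and the estimates in one formula. Completeness and the
  triangle inequality are both contained in \<open>bnd_suminf\<close>; \<open>bnd_eval\<close> makes convergence in any of
  the spaces imply pointwise convergence, so that series may be summed pointwise.\<close>

locale banach_scale =
  fixes bnd :: "real \<Rightarrow> ('i \<Rightarrow> complex) \<Rightarrow> real \<Rightarrow> bool"
  assumes bnd_nonneg: "bnd d f p \<Longrightarrow> 0 \<le> p"
    and bnd_weaken: "bnd d f p \<Longrightarrow> p \<le> q \<Longrightarrow> bnd d f q"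
    and bnd_closed: "(\<And>e. 0 < e \<Longrightarrow> bnd d f (p + e)) \<Longrightarrow> bnd d f p"
    and bnd_mono: "0 < d \<Longrightarrow> d \<le> d' \<Longrightarrow> d' < 1 \<Longrightarrow> bnd d' f p \<Longrightarrow> bnd d f p"
    and bnd_scale: "0 < d \<Longrightarrow> d < 1 \<Longrightarrow> bnd d f p \<Longrightarrow> bnd d (\<lambda>i. c * f i) (cmod c * p)"
    and bnd_suminf: "0 < d \<Longrightarrow> d < 1 \<Longrightarrow> (\<And>n. bnd d (a n) (r n)) \<Longrightarrow> summable r \<Longrightarrow>
           bnd d (\<lambda>i. \<Sum>n. a n i) (\<Sum>n. r n)"
    and bnd_eval: "0 < d \<Longrightarrow> d < 1 \<Longrightarrow> \<exists>K. \<forall>f p. bnd d f p \<longrightarrow> cmod (f i) \<le> K * p"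
begin

text \<open>A finite sum is a series whose other terms vanish.\<close>

lemma bnd_add:
  assumes d: "0 < d" "d < 1" and "bnd d f p" "bnd d g q"
  shows "bnd d (\<lambda>i. f i + g i) (p + q)"
proof -
  define a where "a = (\<lambda>n::nat. if n = 0 then f else if n = 1 then g else (\<lambda>i. 0))"
  define r where "r = (\<lambda>n::nat. if n = 0 then p else if n = 1 then q else 0)"
  have z: "bnd d (\<lambda>i. 0) 0" using bnd_scale[OF d assms(3), of 0] by simp
  have "bnd d (\<lambda>i. \<Sum>n. a n i) (\<Sum>n. r n)"
  proof (rule bnd_suminf[OF d])
    show "summable r" by (rule summable_finite[of "{0,1}"]) (auto simp: r_def)
  qed (use assms z in \<open>auto simp: a_def r_def\<close>)
  moreover have "(\<Sum>n. r n) = p + q"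
    by (subst suminf_finite[of "{0,1}"]) (auto simp: r_def)
  moreover have "(\<Sum>n. a n i) = f i + g i" for i
    by (subst suminf_finite[of "{0,1}"]) (auto simp: a_def)
  ultimately show ?thesis by simp
qed

lemma bnd_diff:
  assumes "0 < d" "d < 1" "bnd d f p" "bnd d g q"
  shows "bnd d (\<lambda>i. f i - g i) (p + q)"
  using bnd_add[OF assms(1-3) bnd_scale[OF assms(1,2,4), of "-1"]] by simp

lemma bnd_sum:
  assumes d: "0 < d" "d < 1" and "finite A" "A \<noteq> {}" and "\<And>j. j \<in> A \<Longrightarrow> bnd d (f j) (p j)"
  shows "bnd d (\<lambda>i. \<Sum>j\<in>A. f j i) (\<Sum>j\<in>A. p j)"
  using assms(3,4,5)
proof (induction A rule: finite_ne_induct)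
  case (insert x F)
  thus ?case using bnd_add[OF d, of "f x" "p x" "\<lambda>i. \<Sum>j\<in>F. f j i" "\<Sum>j\<in>F. p j"] by auto
qed simp

lemma bnd_summable:
  assumes d: "0 < d" "d < 1" and a: "\<And>n. bnd d (a n) (p n)" and p: "summable p"
  shows "summable (\<lambda>n. a n i)"
proof -
  obtain K where K: "\<And>f p. bnd d f p \<Longrightarrow> cmod (f i) \<le> K * p" using bnd_eval[OF d] by meson
  show ?thesis
    by (rule summable_comparison_test'[of "\<lambda>n. K * p n" 0]) (use K a p in auto)
qed

text \<open>A bounded additive operator between two members of the scale may be applied term by term,
  because it maps the tails of the series to functions of small norm.\<close>

lemma bounded_additive_sums:
  assumes d: "0 < d" "d < 1" and d': "0 < d'" "d' < 1"
    and A: "\<And>f p. bnd d' f p \<Longrightarrow> bnd d (A f) (M * p)"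
    and add: "\<And>f g p q. bnd d' f p \<Longrightarrow> bnd d' g q \<Longrightarrow> A (\<lambda>i. f i + g i) = (\<lambda>i. A f i + A g i)"
    and a: "\<And>n. bnd d' (a n) (p n)" and p: "summable p"
  shows "(\<lambda>n. A (a n) i) sums A (\<lambda>i. \<Sum>n. a n i) i"
proof -
  obtain K where K: "\<And>f p. bnd d f p \<Longrightarrow> cmod (f i) \<le> K * p" using bnd_eval[OF d] by meson
  have tail: "bnd d' (\<lambda>i. \<Sum>n. a (n + m) i) (\<Sum>n. p (n + m))" for m
    by (rule bnd_suminf[OF d']) (use a p in \<open>auto intro: summable_ignore_initial_segment\<close>)
  have eq: "A (\<lambda>i. \<Sum>n. a n i) i = (\<Sum>n<m. A (a n) i) + A (\<lambda>i. \<Sum>n. a (n + m) i) i" for m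
  proof (induction m)
    case (Suc m)
    have "(\<lambda>i. \<Sum>n. a (n + m) i) = (\<lambda>i. a m i + (\<Sum>n. a (n + Suc m) i))"
    proof
      fix i
      have "summable (\<lambda>n. a (n + m) i)"
        using bnd_summable[OF d' a p] by (rule summable_ignore_initial_segment)
      from suminf_split_head[OF this] show "(\<Sum>n. a (n + m) i) = a m i + (\<Sum>n. a (n + Suc m) i)"
        by simp
    qed
    hence "A (\<lambda>i. \<Sum>n. a (n + m) i) i = A (a m) i + A (\<lambda>i. \<Sum>n. a (n + Suc m) i) i"
      using add[OF a tail] by metis
    thus ?case using Suc by simp
  qed simp
  have "(\<lambda>m. A (\<lambda>i. \<Sum>n. a (n + m) i) i) \<longlonglongrightarrow> 0"
  proof (rule Lim_null_comparison)
    show "\<forall>\<^sub>F m in sequentially. norm (A (\<lambda>i. \<Sum>n. a (n + m) i) i) \<le> K * (M * (\<Sum>n. p (n + m)))"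
      using K[OF A[OF tail]] by simp
    have "(\<lambda>m. \<Sum>n. p (n + m)) \<longlonglongrightarrow> 0"
      by (rule suminf_exist_split2[OF p])
    thus "(\<lambda>m. K * (M * (\<Sum>n. p (n + m)))) \<longlonglongrightarrow> 0"
      by (intro tendsto_mult_right_zero)
  qed
  hence "(\<lambda>m. A (\<lambda>i. \<Sum>n. a n i) i - A (\<lambda>i. \<Sum>n. a (n + m) i) i) \<longlonglongrightarrow> A (\<lambda>i. \<Sum>n. a n i) i - 0"
    by (intro tendsto_intros)
  moreover have "(\<Sum>n<m. A (a n) i) = A (\<lambda>i. \<Sum>n. a n i) i - A (\<lambda>i. \<Sum>n. a (n + m) i) i" for m
    using eq[of m] by (simp add: algebra_simps)
  ultimately show ?thesis unfolding sums_def by simp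
qed

definition has_deriv :: "real \<Rightarrow> (complex \<Rightarrow> 'i \<Rightarrow> complex) \<Rightarrow> ('i \<Rightarrow> complex) \<Rightarrow> complex \<Rightarrow> bool" where
  "has_deriv d V W t \<longleftrightarrow> (\<exists>p. bnd d W p) \<and>
     (\<forall>\<epsilon>>0. \<forall>\<^sub>F \<tau> in at t. bnd d (\<lambda>i. (V \<tau> i - V t i) / (\<tau> - t) - W i) \<epsilon>)"

lemma has_deriv_diff:
  assumes d: "0 < d" "d < 1" and "has_deriv d U W t" "has_deriv d U' W' t"
  shows "has_deriv d (\<lambda>t i. U t i - U' t i) (\<lambda>i. W i - W' i) t"
  unfolding has_deriv_def
proof (intro conjI allI impI)
  show "\<exists>p. bnd d (\<lambda>i. W i - W' i) p" using assms bnd_diff[OF d] unfolding has_deriv_def by blast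
  fix e :: real assume "e > 0"
  hence "\<forall>\<^sub>F \<tau> in at t. bnd d (\<lambda>i. (U \<tau> i - U t i) / (\<tau> - t) - W i) (e/2)"
    "\<forall>\<^sub>F \<tau> in at t. bnd d (\<lambda>i. (U' \<tau> i - U' t i) / (\<tau> - t) - W' i) (e/2)"
    using assms(3,4) unfolding has_deriv_def by auto
  thus "\<forall>\<^sub>F \<tau> in at t. bnd d (\<lambda>i. (U \<tau> i - U' \<tau> i - (U t i - U' t i)) / (\<tau> - t) - (W i - W' i)) e"
  proof eventually_elim
    case (elim \<tau>)
    have "(\<lambda>i. (U \<tau> i - U' \<tau> i - (U t i - U' t i)) / (\<tau> - t) - (W i - W' i)) =
      (\<lambda>i. ((U \<tau> i - U t i) / (\<tau> - t) - W i) - ((U' \<tau> i - U' t i) / (\<tau> - t) - W' i))"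
      by (intro ext) (simp add: diff_divide_distrib)
    thus ?case using bnd_diff[OF d elim] by simp
  qed
qed

lemma has_deriv_imp_field_derivative:
  assumes d: "0 < d" "d < 1" and "has_deriv d V W t"
  shows "((\<lambda>t. V t i) has_field_derivative W i) (at t)"
proof -
  obtain K where K: "\<And>f p. bnd d f p \<Longrightarrow> cmod (f i) \<le> K * p" using bnd_eval[OF d] by meson
  have "((\<lambda>\<tau>. (V \<tau> i - V t i) / (\<tau> - t)) \<longlongrightarrow> W i) (at t)"
  proof (rule tendstoI)
    fix e :: real assume "e > 0"
    have "\<forall>\<^sub>F \<tau> in at t. bnd d (\<lambda>i. (V \<tau> i - V t i) / (\<tau> - t) - W i) (e / (2 * (\<bar>K\<bar> + 1)))"
      using assms(3) \<open>e > 0\<close> unfolding has_deriv_def by auto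
    thus "\<forall>\<^sub>F \<tau> in at t. dist ((V \<tau> i - V t i) / (\<tau> - t)) (W i) < e"
    proof eventually_elim
      case (elim \<tau>)
      have "cmod ((V \<tau> i - V t i) / (\<tau> - t) - W i) \<le> K * (e / (2 * (\<bar>K\<bar> + 1)))" by (rule K[OF elim])
      also have "\<dots> \<le> (\<bar>K\<bar> + 1) * (e / (2 * (\<bar>K\<bar> + 1)))"
        using \<open>e > 0\<close> by (intro mult_right_mono) auto
      also have "\<dots> < e" using \<open>e > 0\<close> by (simp add: divide_simps) 
      finally show ?case by (simp add: dist_norm)
    qed
  qed
  thus ?thesis by (simp add: has_field_derivative_iff)
qed

lemma bnd_increment:
  assumes d: "0 < d" "d < 1" and V: "has_deriv d V W t" and W: "bnd d W p" and "e > 0"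
  shows "\<exists>r>0. \<forall>\<tau>. cmod (\<tau> - t) < r \<longrightarrow> bnd d (\<lambda>i. V \<tau> i - V t i) (cmod (\<tau> - t) * (p + e))"
proof -
  have "\<forall>\<^sub>F \<tau> in at t. bnd d (\<lambda>i. (V \<tau> i - V t i) / (\<tau> - t) - W i) e"
    using V \<open>e > 0\<close> unfolding has_deriv_def by auto
  then obtain r where r: "r > 0"
    "\<And>\<tau>. \<tau> \<noteq> t \<Longrightarrow> dist \<tau> t < r \<Longrightarrow> bnd d (\<lambda>i. (V \<tau> i - V t i) / (\<tau> - t) - W i) e"
    unfolding eventually_at by auto
  have "bnd d (\<lambda>i. V \<tau> i - V t i) (cmod (\<tau> - t) * (p + e))" if "cmod (\<tau> - t) < r" for \<tau>
  proof (cases "\<tau> = t")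
    case True
    thus ?thesis using bnd_scale[OF d W, of 0] by simp
  next
    case False
    hence "bnd d (\<lambda>i. (V \<tau> i - V t i) / (\<tau> - t) - W i) e" using r that by (auto simp: dist_norm)
    from bnd_scale[OF d bnd_add[OF d W this], of "\<tau> - t"] False show ?thesis
      by simp
  qed
  thus ?thesis using r(1) by auto
qed

text \<open>The mean value inequality along a segment. The seminorms are not carried by a type, so the
  inequality is obtained by bisection: it is additive over adjacent intervals and, with an
  error of \<open>e\<close> times the length, it holds on every short interval by differentiability.\<close>

lemma mean_value_bnd:
  assumes d: "0 < d" "d < 1"
    and Z: "\<And>x. 0 \<le> x \<Longrightarrow> x \<le> 1 \<Longrightarrow> has_deriv d Z (W x) (of_real x * t)"
    and W: "\<And>x. 0 \<le> x \<Longrightarrow> x \<le> 1 \<Longrightarrow> bnd d (W x) (g' x)"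
    and g: "\<And>x. 0 \<le> x \<Longrightarrow> x \<le> 1 \<Longrightarrow> (g has_real_derivative cmod t * g' x) (at x)"
    and Z0: "Z 0 = (\<lambda>i. 0)"
  shows "bnd d (Z t) (g 1 - g 0)"
proof (rule bnd_closed)
  let ?Z = "\<lambda>y x i. Z (of_real y * t) i - Z (of_real x * t) i"
  let ?s = "\<lambda>x y. if y \<ge> x then 1 else (-1::real)"
  fix e :: real assume "e > 0"
  define P where "P = (\<lambda>a b. 0 \<le> a \<longrightarrow> b \<le> 1 \<longrightarrow>
     bnd d (?Z b a) (g b - g a + e * (b - a)))"
  have "P 0 1"
  proof (rule Bolzano)
    fix a b c assume *: "P a b" "P b c" "a \<le> b" "b \<le> c"
    show "P a c"
      unfolding P_def
    proof (intro impI)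
      assume "0 \<le> a" "c \<le> 1"
      hence "bnd d (?Z b a) (g b - g a + e * (b - a))"
         "bnd d (?Z c b) (g c - g b + e * (c - b))"
        using * unfolding P_def by auto
      from bnd_add[OF d this] 
      show "bnd d (?Z c a) (g c - g a + e * (c - a))"
        by (simp add: algebra_simps)
    qed
  next
    fix x :: real assume x: "0 \<le> x" "x \<le> 1"
    \<comment> \<open>the segment is traversed with speed \<open>cmod t\<close>; adding 1 covers \<open>t = 0\<close>\<close>
    define e1 where "e1 = e / (2 * (cmod t + 1))"
    have ct: "0 < cmod t + 1" using norm_ge_zero[of t] by linarith
    have e1: "e1 > 0" using \<open>e > 0\<close> ct by (simp add: e1_def)
    have "cmod t * e1 \<le> (cmod t + 1) * e1" using e1 by (intro mult_right_mono) auto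
    also have "\<dots> = e / 2" using ct unfolding e1_def by (simp only: times_divide_eq_right) (simp add: divide_simps)
    finally have e1': "cmod t * e1 \<le> e / 2" .
    obtain r where r: "r > 0" and rZ: "\<And>\<tau>. cmod (\<tau> - of_real x * t) < r \<Longrightarrow>
        bnd d (\<lambda>i. Z \<tau> i - Z (of_real x * t) i) (cmod (\<tau> - of_real x * t) * (g' x + e1))"
      using bnd_increment[OF d Z[OF x] W[OF x] e1] by auto
    have "((\<lambda>y. (g y - g x) / (y - x)) \<longlongrightarrow> cmod t * g' x) (at x)"
      using g[OF x] by (simp add: has_field_derivative_iff)
    hence "\<forall>\<^sub>F y in at x. dist ((g y - g x) / (y - x)) (cmod t * g' x) < e / 2"
      using \<open>e > 0\<close> by (intro tendstoD) auto
    then obtain r2 where r2: "r2 > 0" and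
      rg: "\<And>y. y \<noteq> x \<Longrightarrow> dist y x < r2 \<Longrightarrow> dist ((g y - g x) / (y - x)) (cmod t * g' x) < e / 2"
      unfolding eventually_at by auto
    have gy: "\<bar>y - x\<bar> * (cmod t * g' x) \<le> ?s x y * (g y - g x) + e / 2 * \<bar>y - x\<bar>"
      if "\<bar>y - x\<bar> < r2" for y
    proof (cases "y = x")
      case False
      hence "cmod t * g' x \<le> (g y - g x) / (y - x) + e / 2"
        using rg[OF False] that unfolding dist_real_def by linarith
      hence "\<bar>y - x\<bar> * (cmod t * g' x) \<le> \<bar>y - x\<bar> * ((g y - g x) / (y - x) + e / 2)"
        by (intro mult_left_mono) auto
      also have "\<dots> = ?s x y * (g y - g x) + e / 2 * \<bar>y - x\<bar>"
        using False by (cases "y \<ge> x") (auto simp: distrib_left abs_if divide_simps, auto simp: algebra_simps)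
      finally show ?thesis .
    qed simp
    define r3 where "r3 = min r2 (r / (cmod t + 1))"
    have small: "bnd d (?Z y x)
        (?s x y * (g y - g x) + e * \<bar>y - x\<bar>)" if "\<bar>y - x\<bar> < r3" for y
    proof -
      have nm: "cmod (of_real y * t - of_real x * t) = \<bar>y - x\<bar> * cmod t"
        by (metis left_diff_distrib norm_mult norm_of_real of_real_diff)
      have "\<bar>y - x\<bar> * cmod t \<le> \<bar>y - x\<bar> * (cmod t + 1)" by (intro mult_left_mono) auto
      also have "\<dots> < r" using that by (auto simp: r3_def pos_less_divide_eq add_nonneg_pos)
      finally have b: "bnd d (?Z y x) (\<bar>y - x\<bar> * cmod t * (g' x + e1))"
        using rZ[of "of_real y * t"] by (simp add: nm)
      have "\<bar>y - x\<bar> * cmod t * (g' x + e1) = \<bar>y - x\<bar> * (cmod t * g' x) + \<bar>y - x\<bar> * (cmod t * e1)"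
        by (simp add: algebra_simps)
      also have "\<dots> \<le> (?s x y * (g y - g x) + e / 2 * \<bar>y - x\<bar>) + \<bar>y - x\<bar> * (e / 2)"
        using gy[of y] that by (intro add_mono mult_left_mono e1') (simp_all add: r3_def)
      also have "\<dots> = ?s x y * (g y - g x) + e * \<bar>y - x\<bar>" by simp
      finally show ?thesis
        using b by (elim bnd_weaken)
    qed
    show "\<exists>r>0. \<forall>a b. a \<le> x \<and> x \<le> b \<and> b - a < r \<longrightarrow> P a b"
    proof (intro exI[of _ r3] conjI allI impI)
      show "r3 > 0" using r r2 by (auto simp: r3_def add_nonneg_pos)
      fix a b assume ab: "a \<le> x \<and> x \<le> b \<and> b - a < r3"
      have B: "bnd d (?Z b x) (g b - g x + e * (b - x))"
        using small[of b] ab by auto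
      have A: "bnd d (?Z a x) (g x - g a + e * (x - a))"
        using small[of a] ab by (cases "a = x") auto
      from bnd_diff[OF d B A] show "P a b" unfolding P_def by (simp add: algebra_simps)
    qed
  qed auto
  thus "bnd d (Z t) (g 1 - g 0 + e)" unfolding P_def using Z0 by simp
qed


end

section \<open>A Cauchy--Kovalevskaya theorem for quadratic equations\<close>

text \<open>The right-hand sides of the evolution equations \<open>V' = L V + B(V, V)\<close> considered here. The factor
  \<open>C / (d' - d)\<close> is the price of one derivative in a scale of analytic functions.\<close>

locale cauchy_kovalevskaya = banach_scale bnd
  for bnd :: "real \<Rightarrow> ('i \<Rightarrow> complex) \<Rightarrow> real \<Rightarrow> bool" +
  fixes L :: "('i \<Rightarrow> complex) \<Rightarrow> 'i \<Rightarrow> complex"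
    and B :: "('i \<Rightarrow> complex) \<Rightarrow> ('i \<Rightarrow> complex) \<Rightarrow> 'i \<Rightarrow> complex"
    and C :: real
  assumes C_pos: "0 < C"
    and L_bnd: "0 < d \<Longrightarrow> d < d' \<Longrightarrow> d' < 1 \<Longrightarrow> bnd d' f p \<Longrightarrow> bnd d (L f) (C / (d' - d) * p)"
    and B_bnd: "0 < d \<Longrightarrow> d < d' \<Longrightarrow> d' < 1 \<Longrightarrow> bnd d' f p \<Longrightarrow> bnd d' g q \<Longrightarrow>
                 bnd d (B f g) (C / (d' - d) * (p * q))"
    and L_add: "0 < d \<Longrightarrow> d < 1 \<Longrightarrow> bnd d f p \<Longrightarrow> bnd d g q \<Longrightarrow>
                 L (\<lambda>i. f i + g i) = (\<lambda>i. L f i + L g i)"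
    and L_scale: "0 < d \<Longrightarrow> d < 1 \<Longrightarrow> bnd d f p \<Longrightarrow> L (\<lambda>i. c * f i) = (\<lambda>i. c * L f i)"
    and B_add_left: "0 < d \<Longrightarrow> d < 1 \<Longrightarrow> bnd d f p \<Longrightarrow> bnd d g q \<Longrightarrow> bnd d h r \<Longrightarrow>
                 B (\<lambda>i. f i + g i) h = (\<lambda>i. B f h i + B g h i)"
    and B_add_right: "0 < d \<Longrightarrow> d < 1 \<Longrightarrow> bnd d f p \<Longrightarrow> bnd d g q \<Longrightarrow> bnd d h r \<Longrightarrow>
                 B h (\<lambda>i. f i + g i) = (\<lambda>i. B h f i + B h g i)"
    and B_scale: "0 < d \<Longrightarrow> d < 1 \<Longrightarrow> bnd d f p \<Longrightarrow> bnd d g q \<Longrightarrow>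
                 B (\<lambda>i. c * f i) (\<lambda>i. e * g i) = (\<lambda>i. c * e * B f g i)"
begin

definition solution :: "real \<Rightarrow> ('i \<Rightarrow> complex) \<Rightarrow> (complex \<Rightarrow> 'i \<Rightarrow> complex) \<Rightarrow> bool" where
  "solution T V\<^sub>0 V \<longleftrightarrow> V 0 = V\<^sub>0 \<and>
     (\<forall>d t. 0 < d \<longrightarrow> d < 1 \<longrightarrow> cmod t < T * (1 - d) \<longrightarrow>
        (\<exists>p. bnd d (V t) p) \<and> has_deriv d V (\<lambda>i. L (V t) i + B (V t) (V t) i) t)"

fun coeffs :: "('i \<Rightarrow> complex) \<Rightarrow> nat \<Rightarrow> 'i \<Rightarrow> complex" where
  "coeffs V\<^sub>0 0 = V\<^sub>0"
| "coeffs V\<^sub>0 (Suc n) =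
     (\<lambda>i. of_real (1 / real (Suc n)) *
        (L (coeffs V\<^sub>0 n) i + (\<Sum>j\<le>n. B (coeffs V\<^sub>0 j) (coeffs V\<^sub>0 (n - j)) i)))"

text \<open>The loss of one derivative per step is paid by the factor \<open>n + 1\<close> gained from integrating
  in time: the step from \<open>n\<close> to \<open>n + 1\<close> uses the intermediate index at the fraction
  \<open>1 / (n + 2)\<close> of the way from \<open>d\<close> to \<open>1\<close>. The weights \<open>1 / (n + 1)\<^sup>2\<close> are reproduced by
  the convolution sums of the bilinear term.\<close>

lemma coeffs_bnd:
  assumes K: "K > 0" and V0: "\<And>d. 0 < d \<Longrightarrow> d < 1 \<Longrightarrow> bnd d V\<^sub>0 K"
    and M: "M = 24 * C * (1 + 8 * K)"
  shows "0 < d \<Longrightarrow> d < 1 \<Longrightarrow> bnd d (coeffs V\<^sub>0 n) (K * (M / (1 - d)) ^ n / (real n + 1)\<^sup>2)"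
proof (induction n arbitrary: d rule: less_induct)
  let ?a = "coeffs V\<^sub>0"
  let ?j = "\<lambda>m j. (real j + 1)\<^sup>2 * (real (m - j) + 1)\<^sup>2"
  let ?c = "\<lambda>m q. C * (real m + 2) / q"
  case (less n)
  have Mp: "M > 0" unfolding M using C_pos K by simp
  show ?case
  proof (cases n)
    case 0
    thus ?thesis using V0 less.prems by simp
  next
    case (Suc m)
    define q where "q = 1 - d"
    define d' where "d' = d + q / (real m + 2)"
    have q: "q > 0" "q < 1" using less.prems by (auto simp: q_def)
    have d'd: "d' - d = q / (real m + 2)" by (simp add: d'_def)
    have d1: "1 - d' = q * ((real m + 1) / (real m + 2))"
      unfolding d'_def q_def by (simp add: field_simps)
    have "0 < 1 - d'" unfolding d1 using q by simp
    hence d': "d < d'" "d' < 1" "0 < d'" using q less.prems by (simp_all add: d'_def add_pos_pos)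
    define R where "R = (real m + 2) / (real m + 1)"
    have R: "R > 0" by (simp add: R_def)
    have Mq: "M / (1 - d') = M / q * R" unfolding d1 R_def by simp
    have IH: "bnd d' (?a j) (K * (M / q * R) ^ j / (real j + 1)\<^sup>2)" if "j \<le> m" for j
      using less.IH[of j d'] that Suc d' Mq by simp
    define X where "X = (M / q) ^ m"
    have X: "X > 0" using Mp q by (simp add: X_def)
    have Rm: "R ^ m \<le> 3" using power_ratio_le_3[of m m] by (simp add: R_def)
    have fac: "C / (d' - d) = ?c m q" using q by (simp add: d'd)
    have fp: "?c m q > 0" using C_pos q by simp
    have 1: "bnd d (L (?a m)) (?c m q * (K * (3 * X) / (real m + 1)\<^sup>2))"
    proof (rule bnd_weaken[OF L_bnd[OF less.prems(1) d'(1,2) IH]])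
      show "C / (d' - d) * (K * (M / q * R) ^ m / (real m + 1)\<^sup>2)
          \<le> ?c m q * (K * (3 * X) / (real m + 1)\<^sup>2)"
        unfolding fac power_mult_distrib X_def[symmetric]
        using Rm X K fp by (intro mult_left_mono divide_right_mono) (auto simp: mult.commute)
    qed simp
    have 2: "bnd d (\<lambda>i. \<Sum>j\<le>m. B (?a j) (?a (m - j)) i)
        (\<Sum>j\<le>m. ?c m q * (K\<^sup>2 * (3 * X)) * (1 / ?j m j))"
    proof (rule bnd_sum)
      fix j assume "j \<in> {..m}"
      hence j: "j \<le> m" "m - j \<le> m" by auto
      have "K * (M / q * R) ^ j / (real j + 1)\<^sup>2 * (K * (M / q * R) ^ (m - j) / (real (m - j) + 1)\<^sup>2)
         = K\<^sup>2 * (X * R ^ m) * (1 / ?j m j)"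
        using j by (simp add: power2_eq_square X_def power_mult_distrib[symmetric] power_add[symmetric])
      also have "\<dots> \<le> K\<^sup>2 * (3 * X) * (1 / ?j m j)"
        using Rm X by (intro mult_right_mono mult_left_mono) auto
      finally have "?c m q * (K * (M / q * R) ^ j / (real j + 1)\<^sup>2 * (K * (M / q * R) ^ (m - j) / (real (m - j) + 1)\<^sup>2))
        \<le> ?c m q * (K\<^sup>2 * (3 * X) * (1 / ?j m j))"
        using fp by (intro mult_left_mono) auto
      thus "bnd d (B (?a j) (?a (m - j)))
          (?c m q * (K\<^sup>2 * (3 * X)) * (1 / ?j m j))"
        using bnd_weaken[OF B_bnd[OF less.prems(1) d'(1,2) IH[OF j(1)] IH[OF j(2)]]]
        by (simp add: fac mult.assoc)
    qed (use less.prems in auto)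
    have 3: "bnd d (\<lambda>i. \<Sum>j\<le>m. B (?a j) (?a (m - j)) i)
        (?c m q * (K\<^sup>2 * (3 * X)) * (8 / (real m + 1)\<^sup>2))"
      using 2 unfolding sum_distrib_left[symmetric]
      by (rule bnd_weaken)
         (intro mult_left_mono convolution_inverse_squares mult_nonneg_nonneg less_imp_le[OF fp], use X in auto)
    have 4: "bnd d (?a n) (1 / real (Suc m) *
        (?c m q * (K * (3 * X) / (real m + 1)\<^sup>2)
          + ?c m q * (K\<^sup>2 * (3 * X)) * (8 / (real m + 1)\<^sup>2)))"
      using bnd_scale[OF less.prems bnd_add[OF less.prems 1 3], of "of_real (1 / real (Suc m))"]
      unfolding Suc coeffs.simps norm_of_real by simp
    show ?thesis
    proof (rule bnd_weaken[OF 4])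
      have eq: "1 / real (Suc m) *
        (?c m q * (K * (3 * X) / (real m + 1)\<^sup>2)
          + ?c m q * (K\<^sup>2 * (3 * X)) * (8 / (real m + 1)\<^sup>2))
        = (3 * C * K * (1 + 8 * K) * X / q) * (R * (1 / (real m + 1)\<^sup>2))"
      proof -
        have 1: "1 / real (Suc m) * (real m + 2) = R" by (simp add: R_def add.commute)
        have 2: "1 / real (Suc m) *
          (?c m q * (K * (3 * X) / (real m + 1)\<^sup>2)
          + ?c m q * (K\<^sup>2 * (3 * X)) * (8 / (real m + 1)\<^sup>2))
          = (1 / real (Suc m) * (real m + 2)) * (3 * C * K * (1 + 8 * K) * X / q * (1 / (real m + 1)\<^sup>2))"
          by (simp add: add_divide_distrib distrib_left distrib_right power2_eq_square mult_ac del: of_nat_Suc)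
        show ?thesis unfolding 2 1 by simp
      qed
      have "R \<le> 2" by (simp add: R_def field_simps)
      moreover have "1 / (real m + 1)\<^sup>2 \<le> 4 / (real m + 2)\<^sup>2"
      proof -
        have "(real m + 2)\<^sup>2 \<le> (2 * (real m + 1))\<^sup>2" by (intro power_mono) auto
        also have "\<dots> = 4 * (real m + 1)\<^sup>2" by (simp only: power_mult_distrib) simp
        finally have "1 / (4 * (real m + 1)\<^sup>2) \<le> 1 / (real m + 2)\<^sup>2"
          by (intro divide_left_mono) auto
        thus ?thesis by simp
      qed
      ultimately have "R * (1 / (real m + 1)\<^sup>2) \<le> 2 * (4 / (real m + 2)\<^sup>2)"
        by (intro mult_mono) auto
      hence "(3 * C * K * (1 + 8 * K) * X / q) * (R * (1 / (real m + 1)\<^sup>2))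
          \<le> (3 * C * K * (1 + 8 * K) * X / q) * (2 * (4 / (real m + 2)\<^sup>2))"
        using C_pos K X q by (intro mult_left_mono) auto
      also have "\<dots> = K * (M / q * X) / (real m + 2)\<^sup>2"
        by (simp add: M)
      also have "\<dots> = K * (M / (1 - d)) ^ n / (real n + 1)\<^sup>2"
        by (simp add: Suc X_def q_def add.commute)
      finally show "1 / real (Suc m) *
        (?c m q * (K * (3 * X) / (real m + 1)\<^sup>2)
          + ?c m q * (K\<^sup>2 * (3 * X)) * (8 / (real m + 1)\<^sup>2))
        \<le> K * (M / (1 - d)) ^ n / (real n + 1)\<^sup>2"
        unfolding eq .
    qed
  qed
qed

text \<open>Expanding one argument of \<open>B\<close> after the other gives an iterated series. It is dominated by a
  product, because the loss between \<open>d'\<close> and \<open>d\<close> occurs only once per term.\<close>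

lemma quadratic_term_of_series:
  assumes d: "0 < d" "d < d'" "d' < 1"
    and a: "\<And>n. bnd d' (a n) (p n)" and p: "summable p"
  shows "(\<lambda>n. \<Sum>j\<le>n. B (a j) (a (n - j)) i) sums B (\<lambda>i. \<Sum>n. a n i) (\<lambda>i. \<Sum>n. a n i) i"
proof -
  have d1: "0 < d'" "d < 1" using d by auto
  obtain E where E: "\<And>f p. bnd d f p \<Longrightarrow> cmod (f i) \<le> E * p" using bnd_eval[OF d(1) d1(2)] by meson
  define S where "S = (\<lambda>i. \<Sum>n. a n i)"
  have S: "bnd d' S (suminf p)" unfolding S_def by (rule bnd_suminf[OF d1(1) d(3) a p])
  have p0: "0 \<le> p n" for n using bnd_nonneg[OF a] .
  have 1: "(\<lambda>j. B (a j) S i) sums B (\<lambda>i. \<Sum>n. a n i) S i"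
    by (rule bounded_additive_sums[where A = "\<lambda>f. B f S" and d' = d' and d = d
          and M = "C / (d' - d) * suminf p" and p = p])
       (use d d1 a p S B_bnd[OF d _ S] B_add_left[OF d1(1) d(3) _ _ S] in \<open>auto simp: mult.commute mult.left_commute\<close>)
  have 2: "(\<lambda>k. B (a j) (a k) i) sums B (a j) (\<lambda>i. \<Sum>n. a n i) i" for j
    by (rule bounded_additive_sums[where A = "\<lambda>f. B (a j) f" and d' = d' and d = d
          and M = "C / (d' - d) * p j" and p = p])
       (use d d1 a p B_bnd[OF d a] B_add_right[OF d1(1) d(3) _ _ a] in \<open>auto simp: mult.assoc\<close>)
  have "(\<lambda>n. \<Sum>j\<le>n. B (a j) (a (n - j)) i) sums (\<Sum>j. \<Sum>k. B (a j) (a k) i)"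
  proof (rule sums_diagonals[where p = "\<lambda>j. \<bar>E * (C / (d' - d))\<bar> * p j" and q = p])
    fix j k
    have "cmod (B (a j) (a k) i) \<le> E * (C / (d' - d) * (p j * p k))"
      by (rule E[OF B_bnd[OF d a a]])
    also have "\<dots> = E * (C / (d' - d)) * (p j * p k)" by (simp only: mult.assoc)
    also have "\<dots> \<le> \<bar>E * (C / (d' - d))\<bar> * (p j * p k)"
      using p0 by (intro mult_right_mono abs_ge_self) auto
    finally show "cmod (B (a j) (a k) i) \<le> \<bar>E * (C / (d' - d))\<bar> * p j * p k" by (simp only: mult.assoc)
  qed (use p0 p in \<open>auto intro!: summable_mult\<close>)
  also have "(\<Sum>j. \<Sum>k. B (a j) (a k) i) = B S S i"
    using 1 2 unfolding S_def[symmetric] by (simp add: sums_iff)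
  finally show ?thesis by (simp add: S_def)
qed

text \<open>At the index \<open>d'\<close> and for \<open>|t| < \<rho>\<close>, the terms of the series are dominated by those of a geometric series
  with ratio \<open>M \<rho> / (1 - d')\<close>. If \<open>|t| < (1 - d) / M\<close>, there is room for \<open>\<rho> > |t|\<close> and \<open>d' > d\<close> such
  that this ratio is still below 1, and \<open>L\<close> and \<open>B\<close> may then be applied term by term from \<open>d'\<close> to \<open>d\<close>. The
  remainder of the difference quotient of \<open>t\<^sup>n\<close> contributes a factor of order \<open>n\<^sup>2\<close>, which the
  weights \<open>1 / (n + 1)\<^sup>2\<close> absorb.\<close>

lemma power_series_solution:
  assumes K: "K > 0" and V0: "\<And>d. 0 < d \<Longrightarrow> d < 1 \<Longrightarrow> bnd d V\<^sub>0 K"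
    and M: "M = 24 * C * (1 + 8 * K)"
  shows "solution (1 / M) V\<^sub>0 (\<lambda>t i. \<Sum>n. t ^ n * coeffs V\<^sub>0 n i)"
proof -
  define a where "a = coeffs V\<^sub>0"
  define V where "V = (\<lambda>t i. \<Sum>n. t ^ n * a n i)"
  have Mp: "M > 0" unfolding M using C_pos K by simp
  have a: "bnd d (a n) (K * (M / (1 - d)) ^ n / (real n + 1)\<^sup>2)" if "0 < d" "d < 1" for d n
    unfolding a_def by (rule coeffs_bnd[OF K V0 M that])
  have V00: "V 0 = V\<^sub>0"
  proof
    fix i have "V 0 i = (\<Sum>n. if n = 0 then a 0 i else 0)"
      unfolding V_def by (intro suminf_cong) auto
    also have "\<dots> = a 0 i" by (subst suminf_finite[of "{0}"]) auto
    finally show "V 0 i = V\<^sub>0 i" by (simp add: a_def)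
  qed
  have main: "(\<exists>p. bnd d (V t) p) \<and> has_deriv d V (\<lambda>i. L (V t) i + B (V t) (V t) i) t"
    if d: "0 < d" "d < 1" and t: "cmod t < 1 / M * (1 - d)" for d t
  proof -
    \<comment> \<open>a radius beyond \<open>t\<close> and an index beyond \<open>d\<close> for which the majorants still converge\<close>
    obtain \<rho> where \<rho>: "cmod t < \<rho>" "\<rho> < 1 / M * (1 - d)" using dense[OF t] by auto
    have \<rho>0: "\<rho> > 0" using \<rho>(1) norm_ge_zero[of t] by linarith
    have "M * \<rho> < 1 - d" using \<rho>(2) Mp by (simp add: field_simps)
    hence "d < 1 - M * \<rho>" by simp
    then obtain d' where d': "d < d'" "d' < 1 - M * \<rho>" using dense by blast
    have "0 < M * \<rho>" using Mp \<rho>0 by simp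
    hence d'1: "d' < 1" "0 < d'" using d' d by auto
    define r where "r = \<rho> * (M / (1 - d'))"
    have r: "0 \<le> r" "r < 1" using d' d'1 Mp \<rho>0 by (auto simp: r_def field_simps)
    have r_eq: "\<rho> ^ n * (M / (1 - d')) ^ n = r ^ n" for n unfolding r_def by (rule power_mult_distrib[symmetric])
    have sr: "summable (\<lambda>n. K * r ^ n)" using r by (intro summable_mult summable_geometric) auto
    have tb: "bnd d' (\<lambda>i. \<tau> ^ n * a n i) (K * r ^ n)" if "cmod \<tau> \<le> \<rho>" for \<tau> n
    proof (rule bnd_weaken[OF bnd_scale[OF d'1(2,1) a[OF d'1(2,1)]]])
      have "cmod (\<tau> ^ n) * (K * (M / (1 - d')) ^ n / (real n + 1)\<^sup>2)
         \<le> \<rho> ^ n * (K * (M / (1 - d')) ^ n / 1)"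
        using that K Mp d'1 \<rho>0 by (intro mult_mono divide_left_mono) (auto simp: norm_power power_mono)
      thus "cmod (\<tau> ^ n) * (K * (M / (1 - d')) ^ n / (real n + 1)\<^sup>2) \<le> K * r ^ n"
        by (simp add: r_eq[symmetric] mult_ac)
    qed
    have Vb: "bnd d' (V \<tau>) (\<Sum>n. K * r ^ n)" if "cmod \<tau> \<le> \<rho>" for \<tau>
      unfolding V_def by (rule bnd_suminf[OF d'1(2,1) tb[OF that] sr])
    have Vs: "summable (\<lambda>n. \<tau> ^ n * a n i)" if "cmod \<tau> \<le> \<rho>" for \<tau> i
      by (rule bnd_summable[OF d'1(2,1) tb[OF that] sr])
    define W where "W = (\<lambda>i. \<Sum>n. of_nat n * t ^ (n - Suc 0) * a n i)"
    have W_sums: "(\<lambda>n. of_nat n * t ^ (n - Suc 0) * a n i) sums (L (V t) i + B (V t) (V t) i)" for i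
    proof -
      have 1: "(\<lambda>n. L (\<lambda>i. t ^ n * a n i) i) sums L (V t) i"
        unfolding V_def
        by (rule bounded_additive_sums[where A = L and d' = d' and d = d
          and M = "C / (d' - d)" and p = "\<lambda>n. K * r ^ n"])
         (use d d' d'1 tb[of t] \<rho> sr L_bnd[OF d(1) d'(1) d'1(1)] L_add[OF d'1(2,1)] in auto)
      have 2: "(\<lambda>n. \<Sum>j\<le>n. B (\<lambda>i. t ^ j * a j i) (\<lambda>i. t ^ (n - j) * a (n - j) i) i) sums B (V t) (V t) i"
        unfolding V_def
        by (rule quadratic_term_of_series[where d = d and d' = d' and p = "\<lambda>n. K * r ^ n"])
           (use d d' d'1 tb[of t] \<rho> sr in auto)
      have e: "L (\<lambda>i. t ^ n * a n i) i + (\<Sum>j\<le>n. B (\<lambda>i. t ^ j * a j i) (\<lambda>i. t ^ (n - j) * a (n - j) i) i)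
         = of_nat (Suc n) * t ^ n * a (Suc n) i" for n
      proof -
        have "L (\<lambda>i. t ^ n * a n i) i = t ^ n * L (a n) i"
          using L_scale[OF d a[OF d]] by simp
        moreover have "(\<Sum>j\<le>n. B (\<lambda>i. t ^ j * a j i) (\<lambda>i. t ^ (n - j) * a (n - j) i) i)
            = (\<Sum>j\<le>n. t ^ n * B (a j) (a (n - j)) i)"
          by (intro sum.cong refl) 
             (use B_scale[OF d a[OF d] a[OF d]] in \<open>simp add: power_add[symmetric]\<close>)
        ultimately show ?thesis
          by (simp add: a_def sum_distrib_left[symmetric] distrib_left del: of_nat_Suc)
      qed
      have "(\<lambda>n. of_nat (Suc n) * t ^ n * a (Suc n) i) sums (L (V t) i + B (V t) (V t) i)"
        using sums_add[OF 1 2] by (simp only: e)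
      thus ?thesis
        using sums_Suc_iff[of "\<lambda>n. of_nat n * t ^ (n - Suc 0) * a n i" "L (V t) i + B (V t) (V t) i"] by simp
    qed
    hence W_eq: "W = (\<lambda>i. L (V t) i + B (V t) (V t) i)"
      unfolding W_def by (intro ext sums_unique[symmetric])
    have Wp: "bnd d W (C / (d' - d) * (\<Sum>n. K * r ^ n) + C / (d' - d) * ((\<Sum>n. K * r ^ n) * (\<Sum>n. K * r ^ n)))"
      unfolding W_eq using \<rho> d d' d'1
      by (intro bnd_add L_bnd B_bnd Vb) auto
    have quot: "bnd d' (\<lambda>i. (V \<tau> i - V t i) / (\<tau> - t) - W i) (cmod (\<tau> - t) * ((\<Sum>n. K * r ^ n) / \<rho>\<^sup>2))"
      if \<tau>: "\<tau> \<noteq> t" "cmod \<tau> \<le> \<rho>" for \<tau>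
    proof -
      define c where "c = (\<lambda>n. (\<tau> ^ n - t ^ n) / (\<tau> - t) - of_nat n * t ^ (n - Suc 0))"
      have "bnd d' (\<lambda>i. \<Sum>n. c n * a n i) (\<Sum>n. cmod (\<tau> - t) / \<rho>\<^sup>2 * (K * r ^ n))"
      proof (rule bnd_suminf[OF d'1(2,1)])
        fix n
        have "cmod (c n) \<le> of_nat n * of_nat (n - Suc 0) * \<rho> ^ (n - 2) * cmod (\<tau> - t)"
          using lemma_termdiff3[of "\<tau> - t" t \<rho> n] \<tau> \<rho> by (simp add: c_def)
        also have "\<dots> \<le> (real n + 1)\<^sup>2 * (\<rho> ^ n / \<rho>\<^sup>2) * cmod (\<tau> - t)"
        proof (cases "n \<ge> 2")
          case True
          have "\<rho> ^ (n - 2) = \<rho> ^ n / \<rho>\<^sup>2" using True \<rho>0 by (simp add: power_diff)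
          moreover have "real n * real (n - Suc 0) \<le> (real n + 1) * (real n + 1)" by (intro mult_mono) auto
          ultimately show ?thesis using \<rho>0
            by (simp only:) (intro mult_right_mono, auto simp: power2_eq_square)
        next
          case False
          hence "n = 0 \<or> n = 1" by auto
          thus ?thesis using \<rho>0 by auto
        qed
        finally have c: "cmod (c n) \<le> (real n + 1)\<^sup>2 * (\<rho> ^ n / \<rho>\<^sup>2) * cmod (\<tau> - t)" .
        show "bnd d' (\<lambda>i. c n * a n i) (cmod (\<tau> - t) / \<rho>\<^sup>2 * (K * r ^ n))"
        proof (rule bnd_weaken[OF bnd_scale[OF d'1(2,1) a[OF d'1(2,1)]]])
          have "cmod (c n) * (K * (M / (1 - d')) ^ n / (real n + 1)\<^sup>2)
              \<le> (real n + 1)\<^sup>2 * (\<rho> ^ n / \<rho>\<^sup>2) * cmod (\<tau> - t) * (K * (M / (1 - d')) ^ n / (real n + 1)\<^sup>2)"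
            using c K Mp d'1 by (intro mult_right_mono) auto
          also have "\<dots> = cmod (\<tau> - t) / \<rho>\<^sup>2 * (K * (\<rho> ^ n * (M / (1 - d')) ^ n))"
            by (simp add: field_simps)
          finally show "cmod (c n) * (K * (M / (1 - d')) ^ n / (real n + 1)\<^sup>2)
              \<le> cmod (\<tau> - t) / \<rho>\<^sup>2 * (K * r ^ n)" by (simp only: r_eq)
        qed
      qed (intro summable_mult sr)
      moreover have "(\<Sum>n. cmod (\<tau> - t) / \<rho>\<^sup>2 * (K * r ^ n)) = cmod (\<tau> - t) * ((\<Sum>n. K * r ^ n) / \<rho>\<^sup>2)"
        by (subst suminf_mult[OF sr]) simp
      moreover have "(\<Sum>n. c n * a n i) = (V \<tau> i - V t i) / (\<tau> - t) - W i" for i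
      proof -
        have "(\<lambda>n. (\<tau> ^ n * a n i - t ^ n * a n i) / (\<tau> - t) - of_nat n * t ^ (n - Suc 0) * a n i) sums
            ((V \<tau> i - V t i) / (\<tau> - t) - W i)"
          unfolding V_def W_def using \<tau> \<rho> sums_summable[OF W_sums]
          by (intro sums_diff sums_divide summable_sums Vs) auto
        moreover have "(\<tau> ^ n * a n i - t ^ n * a n i) / (\<tau> - t) - of_nat n * t ^ (n - Suc 0) * a n i = c n * a n i" for n
          by (simp add: c_def algebra_simps diff_divide_distrib)
        ultimately show ?thesis by (simp add: sums_unique[symmetric])
      qed
      ultimately show ?thesis by simp
    qed
    have "has_deriv d V W t"
      unfolding has_deriv_def
    proof (intro conjI allI impI)
      show "\<exists>p. bnd d W p" using Wp by blast
      fix e :: real assume "e > 0"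
      have "((\<lambda>\<tau>. cmod (\<tau> - t) * ((\<Sum>n. K * r ^ n) / \<rho>\<^sup>2)) \<longlongrightarrow> cmod (t - t) * ((\<Sum>n. K * r ^ n) / \<rho>\<^sup>2)) (at t)"
        by (intro tendsto_intros)
      hence "\<forall>\<^sub>F \<tau> in at t. cmod (\<tau> - t) * ((\<Sum>n. K * r ^ n) / \<rho>\<^sup>2) < e"
        by (rule order_tendstoD) (use \<open>e > 0\<close> in simp)
      moreover have "\<forall>\<^sub>F \<tau> in at t. \<tau> \<noteq> t" by (simp add: eventually_at_filter)
      moreover have "\<forall>\<^sub>F \<tau> in at t. cmod \<tau> < \<rho>"
        by (rule order_tendstoD[OF tendsto_norm[OF tendsto_ident_at]]) (use \<rho> in auto)
      ultimately show "\<forall>\<^sub>F \<tau> in at t. bnd d (\<lambda>i. (V \<tau> i - V t i) / (\<tau> - t) - W i) e"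
      proof eventually_elim
        case (elim \<tau>)
        have "bnd d' (\<lambda>i. (V \<tau> i - V t i) / (\<tau> - t) - W i) e"
          using bnd_weaken[OF quot] elim by (simp add: less_imp_le)
        thus ?case using bnd_mono[of d d'] d d' d'1 by simp
      qed
    qed
    moreover have "\<exists>p. bnd d (V t) p"
      using bnd_mono[OF d(1) less_imp_le[OF d'(1)] d'1(1) Vb[OF less_imp_le[OF \<rho>(1)]]] by blast
    ultimately show ?thesis by (simp add: W_eq)
  qed
  show ?thesis
    unfolding solution_def a_def[symmetric] V_def[symmetric] using V00 main by blast
qed

lemma coeffs_summable:
  assumes K: "K > 0" and V0: "\<And>d. 0 < d \<Longrightarrow> d < 1 \<Longrightarrow> bnd d V\<^sub>0 K"
    and M: "M = 24 * C * (1 + 8 * K)" and t: "cmod t < 1 / M"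
  shows "summable (\<lambda>n. t ^ n * coeffs V\<^sub>0 n i)"
proof -
  have Mp: "M > 0" unfolding M using C_pos K by simp
  have "cmod t * M < 1" using t Mp by (simp add: field_simps)
  then obtain d where d: "0 < d" "d < 1 - cmod t * M" using dense[of 0 "1 - cmod t * M"] by auto
  have "0 \<le> cmod t * M" using Mp by (intro mult_nonneg_nonneg) auto
  hence d1: "d < 1" using d by linarith
  define r where "r = cmod t * (M / (1 - d))"
  have r: "0 \<le> r" "r < 1" using d d1 Mp by (auto simp: r_def field_simps)
  have r_eq: "cmod t ^ n * (M / (1 - d)) ^ n = r ^ n" for n unfolding r_def by (rule power_mult_distrib[symmetric])
  show ?thesis
  proof (rule bnd_summable[OF d(1) d1])
    fix n
    show "bnd d (\<lambda>i. t ^ n * coeffs V\<^sub>0 n i) (K * r ^ n)"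
    proof (rule bnd_weaken[OF bnd_scale[OF d(1) d1 coeffs_bnd[OF K V0 M d(1) d1]]])
      have "cmod (t ^ n) * (K * (M / (1 - d)) ^ n / (real n + 1)\<^sup>2) \<le> cmod (t ^ n) * (K * (M / (1 - d)) ^ n / 1)"
        using K Mp d1 by (intro mult_left_mono divide_left_mono) auto
      thus "cmod (t ^ n) * (K * (M / (1 - d)) ^ n / (real n + 1)\<^sup>2) \<le> K * r ^ n"
        by (simp add: r_eq[symmetric] norm_power mult_ac)
    qed
  qed (use r in \<open>intro summable_mult summable_geometric, auto\<close>)
qed

lemma coeffs_in_real_subspace:
  assumes d: "0 < d" "d < 1" and K: "K > 0" and V0: "\<And>d. 0 < d \<Longrightarrow> d < 1 \<Longrightarrow> bnd d V\<^sub>0 K"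
    and V0_real: "\<And>i. V\<^sub>0 i \<in> \<real>"
    and L_real: "\<And>f p i. bnd d f p \<Longrightarrow> (\<And>i. f i \<in> \<real>) \<Longrightarrow> L f i \<in> \<real>"
    and B_real: "\<And>f p g q i. bnd d f p \<Longrightarrow> bnd d g q \<Longrightarrow> (\<And>i. f i \<in> \<real>) \<Longrightarrow> (\<And>i. g i \<in> \<real>) \<Longrightarrow> B f g i \<in> \<real>"
  shows "coeffs V\<^sub>0 n i \<in> \<real>"
proof (induction n arbitrary: i rule: less_induct)
  case (less n)
  note b = coeffs_bnd[OF K V0 refl d]
  show ?case
  proof (cases n)
    case (Suc m)
    have "L (coeffs V\<^sub>0 m) i \<in> \<real>" by (rule L_real[OF b less.IH]) (auto simp: Suc)
    moreover have "B (coeffs V\<^sub>0 j) (coeffs V\<^sub>0 (m - j)) i \<in> \<real>" if "j \<le> m" for j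
      by (rule B_real[OF b b less.IH less.IH]) (use that Suc in auto)
    ultimately show ?thesis unfolding Suc coeffs.simps
      by (intro Reals_mult Reals_add Reals_of_real sum_in_Reals) auto
  qed (use V0_real in auto)
qed


text \<open>Two solutions have the same germ at time 0. Their difference solves a linear equation, and
  integrating the estimate for its derivative again and again gives the bounds below; they tend to
  0 with \<open>n\<close> once \<open>t\<close> is small. The splitting of the interval from \<open>d\<close> to \<open>1/2\<close>
  is the one used for the coefficients.\<close>

lemma difference_of_solutions_bnd:
  assumes Z: "\<And>d t. 0 < d \<Longrightarrow> d < 1/2 \<Longrightarrow> cmod t < r \<Longrightarrow> has_deriv d Z (W t) t"
    and W: "\<And>d d' t p. 0 < d \<Longrightarrow> d < d' \<Longrightarrow> d' < 1/2 \<Longrightarrow> cmod t < r \<Longrightarrow> bnd d' (Z t) p \<Longrightarrow>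
              bnd d (W t) (E / (d' - d) * p)"
    and E: "E > 0"
    and Zb: "\<And>d t. 0 < d \<Longrightarrow> d < 1/2 \<Longrightarrow> cmod t < r \<Longrightarrow> bnd d (Z t) Q" and Q: "Q \<ge> 0"
    and Z0: "Z 0 = (\<lambda>i. 0)"
  shows "0 < d \<Longrightarrow> d < 1/2 \<Longrightarrow> cmod t < r \<Longrightarrow> bnd d (Z t) (Q * (6 * E * cmod t / (1/2 - d)) ^ n)"
proof (induction n arbitrary: d t)
  case 0
  thus ?case using Zb by simp
next
  case (Suc n)
  define q where "q = 1/2 - d"
  define R where "R = (real n + 2) / (real n + 1)"
  define d' where "d' = d + q / (real n + 2)"
  have q: "q > 0" using Suc.prems by (simp add: q_def)
  have d'd: "d' - d = q / (real n + 2)" by (simp add: d'_def)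
  have d1: "1/2 - d' = q / R"
    unfolding d'_def q_def R_def by (simp add: field_simps)
  have "0 < 1/2 - d'" unfolding d1 using q by (simp add: R_def)
  hence d': "d < d'" "d' < 1/2" "0 < d'" using q Suc.prems by (simp_all add: d'_def add_pos_pos)
  define c where "c = E / (d' - d) * (Q * (6 * E * cmod t / (1/2 - d')) ^ n)"
  have "bnd d (Z t) ((\<lambda>x. cmod t * c * x ^ (Suc n) / real (Suc n)) 1 - (\<lambda>x. cmod t * c * x ^ (Suc n) / real (Suc n)) 0)"
  proof (rule mean_value_bnd[where W = "\<lambda>x. W (of_real x * t)" and g' = "\<lambda>x. c * x ^ n"])
    fix x :: real assume x: "0 \<le> x" "x \<le> 1"
    have xt: "cmod (of_real x * t) = x * cmod t" using x by (simp add: norm_mult)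
    have "x * cmod t \<le> 1 * cmod t" using x by (intro mult_right_mono) auto
    hence xr: "cmod (of_real x * t) < r" using Suc.prems by (simp add: xt)
    show "has_deriv d Z (W (of_real x * t)) (of_real x * t)"
      using Z Suc.prems xr by simp
    have "bnd d (W (of_real x * t)) (E / (d' - d) * (Q * (6 * E * (x * cmod t) / (1/2 - d')) ^ n))"
      using W[OF Suc.prems(1) d'(1,2) xr Suc.IH[OF d'(3,2) xr]] by (simp only: xt)
    thus "bnd d (W (of_real x * t)) (c * x ^ n)"
      by (simp add: c_def power_mult_distrib power_divide mult_ac)
    show "((\<lambda>x. cmod t * c * x ^ Suc n / real (Suc n)) has_real_derivative cmod t * (c * x ^ n)) (at x)"
      by (rule derivative_eq_intros refl | simp)+
  qed (use Suc.prems Z0 in auto)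
  moreover have "cmod t * c / real (Suc n) \<le> Q * (6 * E * cmod t / (1/2 - d)) ^ Suc n"
  proof -
    define X where "X = (6 * E * cmod t / q) ^ n"
    have X: "X \<ge> 0" using E q by (simp add: X_def)
    have Rn: "R ^ n \<le> 3" using power_ratio_le_3[of n n] by (simp add: R_def)
    have R2: "0 \<le> R" "R \<le> 2" by (auto simp: R_def field_simps)
    have "6 * E * cmod t / (1/2 - d') = 6 * E * cmod t / q * R" by (simp add: d1)
    hence "c = E * (real n + 2) / q * (Q * (X * R ^ n))"
      unfolding c_def d'd X_def power_mult_distrib[symmetric] by simp
    moreover have "real n + 2 = R * real (Suc n)" by (simp add: R_def add.commute)
    ultimately have "cmod t * c / real (Suc n) = (E * cmod t / q * Q * X) * (R * R ^ n)"
      by simp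
    also have "\<dots> \<le> (E * cmod t / q * Q * X) * (2 * 3)"
      using E q Q X Rn R2 by (intro mult_left_mono mult_mono) auto
    also have "\<dots> = Q * (6 * E * cmod t / q) ^ Suc n" by (simp add: X_def)
    finally show ?thesis by (simp add: q_def)
  qed
  ultimately show ?case by (elim bnd_weaken) simp
qed

text \<open>Both solutions are bounded near time 0 at the index \<open>1/2\<close>, so their difference obeys the bounds of
  \<open>difference_of_solutions_bnd\<close> and vanishes near 0. Its values at a fixed point form a scalar
  holomorphic function on the whole disc, which therefore vanishes by the identity theorem.\<close>

lemma solution_unique:
  assumes T: "T > 0" and V: "solution T V\<^sub>0 V" and V': "solution T V\<^sub>0 V'" and t: "cmod t < T"
  shows "V t = V' t"
proof
  fix i
  have sol: "\<exists>p. bnd d (U t) p" "has_deriv d U (\<lambda>i. L (U t) i + B (U t) (U t) i) t"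
    if "solution T V\<^sub>0 U" "0 < d" "d < 1" "cmod t < T * (1 - d)" for U d t
    using that unfolding solution_def by blast+
  have U0: "U 0 = V\<^sub>0" if "solution T V\<^sub>0 U" for U using that by (simp add: solution_def)
  have half: "\<exists>r>0. \<exists>p. \<forall>\<tau>. cmod \<tau> < r \<longrightarrow> bnd (1/2) (U \<tau>) p" if U: "solution T V\<^sub>0 U" for U
  proof -
    have s: "has_deriv (1/2) U (\<lambda>i. L (U 0) i + B (U 0) (U 0) i) 0" "\<exists>p. bnd (1/2) (U 0) p"
      using sol[OF U, of "1/2" 0] T by auto
    then obtain p where p: "bnd (1/2) (U 0) p" by blast
    from s(1) obtain w where w: "bnd (1/2) (\<lambda>i. L (U 0) i + B (U 0) (U 0) i) w"
      unfolding has_deriv_def by blast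
    have w0: "0 \<le> w" using bnd_nonneg[OF w] .
    from bnd_increment[OF _ _ s(1) w, of 1] obtain r where r: "r > 0"
      "\<And>\<tau>. cmod \<tau> < r \<Longrightarrow> bnd (1/2) (\<lambda>i. U \<tau> i - U 0 i) (cmod \<tau> * (w + 1))" by auto
    have "bnd (1/2) (U \<tau>) (p + r * (w + 1))" if "cmod \<tau> < r" for \<tau>
    proof -
      have "bnd (1/2) (U \<tau>) (p + cmod \<tau> * (w + 1))"
        using bnd_add[OF _ _ p r(2)[OF that]] by simp
      moreover have "cmod \<tau> * (w + 1) \<le> r * (w + 1)" using that w0 by (intro mult_right_mono) auto
      ultimately show ?thesis by (elim bnd_weaken) simp
    qed
    thus ?thesis using r(1) by blast
  qed
  obtain r1 p1 where 1: "r1 > 0" "\<And>\<tau>. cmod \<tau> < r1 \<Longrightarrow> bnd (1/2) (V \<tau>) p1" using half[OF V] by blast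
  obtain r2 p2 where 2: "r2 > 0" "\<And>\<tau>. cmod \<tau> < r2 \<Longrightarrow> bnd (1/2) (V' \<tau>) p2" using half[OF V'] by blast
  define r where "r = min (T / 2) (min r1 r2)"
  have r: "r > 0" "r \<le> T / 2" using T 1 2 by (auto simp: r_def)
  have Vb: "bnd d (V \<tau>) p1" "bnd d (V' \<tau>) p2" if "cmod \<tau> < r" "0 < d" "d \<le> 1/2" for \<tau> d
    using 1 2 that bnd_mono[of d "1/2"] by (auto simp: r_def)
  have p: "0 \<le> p1" "0 \<le> p2" using bnd_nonneg Vb[of 0 "1/2"] r by auto
  define Z where "Z = (\<lambda>t i. V t i - V' t i)"
  define W where "W = (\<lambda>t i. L (V t) i + B (V t) (V t) i - (L (V' t) i + B (V' t) (V' t) i))"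
  define E where "E = C * (1 + p1 + p2)"
  have Ep: "E > 0" using C_pos p by (simp add: E_def)
  have Zb: "bnd d (Z \<tau>) (p1 + p2)" if "0 < d" "d < 1/2" "cmod \<tau> < r" for d :: real and \<tau>
    unfolding Z_def using that by (intro bnd_diff Vb) auto
  have decay: "bnd d (Z \<tau>) ((p1 + p2) * (6 * E * cmod \<tau> / (1/2 - d)) ^ n)"
    if "0 < d" "d < 1/2" "cmod \<tau> < r" for d :: real and \<tau> n
  proof (rule difference_of_solutions_bnd[where r = r and W = W])
    fix d :: real and \<tau> assume d: "0 < d" "d < 1/2" and \<tau>: "cmod \<tau> < r"
    have "T * (1/2) \<le> T * (1 - d)" using T d by (intro mult_left_mono) auto
    hence "cmod \<tau> < T * (1 - d)" using \<tau> r by linarith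
    thus "has_deriv d Z (W \<tau>) \<tau>"
      unfolding Z_def W_def using d by (intro has_deriv_diff sol V V') auto
  next
    fix d d' :: real and \<tau> p assume d: "0 < d" "d < d'" "d' < 1/2" and \<tau>: "cmod \<tau> < r" and Zp: "bnd d' (Z \<tau>) p"
    have d1: "d < 1" "d' < 1" "0 < d'" using d by auto
    have b: "bnd d' (V \<tau>) p1" "bnd d' (V' \<tau>) p2" using Vb[OF \<tau>, of d'] d by auto
    have VZ: "V \<tau> = (\<lambda>i. Z \<tau> i + V' \<tau> i)" by (auto simp: Z_def)
    have "L (V \<tau>) = (\<lambda>i. L (Z \<tau>) i + L (V' \<tau>) i)"
      using L_add[OF d1(3,2) Zp b(2)] VZ by simp
    moreover have "B (V \<tau>) (V \<tau>) = (\<lambda>i. B (V \<tau>) (Z \<tau>) i + B (V \<tau>) (V' \<tau>) i)"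
      using B_add_right[OF d1(3,2) Zp b(2) b(1)] VZ by simp
    moreover have "B (V \<tau>) (V' \<tau>) = (\<lambda>i. B (Z \<tau>) (V' \<tau>) i + B (V' \<tau>) (V' \<tau>) i)"
      using B_add_left[OF d1(3,2) Zp b(2) b(2)] VZ by simp
    ultimately have W_eq: "W \<tau> = (\<lambda>i. L (Z \<tau>) i + B (V \<tau>) (Z \<tau>) i + B (Z \<tau>) (V' \<tau>) i)"
      by (auto simp: W_def algebra_simps)
    have "bnd d (W \<tau>) (C / (d' - d) * p + C / (d' - d) * (p1 * p) + C / (d' - d) * (p * p2))"
      unfolding W_eq by (intro bnd_add L_bnd B_bnd d d1 b Zp)
    moreover have "C / (d' - d) * p + C / (d' - d) * (p1 * p) + C / (d' - d) * (p * p2) = E / (d' - d) * p"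
      by (simp add: E_def distrib_left distrib_right add_divide_distrib mult_ac)
    ultimately show "bnd d (W \<tau>) (E / (d' - d) * p)" by simp
  qed (use Ep Zb p that U0[OF V] U0[OF V'] in \<open>auto simp: Z_def\<close>)
  define \<epsilon> where "\<epsilon> = min r (1 / (24 * E))"
  have \<epsilon>: "\<epsilon> > 0" using r Ep by (simp add: \<epsilon>_def)
  \<comment> \<open>the index \<open>1/4\<close> stays away from \<open>1/2\<close>, so for small times the ratio of the geometric bound is below 1\<close>
  have near0: "V \<tau> i = V' \<tau> i" if \<tau>: "cmod \<tau> < \<epsilon>" for \<tau>
  proof -
    define y where "y = 6 * E * cmod \<tau> / (1/2 - 1/4)"
    have "cmod \<tau> < 1 / (24 * E)" using \<tau> by (simp add: \<epsilon>_def)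
    hence y: "0 \<le> y" "y < 1" using Ep by (auto simp: y_def field_simps)
    have lim: "(\<lambda>n. (p1 + p2) * y ^ n) \<longlonglongrightarrow> (p1 + p2) * 0"
      using y by (intro tendsto_intros LIMSEQ_power_zero) auto
    have "bnd (1/4) (Z \<tau>) 0"
    proof (rule bnd_closed)
      fix e :: real assume "e > 0"
      have "eventually (\<lambda>n. (p1 + p2) * y ^ n < e) sequentially"
        using lim by (rule order_tendstoD) (use \<open>e > 0\<close> in simp)
      then obtain n where n: "(p1 + p2) * y ^ n < e" by (meson eventually_sequentially order_refl)
      have "bnd (1/4) (Z \<tau>) ((p1 + p2) * y ^ n)"
        using decay[of "1/4" \<tau> n] \<tau> by (simp add: y_def \<epsilon>_def)
      thus "bnd (1/4) (Z \<tau>) (0 + e)"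
        using n by (elim bnd_weaken) simp
    qed
    moreover obtain K where "\<And>f p. bnd (1/4) f p \<Longrightarrow> cmod (f i) \<le> K * p"
      using bnd_eval[of "1/4" i] by auto
    ultimately have "cmod (Z \<tau> i) \<le> K * 0" by blast
    thus ?thesis by (simp add: Z_def)
  qed
  have der: "((\<lambda>t. V t i - V' t i) has_field_derivative W t i) (at t)" if "cmod t < T" for t
  proof -
    define d where "d = (1 - cmod t / T) / 2"
    have "0 \<le> cmod t / T" "cmod t / T < 1" using that T by auto
    hence d: "0 < d" "d < 1" by (auto simp: d_def)
    have "T * (1 - d) = (T + cmod t) / 2" using T by (simp add: d_def field_simps)
    hence "cmod t < T * (1 - d)" using that by simp
    hence "has_deriv d (\<lambda>t i. V t i - V' t i) (W t) t"
      unfolding W_def using d by (intro has_deriv_diff sol V V') auto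
    thus ?thesis by (rule has_deriv_imp_field_derivative[OF d])
  qed
  have "(\<lambda>t. V t i - V' t i) t = 0"
  proof (rule analytic_continuation[where f = "\<lambda>t. V t i - V' t i" and S = "ball 0 T" and U = "ball 0 (min \<epsilon> T)" and \<xi> = 0])
    show "(\<lambda>t. V t i - V' t i) holomorphic_on ball 0 T"
    proof (rule holomorphic_onI)
      fix z :: complex assume "z \<in> ball 0 T"
      hence "cmod z < T" by simp
      from has_field_derivative_at_within[OF der[OF this]]
      show "(\<lambda>t. V t i - V' t i) field_differentiable at z within ball 0 T"
        unfolding field_differentiable_def by blast
    qed
    show "(0::complex) islimpt ball 0 (min \<epsilon> T)" using \<epsilon> T by (simp add: islimpt_ball)
  qed (use T t near0 in auto)
  thus "V t i = V' t i" by simp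
qed

end

section \<open>Inequalities for integrals of squares\<close>

lemma two_mult_le_squares_ennreal: "2 * (a * b) \<le> a ^ 2 + (b::ennreal) ^ 2"
proof (cases a; cases b)
  fix x y assume "0 \<le> x" "0 \<le> y" and ab: "a = ennreal x" "b = ennreal y"
  moreover have "2 * (x * y) \<le> x ^ 2 + y ^ 2" using sum_squares_bound[of x y] by simp
  ultimately show ?thesis
    by (simp add: ennreal_power flip: ennreal_mult ennreal_plus ennreal_numeral)
qed (auto simp: power2_eq_square)

text \<open>Integrating \<open>2 a b \<le> a\<^sup>2 + b\<^sup>2\<close> with \<open>a = f x * g y\<close> and \<open>b = f y * g x\<close> over the product space gives
  the inequality with no case distinction for infinite integrals. Counting measures are
  included, which gives the version for series.\<close>

lemma nn_integral_Cauchy_Schwarz: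
  fixes f g :: "'a \<Rightarrow> ennreal"
  assumes M: "sigma_finite_measure M" and [measurable]: "f \<in> borel_measurable M" "g \<in> borel_measurable M"
  shows "(\<integral>\<^sup>+x. f x * g x \<partial>M) ^ 2 \<le> (\<integral>\<^sup>+x. f x ^ 2 \<partial>M) * (\<integral>\<^sup>+x. g x ^ 2 \<partial>M)"
proof -
  interpret sigma_finite_measure M by fact
  let ?A = "\<integral>\<^sup>+x. f x ^ 2 \<partial>M" and ?B = "\<integral>\<^sup>+x. g x ^ 2 \<partial>M"
  have "2 * (\<integral>\<^sup>+x. f x * g x \<partial>M) ^ 2 = (\<integral>\<^sup>+x. \<integral>\<^sup>+y. 2 * ((f x * g y) * (f y * g x)) \<partial>M \<partial>M)"
    by (simp add: power2_eq_square nn_integral_cmult nn_integral_multc mult_ac flip: nn_integral_cmult nn_integral_multc)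
  also have "\<dots> \<le> (\<integral>\<^sup>+x. \<integral>\<^sup>+y. (f x * g y) ^ 2 + (f y * g x) ^ 2 \<partial>M \<partial>M)"
    by (intro nn_integral_mono two_mult_le_squares_ennreal)
  also have "\<dots> = (\<integral>\<^sup>+x. f x ^ 2 * ?B + ?A * g x ^ 2 \<partial>M)"
    by (simp add: power_mult_distrib nn_integral_add nn_integral_cmult nn_integral_multc)
  also have "\<dots> = 2 * (?A * ?B)"
    by (simp add: nn_integral_add nn_integral_cmult nn_integral_multc mult_2)
  finally have "2 * (\<integral>\<^sup>+x. f x * g x \<partial>M) ^ 2 \<le> 2 * (?A * ?B)" .
  thus ?thesis by (subst (asm) ennreal_mult_le_mult_iff) auto
qed

text \<open>Minkowski's inequality in \<open>L\<^sup>2\<close> for countably many functions. The Cauchy--Schwarz inequality for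
  the summation, with weights \<open>q n\<close>, bounds the square of the sum by a series that can be
  integrated term by term. The weights have to be positive, so they are taken slightly larger
  than \<open>p n\<close>, with a total excess that tends to 0.\<close>

lemma nn_integral_suminf_square_le:
  fixes h :: "nat \<Rightarrow> 'a \<Rightarrow> ennreal"
  assumes [measurable]: "\<And>n. h n \<in> borel_measurable M"
    and h: "\<And>n. (\<integral>\<^sup>+x. h n x ^ 2 \<partial>M) \<le> ennreal ((p n)\<^sup>2)"
    and p: "\<And>n. 0 \<le> p n" "summable p"
  shows "(\<integral>\<^sup>+x. (\<Sum>n. h n x) ^ 2 \<partial>M) \<le> ennreal ((suminf p)\<^sup>2)"
proof -
  have pos: "(\<integral>\<^sup>+x. (\<Sum>n. h n x) ^ 2 \<partial>M) \<le> ennreal ((suminf q)\<^sup>2)"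
    if q: "\<And>n. 0 < q n" "summable q" "\<And>n. p n \<le> q n" for q
  proof -
    have q0: "0 \<le> q n" for n using q(1)[of n] by simp
    have sq: "(\<Sum>n. ennreal (q n)) = ennreal (suminf q)" 
      by (rule suminf_ennreal2[OF q0 q(2)])
    have cs: "(\<Sum>n. h n x) ^ 2 \<le> ennreal (suminf q) * (\<Sum>n. h n x ^ 2 * ennreal (1 / q n))" for x
    proof -
      have e1: "ennreal (sqrt (q n)) ^ 2 = ennreal (q n)" for n
        using q0 by (simp add: ennreal_power)
      have e2: "ennreal (1 / sqrt (q n)) ^ 2 = ennreal (1 / q n)" for n
        using q0 by (simp add: ennreal_power power_divide)
      have e3: "ennreal (sqrt (q n)) * (h n x * ennreal (1 / sqrt (q n))) = h n x" for n
      proof -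
        have "ennreal (sqrt (q n)) * ennreal (1 / sqrt (q n)) = 1"
          using q(1)[of n] by (simp flip: ennreal_mult)
        thus ?thesis by (metis mult.left_commute mult.right_neutral)
      qed
      have "(\<Sum>n. h n x) ^ 2 = (\<integral>\<^sup>+n. ennreal (sqrt (q n)) * (h n x * ennreal (1 / sqrt (q n))) \<partial>count_space UNIV) ^ 2"
        by (simp add: e3 nn_integral_count_space_nat)
      also have "\<dots> \<le> (\<integral>\<^sup>+n. ennreal (sqrt (q n)) ^ 2 \<partial>count_space UNIV) *
           (\<integral>\<^sup>+n. (h n x * ennreal (1 / sqrt (q n))) ^ 2 \<partial>count_space UNIV)"
        by (intro nn_integral_Cauchy_Schwarz sigma_finite_measure_count_space) auto
      also have "\<dots> = ennreal (suminf q) * (\<Sum>n. h n x ^ 2 * ennreal (1 / q n))"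
        by (simp add: e1 e2 power_mult_distrib nn_integral_count_space_nat sq)
      finally show ?thesis .
    qed
    have "(\<integral>\<^sup>+x. (\<Sum>n. h n x) ^ 2 \<partial>M) \<le> (\<integral>\<^sup>+x. ennreal (suminf q) * (\<Sum>n. h n x ^ 2 * ennreal (1 / q n)) \<partial>M)"
      by (intro nn_integral_mono cs)
    also have "\<dots> = ennreal (suminf q) * (\<Sum>n. (\<integral>\<^sup>+x. h n x ^ 2 \<partial>M) * ennreal (1 / q n))"
      by (simp add: nn_integral_cmult nn_integral_suminf nn_integral_multc)
    also have "\<dots> \<le> ennreal (suminf q) * (\<Sum>n. ennreal (q n))"
    proof (intro mult_left_mono suminf_le)
      fix n
      have "(\<integral>\<^sup>+x. h n x ^ 2 \<partial>M) * ennreal (1 / q n) \<le> ennreal ((q n)\<^sup>2) * ennreal (1 / q n)"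
        using h[of n] power_mono[OF q(3)[of n] p(1), of 2] 
        by (intro mult_right_mono) (auto intro: order_trans ennreal_leI)
      also have "\<dots> = ennreal (q n)" using q(1)[of n] by (simp add: power2_eq_square flip: ennreal_mult)
      finally show "(\<integral>\<^sup>+x. h n x ^ 2 \<partial>M) * ennreal (1 / q n) \<le> ennreal (q n)" .
    qed auto
    also have "\<dots> = ennreal ((suminf q)\<^sup>2)"
      using suminf_nonneg[OF q(2) q0] by (simp add: sq power2_eq_square ennreal_mult)
    finally show ?thesis .
  qed
  have "(\<integral>\<^sup>+x. (\<Sum>n. h n x) ^ 2 \<partial>M) \<le> ennreal ((suminf p + e * 2)\<^sup>2)" if "e > 0" for e
  proof -
    have s: "summable (\<lambda>n. e * (1/2::real) ^ n)" by (intro summable_mult summable_geometric) auto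
    have "(\<Sum>n. p n + e * (1/2) ^ n) = suminf p + e * 2"
      using suminf_add[OF p(2) s] suminf_mult[of "\<lambda>n. (1/2::real) ^ n" e]
      by (simp add: suminf_geometric summable_geometric)
    moreover have "(\<integral>\<^sup>+x. (\<Sum>n. h n x) ^ 2 \<partial>M) \<le> ennreal ((\<Sum>n. p n + e * (1/2) ^ n)\<^sup>2)"
      using p that by (intro pos summable_add s) (auto intro: add_nonneg_pos)
    ultimately show ?thesis by simp
  qed
  moreover have "((\<lambda>e. ennreal ((suminf p + e * 2)\<^sup>2)) \<longlongrightarrow> ennreal ((suminf p + 0 * 2)\<^sup>2)) (at_right 0)"
    by (intro tendsto_ennrealI tendsto_intros)
  moreover have "eventually (\<lambda>e. (\<integral>\<^sup>+x. (\<Sum>n. h n x) ^ 2 \<partial>M) \<le> ennreal ((suminf p + e * 2)\<^sup>2)) (at_right 0)"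
    using calculation(1) by (auto simp: eventually_at_right_field intro: exI[of _ 1])
  ultimately show ?thesis
    by (intro tendsto_lowerbound) auto
qed

section \<open>The Fourier transform of square-integrable functions\<close>

definition inv_fourier :: "(real \<Rightarrow> complex) \<Rightarrow> real \<Rightarrow> complex" where
  "inv_fourier G x = complex_of_real (1 / sqrt (2 * pi)) * (LINT \<xi>|lborel. G \<xi> * cis (x * \<xi>))"

text \<open>The square of the \<open>L\<^sup>2\<close> norm, as an extended real number, so that estimates need no prior proof of
  integrability.\<close>

definition L2_sq :: "(real \<Rightarrow> complex) \<Rightarrow> ennreal" where
  "L2_sq G = (\<integral>\<^sup>+x. ennreal ((cmod (G x))\<^sup>2) \<partial>lborel)"

lemma cis_measurable [measurable]: "cis \<in> borel_measurable borel"
  by (intro borel_measurable_continuous_onI continuous_on_cis continuous_on_id)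

lemma cnj_measurable [measurable]: "cnj \<in> borel_measurable borel"
  by (intro borel_measurable_continuous_onI continuous_on_cnj continuous_on_id)

lemma L2_fun_iff: "L2_fun f \<longleftrightarrow> f \<in> borel_measurable lborel \<and> L2_sq f < \<infinity>"
  unfolding L2_fun_def L2_sq_def by (auto simp: integrable_iff_bounded)

lemma integrable_mult_cis:
  fixes G :: "real \<Rightarrow> complex"
  assumes "integrable lborel G"
  shows "integrable lborel (\<lambda>\<xi>. G \<xi> * cis (x * \<xi>))"
proof (rule Bochner_Integration.integrable_bound[OF integrable_norm[OF assms]])
  have [measurable]: "G \<in> borel_measurable borel" using borel_measurable_integrable[OF assms] by simp
  show "(\<lambda>\<xi>. G \<xi> * cis (x * \<xi>)) \<in> borel_measurable lborel" by measurable
qed (auto simp: norm_mult)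

lemma norm_inv_fourier_le:
  assumes "integrable lborel G"
  shows "cmod (inv_fourier G x) \<le> (LINT \<xi>|lborel. cmod (G \<xi>))"
proof -
  have "cmod (LINT \<xi>|lborel. G \<xi> * cis (x * \<xi>)) \<le> (LINT \<xi>|lborel. cmod (G \<xi> * cis (x * \<xi>)))"
    by (rule integral_norm_bound)
  also have "\<dots> = (LINT \<xi>|lborel. cmod (G \<xi>))" by (simp add: norm_mult)
  finally have "cmod (LINT \<xi>|lborel. G \<xi> * cis (x * \<xi>)) \<le> (LINT \<xi>|lborel. cmod (G \<xi>))" .
  moreover have "1 \<le> sqrt (2 * pi)" using pi_ge_two by simp
  ultimately show ?thesis unfolding inv_fourier_def norm_mult norm_of_real
    using mult_mono[of "\<bar>1 / sqrt (2 * pi)\<bar>" 1 "cmod (LINT \<xi>|lborel. G \<xi> * cis (x * \<xi>))" "LINT \<xi>|lborel. cmod (G \<xi>)"]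
    by (simp add: divide_simps)
qed

lemma continuous_on_inv_fourier:
  assumes "integrable lborel G"
  shows "continuous_on UNIV (inv_fourier G)"
proof -
  have [measurable]: "G \<in> borel_measurable borel" using borel_measurable_integrable[OF assms] by simp
  have "((\<lambda>x. LINT \<xi>|lborel. G \<xi> * cis (x * \<xi>)) \<longlongrightarrow> (LINT \<xi>|lborel. G \<xi> * cis (a * \<xi>))) (at a)" for a
    unfolding tendsto_at_iff_sequentially comp_def
  proof (intro allI impI)
    fix X :: "nat \<Rightarrow> real" assume "X \<longlonglongrightarrow> a"
    thus "(\<lambda>n. LINT \<xi>|lborel. G \<xi> * cis (X n * \<xi>)) \<longlonglongrightarrow> (LINT \<xi>|lborel. G \<xi> * cis (a * \<xi>))"
      by (intro integral_dominated_convergence[OF _ _ integrable_norm[OF assms]])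
         (auto simp: norm_mult intro!: AE_I2 tendsto_intros continuous_on_tendsto_compose[OF continuous_on_cis[OF continuous_on_id]])
  qed
  thus ?thesis unfolding inv_fourier_def continuous_on_def
    by (auto intro!: tendsto_intros)
qed

lemma inv_fourier_measurable [measurable]:
  "integrable lborel G \<Longrightarrow> inv_fourier G \<in> borel_measurable borel"
  by (intro borel_measurable_continuous_onI continuous_on_inv_fourier)

lemma integrable_mult_inv_fourier:
  assumes f: "integrable lborel f" and g: "integrable lborel g"
  shows "integrable lborel (\<lambda>x. f x * inv_fourier g x)"
proof (rule Bochner_Integration.integrable_bound)
  have [measurable]: "f \<in> borel_measurable borel" using borel_measurable_integrable[OF f] by simp
  note [measurable] = inv_fourier_measurable[OF g]
  show "integrable lborel (\<lambda>x. (LINT \<xi>|lborel. cmod (g \<xi>)) * cmod (f x))"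
    using f by (intro integrable_mult_right integrable_norm)
  show "(\<lambda>x. f x * inv_fourier g x) \<in> borel_measurable lborel" by measurable
  have "cmod (f x * inv_fourier g x) \<le> cmod (f x) * (LINT \<xi>|lborel. cmod (g \<xi>))" for x
    unfolding norm_mult using norm_inv_fourier_le[OF g] by (intro mult_left_mono) auto
  thus "AE x in lborel. norm (f x * inv_fourier g x) \<le> norm ((LINT \<xi>|lborel. cmod (g \<xi>)) * cmod (f x))"
    by (intro AE_I2) (simp add: mult.commute)
qed

text \<open>Both sides are the same absolutely convergent double integral.\<close>

lemma multiplication_formula:
  assumes f: "integrable lborel f" and g: "integrable lborel g"
  shows "(LINT x|lborel. f x * inv_fourier g x) = (LINT x|lborel. g x * inv_fourier f x)"
proof -
  have [measurable]: "f \<in> borel_measurable borel" "g \<in> borel_measurable borel"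
    using borel_measurable_integrable[OF f] borel_measurable_integrable[OF g] by auto
  let ?F = "\<lambda>x y. f x * g y * cis (x * y)"
  have "integrable (lborel \<Otimes>\<^sub>M lborel) (\<lambda>(x,y). ?F x y)"
  proof (rule lborel_pair.Fubini_integrable)
    show "integrable lborel (\<lambda>x. LINT y|lborel. norm (case (x,y) of (x,y) \<Rightarrow> ?F x y))"
      using f by (simp add: norm_mult)
    show "AE x in lborel. integrable lborel (\<lambda>y. case (x,y) of (x,y) \<Rightarrow> ?F x y)"
      using integrable_mult_cis[OF g] by (simp add: mult.assoc)
  qed (simp add: case_prod_unfold)
  from lborel_pair.Fubini_integral[OF this]
  have "(LINT y|lborel. LINT x|lborel. ?F x y) = (LINT x|lborel. LINT y|lborel. ?F x y)" by simp
  moreover have "(LINT x|lborel. ?F x y) = g y * (LINT x|lborel. f x * cis (y * x))" for y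
    by (subst integral_mult_right_zero[symmetric]) (simp add: mult_ac)
  moreover have "(LINT y|lborel. ?F x y) = f x * (LINT y|lborel. g y * cis (x * y))" for x
    by (subst integral_mult_right_zero[symmetric]) (simp add: mult_ac)
  ultimately have "(LINT y|lborel. g y * (LINT x|lborel. f x * cis (y * x))) =
       (LINT x|lborel. f x * (LINT y|lborel. g y * cis (x * y)))" by simp
  hence "complex_of_real (1 / sqrt (2 * pi)) * (LINT y|lborel. g y * (LINT x|lborel. f x * cis (y * x))) =
       complex_of_real (1 / sqrt (2 * pi)) * (LINT x|lborel. f x * (LINT y|lborel. g y * cis (x * y)))" by simp
  thus ?thesis
    unfolding inv_fourier_def integral_mult_right_zero[symmetric] by (simp add: mult_ac)
qed

lemma integrable_exp_square: "0 < \<sigma> \<Longrightarrow> integrable lborel (\<lambda>x::real. exp (- (\<sigma> * x)\<^sup>2 / 2))"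
proof -
  assume "0 < \<sigma>"
  have "(\<lambda>x. sqrt (2 * pi) / \<sigma> * normal_density 0 (1 / \<sigma>) x) = (\<lambda>x::real. exp (- (\<sigma> * x)\<^sup>2 / 2))"
    using \<open>0 < \<sigma>\<close> by (auto simp: normal_density_def real_sqrt_divide power_mult_distrib field_simps real_sqrt_mult)
  moreover have "integrable lborel (\<lambda>x. sqrt (2 * pi) / \<sigma> * normal_density 0 (1 / \<sigma>) x)"
    using \<open>0 < \<sigma>\<close> by (intro integrable_mult_right integrable_normal_density) auto
  ultimately show ?thesis by simp
qed

text \<open>The characteristic function of the standard normal distribution, rescaled.\<close>

lemma fourier_integral_exp_square:
  assumes "0 < \<sigma>"
  shows "(LINT x|lborel. complex_of_real (exp (- (\<sigma> * x)\<^sup>2 / 2)) * cis (x * y))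
           = of_real (sqrt (2 * pi) / \<sigma> * exp (- (y / \<sigma>)\<^sup>2 / 2))"
proof -
  have std: "(LINT x|lborel. complex_of_real (exp (- x\<^sup>2 / 2)) * cis (x * t)) = of_real (sqrt (2 * pi) * exp (- t\<^sup>2 / 2))" for t
  proof -
    have "char std_normal_distribution t = (LINT x|lborel. std_normal_density x *\<^sub>R iexp (t * x))"
      unfolding char_def by (subst integral_density) (auto simp: normal_density_nonneg)
    also have "\<dots> = (LINT x|lborel. of_real (1 / sqrt (2 * pi)) * (complex_of_real (exp (- x\<^sup>2 / 2)) * cis (x * t)))"
      by (intro Bochner_Integration.integral_cong refl)
         (simp add: std_normal_density_def cis_conv_exp scaleR_conv_of_real mult_ac)
    finally have "complex_of_real (exp (- t\<^sup>2 / 2)) =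
        of_real (1 / sqrt (2 * pi)) * (LINT x|lborel. complex_of_real (exp (- x\<^sup>2 / 2)) * cis (x * t))"
      by (simp add: char_std_normal_distribution)
    hence "of_real (sqrt (2 * pi)) * complex_of_real (exp (- t\<^sup>2 / 2)) =
        of_real (sqrt (2 * pi) * (1 / sqrt (2 * pi))) * (LINT x|lborel. complex_of_real (exp (- x\<^sup>2 / 2)) * cis (x * t))"
      by simp
    thus ?thesis by simp
  qed
  have "(LINT x|lborel. complex_of_real (exp (- x\<^sup>2 / 2)) * cis (x * (y / \<sigma>)))
      = \<bar>\<sigma>\<bar> *\<^sub>R (LINT x|lborel. complex_of_real (exp (- (0 + \<sigma> * x)\<^sup>2 / 2)) * cis ((0 + \<sigma> * x) * (y / \<sigma>)))"
    using assms by (intro lborel_integral_real_affine) auto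
  hence "of_real (sqrt (2 * pi) * exp (- (y / \<sigma>)\<^sup>2 / 2))
      = complex_of_real \<sigma> * (LINT x|lborel. complex_of_real (exp (- (\<sigma> * x)\<^sup>2 / 2)) * cis (x * y))"
    using assms unfolding std by (simp add: scaleR_conv_of_real)
  hence "complex_of_real (1 / \<sigma>) * of_real (sqrt (2 * pi) * exp (- (y / \<sigma>)\<^sup>2 / 2))
      = complex_of_real (1 / \<sigma> * \<sigma>) * (LINT x|lborel. complex_of_real (exp (- (\<sigma> * x)\<^sup>2 / 2)) * cis (x * y))"
    by (simp only: mult.assoc of_real_mult)
  thus ?thesis using assms by simp
qed

text \<open>With a Gaussian factor \<open>exp (- (\<sigma> x)\<^sup>2 / 2)\<close> inserted, the integral of \<open>|inv_fourier G|\<^sup>2\<close> becomes, by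
  two applications of the multiplication formula, a double integral of \<open>G \<xi> * G' \<eta>\<close> against
  the normal density of \<open>\<xi> + \<eta>\<close>. Because the density has total mass 1, the inequality
  \<open>2 a b \<le> a\<^sup>2 + b\<^sup>2\<close> bounds it by the square of the norm of \<open>G\<close>, uniformly in \<open>\<sigma>\<close>. Fatou's lemma
  removes the Gaussian factor.\<close>

lemma bessel_inequality:
  assumes G: "integrable lborel G"
  shows "L2_sq (inv_fourier G) \<le> L2_sq G"
proof -
  let ?e = "\<lambda>\<sigma> x::real. exp (- (\<sigma> * x)\<^sup>2 / 2)"
  have [measurable]: "G \<in> borel_measurable borel" using borel_measurable_integrable[OF G] by simp
  define g where "g = inv_fourier G"
  have [measurable]: "g \<in> borel_measurable borel" unfolding g_def by (rule inv_fourier_measurable[OF G])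
  \<comment> \<open>conjugation of the transform of \<open>G\<close> amounts to replacing \<open>G\<close> by \<open>G'\<close>\<close>
  define G' where "G' = (\<lambda>\<eta>. cnj (G (- \<eta>)))"
  have [measurable]: "G' \<in> borel_measurable borel" unfolding G'_def by measurable
  have G': "integrable lborel G'"
    unfolding G'_def using lborel_integrable_real_affine[OF G, of "-1" 0] by simp
  have nnG': "L2_sq G' = L2_sq G"
    unfolding L2_sq_def G'_def
    using nn_integral_real_affine[of "\<lambda>x. ennreal ((cmod (G x))\<^sup>2)" "-1" 0] by simp
  have cnj_g: "cnj (g x) = inv_fourier G' x" for x
  proof -
    have "cnj (LINT \<xi>|lborel. G \<xi> * cis (x * \<xi>)) = (LINT \<xi>|lborel. cnj (G \<xi>) * cis (- (x * \<xi>)))"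
      by (subst Bochner_Integration.integral_cnj[symmetric]) (simp add: cis_cnj)
    also have "\<dots> = (LINT \<xi>|lborel. G' \<xi> * cis (x * \<xi>))"
      using lborel_integral_real_affine[of "-1" "\<lambda>\<xi>. cnj (G \<xi>) * cis (- (x * \<xi>))" 0]
      by (simp add: G'_def)
    finally show ?thesis by (simp add: g_def inv_fourier_def)
  qed
  have reg: "(\<integral>\<^sup>+x. ennreal ((cmod (g x))\<^sup>2 * ?e \<sigma> x) \<partial>lborel) \<le> L2_sq G" if \<sigma>: "\<sigma> > 0" for \<sigma>
  proof -
    define \<gamma> where "\<gamma> = (\<lambda>x. complex_of_real (?e \<sigma> x))"
    have \<gamma>: "integrable lborel \<gamma>"
      unfolding \<gamma>_def using integrable_exp_square[OF \<sigma>] by (intro integrable_of_real)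
    have [measurable]: "\<gamma> \<in> borel_measurable borel" unfolding \<gamma>_def by measurable
    define h where "h = (\<lambda>x. \<gamma> x * inv_fourier G' x)"
    have h: "integrable lborel h" unfolding h_def by (rule integrable_mult_inv_fourier[OF \<gamma> G'])
    have h_hat: "inv_fourier h \<xi> = (LINT \<eta>|lborel. G' \<eta> * of_real (normal_density 0 \<sigma> (\<xi> + \<eta>)))" for \<xi>
    proof -
      have k: "integrable lborel (\<lambda>x. \<gamma> x * cis (\<xi> * x))" by (rule integrable_mult_cis[OF \<gamma>])
      have k_hat: "inv_fourier (\<lambda>x. \<gamma> x * cis (\<xi> * x)) \<eta> = of_real (exp (- ((\<xi> + \<eta>) / \<sigma>)\<^sup>2 / 2) / \<sigma>)" for \<eta>
      proof -
        have "(LINT x|lborel. \<gamma> x * cis (\<xi> * x) * cis (\<eta> * x)) = (LINT x|lborel. \<gamma> x * cis (x * (\<xi> + \<eta>)))"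
          by (intro Bochner_Integration.integral_cong refl) (simp add: mult.assoc cis_mult algebra_simps)
        also have "\<dots> = of_real (sqrt (2 * pi) / \<sigma> * exp (- ((\<xi> + \<eta>) / \<sigma>)\<^sup>2 / 2))"
          unfolding \<gamma>_def by (rule fourier_integral_exp_square[OF \<sigma>])
        finally show ?thesis unfolding inv_fourier_def by simp
      qed
      have "inv_fourier h \<xi> = of_real (1 / sqrt (2 * pi)) * (LINT x|lborel. \<gamma> x * cis (\<xi> * x) * inv_fourier G' x)"
        unfolding inv_fourier_def[of h] by (simp add: h_def mult_ac)
      also have "(LINT x|lborel. \<gamma> x * cis (\<xi> * x) * inv_fourier G' x)
          = (LINT \<eta>|lborel. G' \<eta> * of_real (exp (- ((\<xi> + \<eta>) / \<sigma>)\<^sup>2 / 2) / \<sigma>))"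
        using multiplication_formula[OF k G'] by (simp add: k_hat)
      also have "of_real (1 / sqrt (2 * pi)) * \<dots> = (LINT \<eta>|lborel. G' \<eta> * of_real (normal_density 0 \<sigma> (\<xi> + \<eta>)))"
        by (subst integral_mult_right_zero[symmetric])
           (use \<sigma> in \<open>simp add: normal_density_def real_sqrt_mult power_divide mult_ac\<close>)
      finally show ?thesis .
    qed
    have nd: "(\<integral>\<^sup>+x. ennreal (normal_density 0 \<sigma> (a + x)) \<partial>lborel) = 1" for a
    proof -
      have "(\<integral>\<^sup>+x. ennreal (normal_density 0 \<sigma> x) \<partial>lborel) = 1"
        using \<sigma> by (subst nn_integral_eq_integral) (auto simp: normal_density_nonneg)
      thus ?thesis using nn_integral_real_affine[of "\<lambda>x. ennreal (normal_density 0 \<sigma> x)" 1 a] by simp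
    qed
    have nd': "(\<integral>\<^sup>+x. ennreal (normal_density 0 \<sigma> (x + a)) \<partial>lborel) = 1" for a
      using nd[of a] by (simp add: add.commute)
    have eq: "complex_of_real ((cmod (g x))\<^sup>2 * ?e \<sigma> x) = h x * inv_fourier G x" for x
      by (simp add: h_def \<gamma>_def cnj_g[symmetric] g_def[symmetric] complex_norm_square mult_ac del: of_real_power)
    have int: "integrable lborel (\<lambda>x. (cmod (g x))\<^sup>2 * ?e \<sigma> x)"
      using integrable_mult_inv_fourier[OF h G] unfolding eq[symmetric] by (simp only: complex_of_real_integrable_eq)
    have "(\<integral>\<^sup>+x. ennreal ((cmod (g x))\<^sup>2 * ?e \<sigma> x) \<partial>lborel)
        = ennreal (LINT x|lborel. (cmod (g x))\<^sup>2 * ?e \<sigma> x)"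
      by (rule nn_integral_eq_integral[OF int]) auto
    also have "\<dots> = ennreal (cmod (LINT x|lborel. complex_of_real ((cmod (g x))\<^sup>2 * ?e \<sigma> x)))"
      unfolding integral_complex_of_real norm_of_real by (simp add: abs_of_nonneg integral_nonneg_AE)
    also have "\<dots> = ennreal (cmod (LINT x|lborel. G x * inv_fourier h x))"
      unfolding eq by (simp only: multiplication_formula[OF h G])
    also have "\<dots> \<le> (\<integral>\<^sup>+x. ennreal (cmod (G x * inv_fourier h x)) \<partial>lborel)"
      by (rule integral_norm_bound_ennreal[OF integrable_mult_inv_fourier[OF G h]])
    also have "\<dots> \<le> (\<integral>\<^sup>+\<xi>. \<integral>\<^sup>+\<eta>. ennreal (cmod (G \<xi>)) * (ennreal (cmod (G' \<eta>)) * ennreal (normal_density 0 \<sigma> (\<xi> + \<eta>))) \<partial>lborel \<partial>lborel)"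
    proof (rule nn_integral_mono)
      fix \<xi>
      have int2: "integrable lborel (\<lambda>\<eta>. G' \<eta> * of_real (normal_density 0 \<sigma> (\<xi> + \<eta>)))"
      proof (rule Bochner_Integration.integrable_bound[OF integrable_mult_right[OF integrable_norm[OF G'], of "1 / (\<sigma> * sqrt (2 * pi))"]])
        have nb: "normal_density 0 \<sigma> z \<le> 1 / (\<sigma> * sqrt (2 * pi))" for z
          using \<sigma> by (simp add: normal_density_def real_sqrt_mult divide_simps)
        show "AE x in lborel. norm (G' x * complex_of_real (normal_density 0 \<sigma> (\<xi> + x))) \<le> norm (1 / (\<sigma> * sqrt (2 * pi)) * cmod (G' x))"
          using \<sigma> mult_left_mono[OF nb norm_ge_zero] by (intro AE_I2) (simp add: norm_mult normal_density_nonneg mult_ac)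
      qed measurable
      have "ennreal (cmod (inv_fourier h \<xi>)) \<le> (\<integral>\<^sup>+\<eta>. ennreal (cmod (G' \<eta> * of_real (normal_density 0 \<sigma> (\<xi> + \<eta>)))) \<partial>lborel)"
        unfolding h_hat by (rule integral_norm_bound_ennreal[OF int2])
      also have "\<dots> = (\<integral>\<^sup>+\<eta>. ennreal (cmod (G' \<eta>)) * ennreal (normal_density 0 \<sigma> (\<xi> + \<eta>)) \<partial>lborel)"
        by (simp add: norm_mult normal_density_nonneg ennreal_mult)
      finally show "ennreal (cmod (G \<xi> * inv_fourier h \<xi>)) \<le>
        (\<integral>\<^sup>+\<eta>. ennreal (cmod (G \<xi>)) * (ennreal (cmod (G' \<eta>)) * ennreal (normal_density 0 \<sigma> (\<xi> + \<eta>))) \<partial>lborel)"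
        by (simp add: norm_mult ennreal_mult nn_integral_cmult mult_left_mono)
    qed
    finally have main: "(\<integral>\<^sup>+x. ennreal ((cmod (g x))\<^sup>2 * ?e \<sigma> x) \<partial>lborel) \<le>
       (\<integral>\<^sup>+\<xi>. \<integral>\<^sup>+\<eta>. ennreal (cmod (G \<xi>)) * (ennreal (cmod (G' \<eta>)) * ennreal (normal_density 0 \<sigma> (\<xi> + \<eta>))) \<partial>lborel \<partial>lborel)" (is "?I \<le> ?J") .
    have "2 * ?J \<le> (\<integral>\<^sup>+\<xi>. \<integral>\<^sup>+\<eta>. ennreal ((cmod (G \<xi>))\<^sup>2) * ennreal (normal_density 0 \<sigma> (\<xi> + \<eta>))
        + ennreal ((cmod (G' \<eta>))\<^sup>2) * ennreal (normal_density 0 \<sigma> (\<xi> + \<eta>)) \<partial>lborel \<partial>lborel)"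
      unfolding nn_integral_cmult[symmetric]
    proof -
      have "2 * ?J = (\<integral>\<^sup>+\<xi>. \<integral>\<^sup>+\<eta>. 2 * (ennreal (cmod (G \<xi>)) * ennreal (cmod (G' \<eta>))) * ennreal (normal_density 0 \<sigma> (\<xi> + \<eta>)) \<partial>lborel \<partial>lborel)"
        by (simp add: nn_integral_cmult[symmetric] mult.assoc)
      also have "\<dots> \<le> (\<integral>\<^sup>+\<xi>. \<integral>\<^sup>+\<eta>. (ennreal (cmod (G \<xi>)) ^ 2 + ennreal (cmod (G' \<eta>)) ^ 2) * ennreal (normal_density 0 \<sigma> (\<xi> + \<eta>)) \<partial>lborel \<partial>lborel)"
        by (intro nn_integral_mono mult_right_mono two_mult_le_squares_ennreal) auto
      finally show "2 * ?J \<le> (\<integral>\<^sup>+\<xi>. \<integral>\<^sup>+\<eta>. ennreal ((cmod (G \<xi>))\<^sup>2) * ennreal (normal_density 0 \<sigma> (\<xi> + \<eta>))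
        + ennreal ((cmod (G' \<eta>))\<^sup>2) * ennreal (normal_density 0 \<sigma> (\<xi> + \<eta>)) \<partial>lborel \<partial>lborel)"
        by (simp add: distrib_right ennreal_power)
    qed
    also have "\<dots> = (\<integral>\<^sup>+\<xi>. ennreal ((cmod (G \<xi>))\<^sup>2) \<partial>lborel)
       + (\<integral>\<^sup>+\<xi>. \<integral>\<^sup>+\<eta>. ennreal ((cmod (G' \<eta>))\<^sup>2) * ennreal (normal_density 0 \<sigma> (\<xi> + \<eta>)) \<partial>lborel \<partial>lborel)"
      by (simp add: nn_integral_add nn_integral_cmult nd)
    also have "(\<integral>\<^sup>+\<xi>. \<integral>\<^sup>+\<eta>. ennreal ((cmod (G' \<eta>))\<^sup>2) * ennreal (normal_density 0 \<sigma> (\<xi> + \<eta>)) \<partial>lborel \<partial>lborel)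
       = (\<integral>\<^sup>+\<eta>. \<integral>\<^sup>+\<xi>. ennreal ((cmod (G' \<eta>))\<^sup>2) * ennreal (normal_density 0 \<sigma> (\<xi> + \<eta>)) \<partial>lborel \<partial>lborel)"
      by (rule lborel_pair.Fubini') (simp add: case_prod_unfold)
    also have "\<dots> = L2_sq G'" unfolding L2_sq_def by (simp add: nn_integral_cmult nd')
    finally have "2 * ?J \<le> 2 * L2_sq G" by (simp add: nnG' L2_sq_def[symmetric] mult_2)
    hence "?J \<le> L2_sq G" by (subst (asm) ennreal_mult_le_mult_iff) auto
    with main show ?thesis by (rule order_trans)
  qed
  define \<sigma> where "\<sigma> = (\<lambda>n::nat. 1 / real (Suc n))"
  have lim: "(\<lambda>n. ennreal ((cmod (g x))\<^sup>2 * ?e (\<sigma> n) x)) \<longlonglongrightarrow> ennreal ((cmod (g x))\<^sup>2)" for x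
  proof -
    have "(\<lambda>n. ennreal ((cmod (g x))\<^sup>2 * ?e (\<sigma> n) x)) \<longlonglongrightarrow> ennreal ((cmod (g x))\<^sup>2 * exp (- (0 * x)\<^sup>2 / 2))"
      unfolding \<sigma>_def by (intro tendsto_ennrealI tendsto_intros LIMSEQ_inverse_real_of_nat[unfolded inverse_eq_divide]) auto
    thus ?thesis by simp
  qed
  have "L2_sq g = (\<integral>\<^sup>+x. liminf (\<lambda>n. ennreal ((cmod (g x))\<^sup>2 * ?e (\<sigma> n) x)) \<partial>lborel)"
    unfolding L2_sq_def by (intro nn_integral_cong lim_imp_Liminf[symmetric] lim) auto
  also have "\<dots> \<le> liminf (\<lambda>n. \<integral>\<^sup>+x. ennreal ((cmod (g x))\<^sup>2 * ?e (\<sigma> n) x) \<partial>lborel)"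
    by (rule nn_integral_liminf) measurable
  also have "\<dots> \<le> L2_sq G"
  proof (rule Liminf_le)
    show "\<forall>\<^sub>F n in sequentially. (\<integral>\<^sup>+x. ennreal ((cmod (g x))\<^sup>2 * ?e (\<sigma> n) x) \<partial>lborel) \<le> L2_sq G"
      by (intro always_eventually allI reg) (simp add: \<sigma>_def)
  qed simp
  finally show ?thesis by (simp add: g_def)
qed


lemma L2_sq_reflect:
  assumes [measurable]: "G \<in> borel_measurable borel"
  shows "L2_sq (\<lambda>x. G (- x)) = L2_sq G"
  unfolding L2_sq_def using nn_integral_real_affine[of "\<lambda>x. ennreal ((cmod (G x))\<^sup>2)" "-1" 0] by simp

lemma norm_add_square_le: "(cmod (a + b))\<^sup>2 \<le> 2 * (cmod a)\<^sup>2 + 2 * (cmod b)\<^sup>2"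
proof -
  have "(cmod (a + b))\<^sup>2 \<le> (cmod a + cmod b)\<^sup>2" by (intro power_mono norm_triangle_ineq) auto
  also have "\<dots> \<le> 2 * (cmod a)\<^sup>2 + 2 * (cmod b)\<^sup>2"
    using sum_squares_bound[of "cmod a" "cmod b"] by (simp add: power2_sum)
  finally show ?thesis .
qed

lemma L2_sq_add_le:
  assumes [measurable]: "f \<in> borel_measurable borel" "g \<in> borel_measurable borel"
  shows "L2_sq (\<lambda>x. f x + g x) \<le> 2 * L2_sq f + 2 * L2_sq g"
proof -
  have "L2_sq (\<lambda>x. f x + g x) \<le> (\<integral>\<^sup>+x. 2 * ennreal ((cmod (f x))\<^sup>2) + 2 * ennreal ((cmod (g x))\<^sup>2) \<partial>lborel)"
    unfolding L2_sq_def
    using norm_add_square_le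
    by (intro nn_integral_mono) (simp flip: ennreal_plus ennreal_mult ennreal_numeral)
  thus ?thesis by (simp add: L2_sq_def nn_integral_add nn_integral_cmult)
qed

lemma ennreal_tendsto_0I:
  fixes a :: "nat \<Rightarrow> ennreal"
  assumes "\<And>e. e > 0 \<Longrightarrow> \<forall>\<^sub>F n in sequentially. a n \<le> ennreal e"
  shows "a \<longlonglongrightarrow> 0"
proof (rule order_tendstoI)
  fix c :: ennreal assume "0 < c"
  then obtain b where b: "0 < b" "b < c" using dense by blast
  then obtain e where e: "b = ennreal e" "e > 0"
    by (cases b) auto
  from assms[OF e(2)] show "\<forall>\<^sub>F n in sequentially. a n < c"
    by eventually_elim (use b e in auto)
qed simp

text \<open>Along a subsequence the increments \<open>d k\<close> decay so fast that \<open>\<Sum>k. 4\<^sup>k |d k|\<^sup>2\<close> is integrable. Hence the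
  subsequence converges almost everywhere, and Fatou's lemma turns the Cauchy property into
  convergence to this limit in the mean.\<close>

lemma L2_Cauchy_converges:
  fixes g :: "nat \<Rightarrow> real \<Rightarrow> complex"
  assumes L2: "\<And>n. L2_fun (g n)"
    and Cauchy: "\<And>e. e > 0 \<Longrightarrow> \<exists>N. \<forall>m\<ge>N. \<forall>n\<ge>N. L2_sq (\<lambda>x. g m x - g n x) \<le> ennreal e"
  shows "\<exists>f. L2_fun f \<and> (\<lambda>n. L2_sq (\<lambda>x. g n x - f x)) \<longlonglongrightarrow> 0"
proof -
  have [measurable]: "g n \<in> borel_measurable borel" for n using L2[of n] by (simp add: L2_fun_def)
  \<comment> \<open>the powers of \<open>1/8\<close> are summable against the weights \<open>4\<^sup>k\<close>\<close>
  have "\<exists>N. \<forall>m\<ge>N. \<forall>n\<ge>N. L2_sq (\<lambda>x. g m x - g n x) \<le> ennreal ((1/8)^k)" for k::nat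
    by (rule Cauchy) simp
  then obtain N where N: "\<And>k m n. m \<ge> N k \<Longrightarrow> n \<ge> N k \<Longrightarrow> L2_sq (\<lambda>x. g m x - g n x) \<le> ennreal ((1/8)^k)"
    by metis
  \<comment> \<open>the sum makes \<open>r k\<close> and \<open>r (Suc k)\<close> at least \<open>N k\<close>; the summand \<open>k\<close> makes \<open>r\<close> tend to infinity\<close>
  define r where "r = (\<lambda>k. (\<Sum>j\<le>k. N j) + k)"
  have r1: "N k \<le> r k" for k
    using member_le_sum[of k "{..k}" N] by (auto simp: r_def intro: trans_le_add1)
  have r2: "N k \<le> r (Suc k)" for k using r1[of k] by (simp add: r_def)
  define d where "d = (\<lambda>k x. g (r (Suc k)) x - g (r k) x)"
  have [measurable]: "d k \<in> borel_measurable borel" for k unfolding d_def by measurable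
  have "(\<integral>\<^sup>+x. (\<Sum>k. ennreal (4 ^ k * (cmod (d k x))\<^sup>2)) \<partial>lborel) = (\<Sum>k. ennreal (4 ^ k) * L2_sq (d k))"
    by (simp add: nn_integral_suminf nn_integral_cmult L2_sq_def ennreal_mult)
  also have "\<dots> \<le> (\<Sum>k. ennreal ((1/2) ^ k))"
  proof (intro suminf_le)
    fix k
    have "ennreal (4 ^ k) * L2_sq (d k) \<le> ennreal (4 ^ k) * ennreal ((1/8) ^ k)"
      unfolding d_def by (intro mult_left_mono N r1 r2) auto
    also have "\<dots> = ennreal ((1/2) ^ k)" by (simp flip: ennreal_mult power_mult_distrib)
    finally show "ennreal (4 ^ k) * L2_sq (d k) \<le> ennreal ((1/2) ^ k)" .
  qed auto
  also have "\<dots> < \<infinity>"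
    by (subst suminf_ennreal2) (auto intro: summable_geometric)
  finally have fin: "(\<integral>\<^sup>+x. (\<Sum>k. ennreal (4 ^ k * (cmod (d k x))\<^sup>2)) \<partial>lborel) \<noteq> \<infinity>" by simp
  have "AE x in lborel. (\<Sum>k. ennreal (4 ^ k * (cmod (d k x))\<^sup>2)) \<noteq> \<infinity>"
    by (rule nn_integral_PInf_AE[OF _ fin]) measurable
  hence conv: "AE x in lborel. convergent (\<lambda>k. g (r k) x)"
  proof eventually_elim
    case (elim x)
    have "summable (\<lambda>k. 4 ^ k * (cmod (d k x))\<^sup>2)"
      using elim by (intro summable_suminf_not_top) auto
    from summable_imp_Bseq[OF this] obtain B where B: "B > 0" "\<And>k. norm (4 ^ k * (cmod (d k x))\<^sup>2) \<le> B"
      by (auto simp: Bseq_def)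
    have bd: "cmod (d k x) \<le> sqrt B * (1/2) ^ k" for k
    proof (rule power2_le_imp_le)
      have "(sqrt B * (1/2) ^ k)\<^sup>2 = B * (1/4) ^ k" using B(1)
        by (simp add: power_mult_distrib power_even_eq[symmetric] power_mult[symmetric] mult.commute[of _ 2])
           (simp add: power_mult power_divide power2_eq_square)
      moreover have "(cmod (d k x))\<^sup>2 = (4 ^ k * (cmod (d k x))\<^sup>2) * (1/4) ^ k"
        by (simp add: power_divide)
      moreover have "4 ^ k * (cmod (d k x))\<^sup>2 \<le> B" using B(2)[of k] by simp
      ultimately show "(cmod (d k x))\<^sup>2 \<le> (sqrt B * (1/2) ^ k)\<^sup>2"
        by (metis mult_right_mono zero_le_divide_1_iff zero_le_numeral zero_le_power)
    qed (use B in auto)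
    have "summable (\<lambda>k. sqrt B * (1/2) ^ k)" by (intro summable_mult summable_geometric) auto
    hence "summable (\<lambda>k. d k x)" by (rule summable_comparison_test'[of _ 0]) (use bd in auto)
    hence "convergent (\<lambda>k. g (r 0) x + (\<Sum>j<k. d j x))"
      by (intro convergent_add convergent_const) (simp add: summable_iff_convergent)
    moreover have "g (r 0) x + (\<Sum>j<k. d j x) = g (r k) x" for k
      unfolding d_def by (subst sum_lessThan_telescope[of "\<lambda>j. g (r j) x"]) simp
    ultimately show ?case by simp
  qed
  define f where "f = (\<lambda>x. lim (\<lambda>k. g (r k) x))"
  have [measurable]: "f \<in> borel_measurable borel"
    unfolding f_def by (rule borel_measurable_lim_metric) measurable
  have lim: "AE x in lborel. (\<lambda>k. g (r k) x) \<longlonglongrightarrow> f x"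
    using conv by eventually_elim (simp add: f_def convergent_LIMSEQ_iff)
  have close: "\<exists>N. \<forall>n\<ge>N. L2_sq (\<lambda>x. g n x - f x) \<le> ennreal e" if "e > 0" for e
  proof -
    from Cauchy[OF that] obtain M where M: "\<And>m n. m \<ge> M \<Longrightarrow> n \<ge> M \<Longrightarrow> L2_sq (\<lambda>x. g m x - g n x) \<le> ennreal e"
      by blast
    have "L2_sq (\<lambda>x. g n x - f x) \<le> ennreal e" if n: "n \<ge> M" for n
    proof -
      have "L2_sq (\<lambda>x. g n x - f x) = (\<integral>\<^sup>+x. liminf (\<lambda>k. ennreal ((cmod (g n x - g (r k) x))\<^sup>2)) \<partial>lborel)"
        unfolding L2_sq_def
      proof (rule nn_integral_cong_AE, use lim in eventually_elim)
        case (elim x)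
        hence "(\<lambda>k. ennreal ((cmod (g n x - g (r k) x))\<^sup>2)) \<longlonglongrightarrow> ennreal ((cmod (g n x - f x))\<^sup>2)"
          by (intro tendsto_ennrealI tendsto_intros)
        from lim_imp_Liminf[OF sequentially_bot this] show ?case by (rule sym)
      qed
      also have "\<dots> \<le> liminf (\<lambda>k. L2_sq (\<lambda>x. g n x - g (r k) x))"
        unfolding L2_sq_def by (rule nn_integral_liminf) measurable
      also have "\<dots> \<le> ennreal e"
      proof (rule Liminf_le)
        show "\<forall>\<^sub>F k in sequentially. L2_sq (\<lambda>x. g n x - g (r k) x) \<le> ennreal e"
          unfolding eventually_sequentially
          using n by (intro exI[of _ M] allI impI M) (auto simp: r_def)
      qed simp
      finally show ?thesis .
    qed
    thus ?thesis by blast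
  qed
  have "L2_fun f"
  proof -
    obtain n where n: "L2_sq (\<lambda>x. g n x - f x) \<le> ennreal 1" using close[of 1] by auto
    have "L2_sq f \<le> 2 * L2_sq (g n) + 2 * L2_sq (\<lambda>x. f x - g n x)"
      using L2_sq_add_le[of "g n" "\<lambda>x. f x - g n x"] by simp
    moreover have "L2_sq (\<lambda>x. f x - g n x) = L2_sq (\<lambda>x. g n x - f x)"
      by (simp add: L2_sq_def norm_minus_commute)
    moreover have "L2_sq (g n) < \<infinity>" using L2[of n] by (simp add: L2_fun_iff)
    moreover have "2 * L2_sq (g n) + 2 * L2_sq (\<lambda>x. g n x - f x) < \<infinity>"
      using calculation(3) n by (auto simp: ennreal_mult_less_top intro: le_less_trans[OF _ ennreal_one_less_top])
    ultimately have "L2_sq f < \<infinity>" by (simp add: le_less_trans)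
    thus ?thesis by (simp add: L2_fun_iff)
  qed
  moreover have "(\<lambda>n. L2_sq (\<lambda>x. g n x - f x)) \<longlonglongrightarrow> 0"
    by (rule ennreal_tendsto_0I) (use close in \<open>auto simp: eventually_sequentially\<close>)
  ultimately show ?thesis by blast
qed

lemma inv_fourier_reflect: "inv_fourier (\<lambda>\<xi>. G (- \<xi>)) x = inv_fourier G (- x)"
  unfolding inv_fourier_def
  using lborel_integral_real_affine[of "-1" "\<lambda>\<xi>. G \<xi> * cis (- x * \<xi>)" 0] by simp

lemma inv_fourier_scale: "inv_fourier (\<lambda>\<xi>. c * G \<xi>) x = c * inv_fourier G x"
  unfolding inv_fourier_def by (simp add: mult.assoc mult.left_commute)

lemma inv_fourier_diff:
  assumes "integrable lborel F" "integrable lborel G"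
  shows "inv_fourier (\<lambda>\<xi>. F \<xi> - G \<xi>) x = inv_fourier F x - inv_fourier G x"
  unfolding inv_fourier_def
  by (simp add: left_diff_distrib right_diff_distrib integral_diff integrable_mult_cis assms)

abbreviation truncate :: "nat \<Rightarrow> (real \<Rightarrow> complex) \<Rightarrow> real \<Rightarrow> complex" where
  "truncate n f \<equiv> (\<lambda>x. indicator {- real n..real n} x *\<^sub>R f x)"

lemma fourier_trunc_eq: "fourier_trunc n f \<xi> = inv_fourier (truncate n f) (- \<xi>)"
  unfolding fourier_trunc_def inv_fourier_def set_lebesgue_integral_def
  by (simp add: cis_conv_exp mult_ac)

lemma integrable_truncate:
  assumes "L2_fun f"
  shows "integrable lborel (truncate n f)"
proof (rule Bochner_Integration.integrable_bound)
  have [measurable]: "f \<in> borel_measurable borel" using assms by (simp add: L2_fun_def)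
  show "truncate n f \<in> borel_measurable lborel" by measurable
  show "integrable lborel (\<lambda>x. indicator {- real n..real n} x + (cmod (f x))\<^sup>2)"
    using assms by (intro Bochner_Integration.integrable_add integrable_real_indicator) (auto simp: L2_fun_def)
  have "cmod z \<le> 1 + (cmod z)\<^sup>2" for z using sum_squares_bound[of 1 "cmod z"] by (simp, smt (verit) norm_ge_zero)
  thus "AE x in lborel. norm (truncate n f x) \<le> norm (indicator {- real n..real n} x + (cmod (f x))\<^sup>2)"
    by (intro AE_I2) (auto simp: indicator_def)
qed

text \<open>The truncations of \<open>f\<close> are integrable and converge to \<open>f\<close> in \<open>L\<^sup>2\<close>, so by the Bessel inequality their
  transforms form a Cauchy sequence in \<open>L\<^sup>2\<close>.\<close>

lemma is_fourier_L2_exists: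
  assumes f: "L2_fun f"
  shows "\<exists>g. is_fourier_L2 f g"
proof -
  have [measurable]: "f \<in> borel_measurable borel" using f by (simp add: L2_fun_def)
  note int = integrable_truncate[OF f]
  note [measurable] = inv_fourier_measurable[OF int]
  have trunc_eq: "fourier_trunc n f = (\<lambda>\<xi>. inv_fourier (truncate n f) (- \<xi>))" for n
    by (rule ext) (rule fourier_trunc_eq)
  have nnf: "L2_sq f < \<infinity>" using f by (simp add: L2_fun_iff)
  have L2: "L2_fun (fourier_trunc n f)" for n
  proof -
    have "L2_sq (fourier_trunc n f) = L2_sq (inv_fourier (truncate n f))"
      unfolding trunc_eq by (rule L2_sq_reflect) measurable
    also have "\<dots> \<le> L2_sq (truncate n f)" by (rule bessel_inequality[OF int])
    also have "\<dots> \<le> L2_sq f"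
      unfolding L2_sq_def by (intro nn_integral_mono ennreal_leI power_mono) (auto simp: indicator_def)
    finally have "L2_sq (fourier_trunc n f) < \<infinity>" using nnf by simp
    moreover have "fourier_trunc n f \<in> borel_measurable lborel" unfolding trunc_eq by measurable
    ultimately show ?thesis by (simp add: L2_fun_iff)
  qed
  define t where "t = (\<lambda>N::nat. \<integral>\<^sup>+x. ennreal ((cmod (f x))\<^sup>2) * indicator (- {- real N..real N}) x \<partial>lborel)"
  have t0: "t \<longlonglongrightarrow> 0"
  proof -
    have "(\<lambda>N. \<integral>\<^sup>+x. ennreal ((cmod (f x))\<^sup>2) * indicator (- {- real N..real N}) x \<partial>lborel) \<longlonglongrightarrow> (\<integral>\<^sup>+(x::real). 0 \<partial>lborel)"
    proof (rule nn_integral_dominated_convergence[where w = "\<lambda>x. ennreal ((cmod (f x))\<^sup>2)"])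
      show "(\<integral>\<^sup>+x. ennreal ((cmod (f x))\<^sup>2) \<partial>lborel) < \<infinity>" using nnf by (simp add: L2_sq_def)
      show "AE x in lborel. ennreal ((cmod (f x))\<^sup>2) * indicator (- {- real j..real j}) x \<le> ennreal ((cmod (f x))\<^sup>2)" for j
        by (intro AE_I2) (auto simp: indicator_def)
      show "AE x in lborel. (\<lambda>N. ennreal ((cmod (f x))\<^sup>2) * indicator (- {- real N..real N}) x) \<longlonglongrightarrow> 0"
      proof (intro AE_I2 tendsto_eventually)
        fix x :: real
        obtain M :: nat where "\<bar>x\<bar> \<le> real M" using real_arch_simple by blast
        thus "\<forall>\<^sub>F N in sequentially. ennreal ((cmod (f x))\<^sup>2) * indicator (- {- real N..real N}) x = 0"
          unfolding eventually_sequentially by (intro exI[of _ M]) (auto simp: indicator_def)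
      qed
    qed measurable
    thus ?thesis by (simp add: t_def)
  qed
  have diff: "L2_sq (\<lambda>\<xi>. fourier_trunc m f \<xi> - fourier_trunc n f \<xi>) \<le> t N" if "m \<ge> N" "n \<ge> N" for m n N
  proof -
    have i: "integrable lborel (\<lambda>x. truncate m f x - truncate n f x)" by (intro Bochner_Integration.integrable_diff int)
    note [measurable] = inv_fourier_measurable[OF i]
    have "(\<lambda>\<xi>. fourier_trunc m f \<xi> - fourier_trunc n f \<xi>) = (\<lambda>\<xi>. inv_fourier (\<lambda>x. truncate m f x - truncate n f x) (- \<xi>))"
      by (simp add: fourier_trunc_eq inv_fourier_diff[OF int int])
    hence "L2_sq (\<lambda>\<xi>. fourier_trunc m f \<xi> - fourier_trunc n f \<xi>) = L2_sq (inv_fourier (\<lambda>x. truncate m f x - truncate n f x))"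
      by (simp add: L2_sq_reflect inv_fourier_measurable[OF i])
    also have "\<dots> \<le> L2_sq (\<lambda>x. truncate m f x - truncate n f x)" by (rule bessel_inequality[OF i])
    also have "\<dots> \<le> t N"
      unfolding L2_sq_def t_def using that
      by (intro nn_integral_mono) (auto simp: indicator_def)
    finally show ?thesis .
  qed
  have "\<exists>g. L2_fun g \<and> (\<lambda>n. L2_sq (\<lambda>x. fourier_trunc n f x - g x)) \<longlonglongrightarrow> 0"
  proof (rule L2_Cauchy_converges[OF L2])
    fix e :: real assume "e > 0"
    hence "\<forall>\<^sub>F N in sequentially. t N < ennreal e" by (intro order_tendstoD[OF t0]) auto
    then obtain N where "t N < ennreal e" by (auto simp: eventually_sequentially)
    hence tN: "t N \<le> ennreal e" by (rule less_imp_le)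
    thus "\<exists>N. \<forall>m\<ge>N. \<forall>n\<ge>N. L2_sq (\<lambda>x. fourier_trunc m f x - fourier_trunc n f x) \<le> ennreal e"
      by (intro exI[of _ N] allI impI order_trans[OF diff[of N] tN])
  qed
  thus ?thesis by (simp add: is_fourier_L2_def L2_sq_def)
qed

lemma is_fourier_L2_fourier_L2: "L2_fun f \<Longrightarrow> is_fourier_L2 f (fourier_L2 f)"
  unfolding fourier_L2_def using is_fourier_L2_exists by (rule someI_ex)

lemma L2_fun_fourier_L2: "L2_fun f \<Longrightarrow> L2_fun (fourier_L2 f)"
  using is_fourier_L2_fourier_L2 by (simp add: is_fourier_L2_def)

lemma integrable_mult_L2:
  assumes "L2_fun f" "L2_fun g"
  shows "integrable lborel (\<lambda>x. f x * g x)"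
proof (rule Bochner_Integration.integrable_bound)
  have [measurable]: "f \<in> borel_measurable borel" "g \<in> borel_measurable borel" using assms by (auto simp: L2_fun_def)
  show "(\<lambda>x. f x * g x) \<in> borel_measurable lborel" by measurable
  show "integrable lborel (\<lambda>x. (cmod (f x))\<^sup>2 + (cmod (g x))\<^sup>2)"
    using assms by (intro Bochner_Integration.integrable_add) (auto simp: L2_fun_def)
  have "cmod a * cmod b \<le> (cmod a)\<^sup>2 + (cmod b)\<^sup>2" for a b
  proof -
    have "0 \<le> cmod a * cmod b" by simp
    thus ?thesis using sum_squares_bound[of "cmod a" "cmod b"] by linarith
  qed
  thus "AE x in lborel. norm (f x * g x) \<le> norm ((cmod (f x))\<^sup>2 + (cmod (g x))\<^sup>2)"
    by (intro AE_I2) (simp add: norm_mult)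
qed

lemma norm_integral_mult_L2_le:
  assumes "L2_fun f" "L2_fun g"
  shows "ennreal ((cmod (LINT x|lborel. f x * g x))\<^sup>2) \<le> L2_sq f * L2_sq g"
proof -
  have [measurable]: "f \<in> borel_measurable borel" "g \<in> borel_measurable borel" using assms by (auto simp: L2_fun_def)
  have "ennreal ((cmod (LINT x|lborel. f x * g x))\<^sup>2) = ennreal (cmod (LINT x|lborel. f x * g x)) ^ 2"
    by (simp add: ennreal_power)
  also have "\<dots> \<le> (\<integral>\<^sup>+x. ennreal (cmod (f x * g x)) \<partial>lborel) ^ 2"
    by (intro power_mono integral_norm_bound_ennreal integrable_mult_L2 assms) auto
  also have "\<dots> = (\<integral>\<^sup>+x. ennreal (cmod (f x)) * ennreal (cmod (g x)) \<partial>lborel) ^ 2"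
    by (simp add: norm_mult ennreal_mult)
  also have "\<dots> \<le> (\<integral>\<^sup>+x. ennreal (cmod (f x)) ^ 2 \<partial>lborel) * (\<integral>\<^sup>+x. ennreal (cmod (g x)) ^ 2 \<partial>lborel)"
    by (intro nn_integral_Cauchy_Schwarz sigma_finite_lborel) auto
  finally show ?thesis by (simp add: L2_sq_def ennreal_power)
qed

lemma L2_fun_diff:
  assumes "L2_fun f" "L2_fun g" shows "L2_fun (\<lambda>x. f x - g x)"
proof -
  have [measurable]: "f \<in> borel_measurable borel" "g \<in> borel_measurable borel" using assms by (auto simp: L2_fun_def)
  have "L2_sq (\<lambda>x. f x - g x) \<le> 2 * L2_sq f + 2 * L2_sq g"
    using L2_sq_add_le[of f "\<lambda>x. - g x"] by (simp add: L2_sq_def)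
  thus ?thesis using assms by (auto simp: L2_fun_iff ennreal_mult_less_top intro: le_less_trans)
qed

lemma L2_fun_inv_fourier:
  assumes "integrable lborel G" "L2_fun G"
  shows "L2_fun (inv_fourier G)"
  using bessel_inequality[OF assms(1)] assms(2) inv_fourier_measurable[OF assms(1)]
  by (auto simp: L2_fun_iff)

lemma L2_fun_reflect: "L2_fun G \<Longrightarrow> L2_fun (\<lambda>x. G (- x))"
  by (auto simp: L2_fun_iff L2_sq_reflect)

text \<open>Passage to the limit in the multiplication formula for the truncations. Together with its
  square integrability, this identity is all that is used about the transform of a
  square-integrable function.\<close>

lemma multiplication_formula_L2:
  assumes f: "L2_fun f" and \<psi>: "integrable lborel \<psi>" "L2_fun \<psi>"
  shows "(LINT y|lborel. f y * inv_fourier \<psi> (- y)) = (LINT \<xi>|lborel. fourier_L2 f \<xi> * \<psi> \<xi>)"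
proof (rule LIMSEQ_unique)
  let ?T = "\<lambda>n. LINT \<xi>|lborel. fourier_trunc n f \<xi> * \<psi> \<xi>"
  have [measurable]: "f \<in> borel_measurable borel" using f by (simp add: L2_fun_def)
  note int = integrable_truncate[OF f]
  define \<psi>' where "\<psi>' = (\<lambda>\<xi>. \<psi> (- \<xi>))"
  have \<psi>': "integrable lborel \<psi>'"
    unfolding \<psi>'_def using lborel_integrable_real_affine[OF \<psi>(1), of "-1" 0] by simp
  have \<psi>'L: "L2_fun \<psi>'" unfolding \<psi>'_def by (rule L2_fun_reflect[OF \<psi>(2)])
  note [measurable] = inv_fourier_measurable[OF \<psi>']
  have hat: "inv_fourier \<psi> (- y) = inv_fourier \<psi>' y" for y by (simp add: \<psi>'_def inv_fourier_reflect)
  define g where "g = fourier_L2 f"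
  have g: "L2_fun g" and glim: "(\<lambda>n. L2_sq (\<lambda>\<xi>. fourier_trunc n f \<xi> - g \<xi>)) \<longlonglongrightarrow> 0"
    using is_fourier_L2_fourier_L2[OF f] by (auto simp: g_def is_fourier_L2_def L2_sq_def)
  have tr: "L2_fun (fourier_trunc n f)" for n
  proof -
    have "L2_sq (truncate n f) \<le> L2_sq f"
      unfolding L2_sq_def by (intro nn_integral_mono ennreal_leI power_mono) (auto simp: indicator_def)
    hence "L2_fun (truncate n f)" using f by (auto simp: L2_fun_iff intro: le_less_trans)
    from L2_fun_reflect[OF L2_fun_inv_fourier[OF int this]] show ?thesis
      by (simp add: fourier_trunc_eq[abs_def])
  qed
  have an: "(LINT y|lborel. truncate n f y * inv_fourier \<psi>' y) = ?T n" for n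
  proof -
    have "(LINT y|lborel. truncate n f y * inv_fourier \<psi>' y) = (LINT \<xi>|lborel. \<psi> (- \<xi>) * inv_fourier (truncate n f) \<xi>)"
      by (subst multiplication_formula[OF int \<psi>']) (simp add: \<psi>'_def)
    also have "\<dots> = (LINT \<xi>|lborel. \<psi> \<xi> * inv_fourier (truncate n f) (- \<xi>))"
      using lborel_integral_real_affine[of "-1" "\<lambda>\<xi>. \<psi> (- \<xi>) * inv_fourier (truncate n f) \<xi>" 0] by simp
    finally show ?thesis by (simp add: fourier_trunc_eq mult.commute)
  qed
  show "(\<lambda>n. LINT y|lborel. truncate n f y * inv_fourier \<psi>' y) \<longlonglongrightarrow> (LINT y|lborel. f y * inv_fourier \<psi> (- y))"
    unfolding hat
  proof (rule integral_dominated_convergence)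
    show "integrable lborel (\<lambda>y. cmod (f y * inv_fourier \<psi>' y))"
      by (intro integrable_norm integrable_mult_L2 f L2_fun_inv_fourier \<psi>' \<psi>'L)
    show "AE x in lborel. (\<lambda>n. truncate n f x * inv_fourier \<psi>' x) \<longlonglongrightarrow> f x * inv_fourier \<psi>' x"
    proof (intro AE_I2 tendsto_eventually)
      fix x :: real
      obtain M :: nat where "\<bar>x\<bar> \<le> real M" using real_arch_simple by blast
      thus "\<forall>\<^sub>F n in sequentially. truncate n f x * inv_fourier \<psi>' x = f x * inv_fourier \<psi>' x"
        unfolding eventually_sequentially by (intro exI[of _ M]) (auto simp: indicator_def)
    qed
  qed (auto simp: indicator_def norm_mult intro!: AE_I2)
  show "(\<lambda>n. LINT y|lborel. truncate n f y * inv_fourier \<psi>' y) \<longlonglongrightarrow> (LINT \<xi>|lborel. fourier_L2 f \<xi> * \<psi> \<xi>)"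
    unfolding an g_def[symmetric]
  proof (rule LIM_zero_cancel)
    have eq: "?T n - (LINT \<xi>|lborel. g \<xi> * \<psi> \<xi>)
        = (LINT \<xi>|lborel. (fourier_trunc n f \<xi> - g \<xi>) * \<psi> \<xi>)" for n
      by (simp add: left_diff_distrib integral_diff integrable_mult_L2 g tr \<psi>)
    have "(\<lambda>n. ennreal ((cmod (LINT \<xi>|lborel. (fourier_trunc n f \<xi> - g \<xi>) * \<psi> \<xi>))\<^sup>2)) \<longlonglongrightarrow> 0"
    proof (rule tendsto_sandwich[OF _ _ tendsto_const])
      show "(\<lambda>n. L2_sq (\<lambda>\<xi>. fourier_trunc n f \<xi> - g \<xi>) * L2_sq \<psi>) \<longlonglongrightarrow> 0"
        using tendsto_mult_ennreal[OF glim tendsto_const[of "L2_sq \<psi>"]] \<psi>(2) by (auto simp: L2_fun_iff)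
      show "\<forall>\<^sub>F n in sequentially. ennreal ((cmod (LINT \<xi>|lborel. (fourier_trunc n f \<xi> - g \<xi>) * \<psi> \<xi>))\<^sup>2)
          \<le> L2_sq (\<lambda>\<xi>. fourier_trunc n f \<xi> - g \<xi>) * L2_sq \<psi>"
        by (intro always_eventually allI norm_integral_mult_L2_le L2_fun_diff tr g \<psi>)
    qed auto
    hence "(\<lambda>n. (cmod (LINT \<xi>|lborel. (fourier_trunc n f \<xi> - g \<xi>) * \<psi> \<xi>))\<^sup>2) \<longlonglongrightarrow> 0"
      by (subst (asm) ennreal_tendsto_0_iff) auto
    hence "(\<lambda>n. LINT \<xi>|lborel. (fourier_trunc n f \<xi> - g \<xi>) * \<psi> \<xi>) \<longlonglongrightarrow> 0"
      by (simp add: tendsto_norm_zero_iff)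
    thus "(\<lambda>n. ?T n - (LINT \<xi>|lborel. g \<xi> * \<psi> \<xi>)) \<longlonglongrightarrow> 0"
      by (simp add: eq)
  qed
qed

section \<open>Uniqueness and inversion\<close>

text \<open>The positive and the negative part of \<open>h\<close> have the same transform, in particular the same mass.
  After normalization they are probability densities with the same characteristic function, so
  they agree by Levy's uniqueness theorem.\<close>

lemma fourier_unique_real:
  fixes h :: "real \<Rightarrow> real"
  assumes h: "integrable lborel h"
    and zero: "\<And>x. (LINT \<xi>|lborel. complex_of_real (h \<xi>) * cis (x * \<xi>)) = 0"
  shows "AE \<xi> in lborel. h \<xi> = 0"
proof -
  let ?I = "\<lambda>p x. LINT \<xi>|lborel. complex_of_real (p \<xi>) * cis (x * \<xi>)"
  let ?D = "\<lambda>m r. density lborel (\<lambda>x. ennreal (r x / m))"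
  define p q where "p = (\<lambda>x. max 0 (h x))" and "q = (\<lambda>x. max 0 (- h x))"
  have pq: "h x = p x - q x" "0 \<le> p x" "0 \<le> q x" for x by (auto simp: p_def q_def)
  have p: "integrable lborel p" unfolding p_def using h by (intro integrable_max) auto
  have q: "integrable lborel q" unfolding q_def using h by (intro integrable_max) auto
  have [measurable]: "p \<in> borel_measurable borel" "q \<in> borel_measurable borel"
    using borel_measurable_integrable[OF p] borel_measurable_integrable[OF q] by auto
  have eq: "?I p x = ?I q x" for x
  proof -
    have "?I p x - ?I q x
      = (LINT \<xi>|lborel. complex_of_real (p \<xi>) * cis (x * \<xi>) - complex_of_real (q \<xi>) * cis (x * \<xi>))"
      by (rule Bochner_Integration.integral_diff[symmetric]) (intro integrable_mult_cis integrable_of_real p q)+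
    also have "\<dots> = 0" using zero[of x] by (simp add: pq(1) left_diff_distrib)
    finally show ?thesis by simp
  qed
  define m where "m = (LINT \<xi>|lborel. p \<xi>)"
  have "complex_of_real (LINT \<xi>|lborel. p \<xi>) = complex_of_real (LINT \<xi>|lborel. q \<xi>)"
    using eq[of 0] by simp
  hence mq: "m = (LINT \<xi>|lborel. q \<xi>)" by (simp only: of_real_eq_iff m_def)
  show ?thesis
  proof (cases "m = 0")
    case True
    have "AE x in lborel. p x = 0" "AE x in lborel. q x = 0"
      using True integral_nonneg_eq_0_iff_AE[OF p] integral_nonneg_eq_0_iff_AE[OF q] mq pq m_def by auto
    thus ?thesis by eventually_elim (simp add: pq(1))
  next
    case False
    moreover have "m \<ge> 0" unfolding m_def by (rule integral_nonneg_AE) (use pq in auto)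
    ultimately have m: "m > 0" by simp
    have dist: "real_distribution (?D m r)"
      if r: "integrable lborel r" "\<And>x. 0 \<le> r x" "(LINT x|lborel. r x) = m" for r
    proof -
      have [measurable]: "r \<in> borel_measurable borel" using borel_measurable_integrable[OF r(1)] by simp
      have "(\<integral>\<^sup>+x. ennreal (r x / m) \<partial>lborel) = ennreal (LINT x|lborel. r x / m)"
        by (rule nn_integral_eq_integral) (use r m in auto)
      also have "\<dots> = 1" using r(3) m by simp
      finally have "prob_space (?D m r)"
        by (intro prob_spaceI) (simp add: emeasure_density)
      thus ?thesis by (simp add: real_distribution_def real_distribution_axioms_def)
    qed
    have char: "char (?D m r) t = ?I r t / m"
      if r: "integrable lborel r" "\<And>x. 0 \<le> r x" for r t
    proof -
      have [measurable]: "r \<in> borel_measurable borel" using borel_measurable_integrable[OF r(1)] by simp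
      have "char (?D m r) t = (LINT x|lborel. (r x / m) *\<^sub>R iexp (t * x))"
        unfolding char_def by (subst integral_density) (use r m in auto)
      also have "\<dots> = (LINT x|lborel. complex_of_real (r x) * cis (t * x) / m)"
        by (intro Bochner_Integration.integral_cong refl) (simp add: scaleR_conv_of_real cis_conv_exp)
      finally show ?thesis by simp
    qed
    have "?D m p = ?D m q"
    proof (rule Levy_uniqueness)
      show "char (?D m p) = char (?D m q)"
        using char[OF p] char[OF q] pq eq by auto
    qed (use dist[OF p] dist[OF q] pq mq m_def in auto)
    hence "AE x in lborel. ennreal (p x / m) = ennreal (q x / m)"
      by (intro sigma_finite_measure.density_unique[OF sigma_finite_lborel]) auto
    thus ?thesis by eventually_elim (use m pq in auto)
  qed
qed

text \<open>The transform of the conjugate of \<open>h\<close> vanishes as well, hence so do those of the real and imaginary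
  parts.\<close>

lemma fourier_unique:
  assumes h: "integrable lborel h" and zero: "\<And>x. inv_fourier h x = 0"
  shows "AE \<xi> in lborel. h \<xi> = 0"
proof -
  have z: "(LINT \<xi>|lborel. h \<xi> * cis (x * \<xi>)) = 0" for x
    using zero[of x] by (simp add: inv_fourier_def)
  have zc: "(LINT \<xi>|lborel. cnj (h \<xi>) * cis (x * \<xi>)) = 0" for x
  proof -
    have "(LINT \<xi>|lborel. cnj (h \<xi>) * cis (x * \<xi>)) = (LINT \<xi>|lborel. cnj (h \<xi> * cis (- x * \<xi>)))"
      by (simp add: cis_cnj)
    also have "\<dots> = cnj (LINT \<xi>|lborel. h \<xi> * cis (- x * \<xi>))" by (rule Bochner_Integration.integral_cnj)
    finally show ?thesis using z[of "- x"] by simp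
  qed
  have hc: "integrable lborel (\<lambda>\<xi>. cnj (h \<xi>))" using h by simp
  have "AE \<xi> in lborel. Re (h \<xi>) = 0"
  proof (rule fourier_unique_real)
    show "integrable lborel (\<lambda>\<xi>. Re (h \<xi>))" using h by simp
    fix x
    have "(LINT \<xi>|lborel. complex_of_real (Re (h \<xi>)) * cis (x * \<xi>))
        = (LINT \<xi>|lborel. (1/2) * (h \<xi> * cis (x * \<xi>) + cnj (h \<xi>) * cis (x * \<xi>)))"
      by (intro Bochner_Integration.integral_cong refl) (simp add: complex_add_cnj distrib_right[symmetric])
    also have "\<dots> = 0"
      by (simp add: integrable_mult_cis h hc z zc)
    finally show "(LINT \<xi>|lborel. complex_of_real (Re (h \<xi>)) * cis (x * \<xi>)) = 0" .
  qed
  \<comment> \<open>the constant \<open>Complex 0 (-1/2)\<close> below is \<open>1 / (2 \<i>)\<close>\<close>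
  moreover have "AE \<xi> in lborel. Im (h \<xi>) = 0"
  proof (rule fourier_unique_real)
    show "integrable lborel (\<lambda>\<xi>. Im (h \<xi>))" using h by simp
    fix x
    have "(LINT \<xi>|lborel. complex_of_real (Im (h \<xi>)) * cis (x * \<xi>))
        = (LINT \<xi>|lborel. Complex 0 (-1/2) * (h \<xi> * cis (x * \<xi>) - cnj (h \<xi>) * cis (x * \<xi>)))"
      by (intro Bochner_Integration.integral_cong refl) (simp add: complex_eq_iff algebra_simps)
    also have "\<dots> = 0"
      by (simp add: integrable_mult_cis h hc z zc)
    finally show "(LINT \<xi>|lborel. complex_of_real (Im (h \<xi>)) * cis (x * \<xi>)) = 0" .
  qed
  ultimately show ?thesis by eventually_elim (simp add: complex_eq_iff)
qed

lemma L2_fun_mono: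
  assumes "L2_fun g" "f \<in> borel_measurable borel" "\<And>x. cmod (f x) \<le> cmod (g x)"
  shows "L2_fun f"
proof -
  have "L2_sq f \<le> L2_sq g" unfolding L2_sq_def
    by (intro nn_integral_mono ennreal_leI power_mono assms) auto
  thus ?thesis using assms(1,2) by (auto simp: L2_fun_iff)
qed

lemma L2_fun_bounded_integrable:
  assumes "integrable lborel \<psi>" "\<And>x. cmod (\<psi> x) \<le> 1"
  shows "L2_fun \<psi>"
  unfolding L2_fun_def
proof
  show m: "\<psi> \<in> borel_measurable lborel" by (rule borel_measurable_integrable[OF assms(1)])
  show "integrable lborel (\<lambda>x. (cmod (\<psi> x))\<^sup>2)"
  proof (rule Bochner_Integration.integrable_bound[OF integrable_norm[OF assms(1)]])
    show "(\<lambda>x. (cmod (\<psi> x))\<^sup>2) \<in> borel_measurable lborel" using m by measurable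
    show "AE x in lborel. norm ((cmod (\<psi> x))\<^sup>2) \<le> norm (cmod (\<psi> x))"
      using assms(2) by (intro AE_I2) (simp add: power2_eq_square mult_left_le_one_le)
  qed
qed

definition gaussian :: "real \<Rightarrow> complex" where
  "gaussian x = complex_of_real (exp (- x\<^sup>2 / 2))"

lemma integrable_gaussian: "integrable lborel gaussian"
  unfolding gaussian_def using integrable_exp_square[of 1] by (intro integrable_of_real) simp

lemma gaussian_measurable [measurable]: "gaussian \<in> borel_measurable borel"
  unfolding gaussian_def by measurable

lemma gaussian_minus: "gaussian (- x) = gaussian x" by (simp add: gaussian_def)

lemma norm_gaussian_le: "cmod (gaussian x) \<le> 1" by (simp add: gaussian_def)

lemma gaussian_nonzero: "gaussian x \<noteq> 0" by (simp add: gaussian_def)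

lemma inv_fourier_gaussian: "inv_fourier gaussian x = gaussian x"
proof -
  have "(LINT \<xi>|lborel. complex_of_real (exp (- (1 * \<xi>)\<^sup>2 / 2)) * cis (\<xi> * x)) = of_real (sqrt (2 * pi) / 1 * exp (- (x / 1)\<^sup>2 / 2))"
    by (rule fourier_integral_exp_square) simp
  hence "(LINT \<xi>|lborel. gaussian \<xi> * cis (x * \<xi>)) = of_real (sqrt (2 * pi)) * gaussian x"
    by (simp add: gaussian_def mult.commute)
  thus ?thesis by (simp add: inv_fourier_def)
qed

lemma inv_fourier_modulate: "inv_fourier (\<lambda>\<xi>. G \<xi> * cis (a * \<xi>)) x = inv_fourier G (a + x)"
  unfolding inv_fourier_def by (simp add: mult.assoc cis_mult distrib_right)

lemma inv_fourier_shift: "inv_fourier (\<lambda>\<xi>. G (\<xi> - a)) x = cis (a * x) * inv_fourier G x"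
proof -
  have "(LINT \<xi>|lborel. G (\<xi> - a) * cis (x * \<xi>)) = (LINT \<xi>|lborel. G \<xi> * cis (x * (a + \<xi>)))"
    using lborel_integral_real_affine[of 1 "\<lambda>\<xi>. G (\<xi> - a) * cis (x * \<xi>)" a] by simp
  also have "\<dots> = (LINT \<xi>|lborel. cis (a * x) * (G \<xi> * cis (x * \<xi>)))"
    by (intro Bochner_Integration.integral_cong refl) (simp add: distrib_left cis_mult[symmetric] mult_ac)
  also have "\<dots> = cis (a * x) * (LINT \<xi>|lborel. G \<xi> * cis (x * \<xi>))"
    by (rule integral_mult_right_zero)
  finally show ?thesis by (simp add: inv_fourier_def mult.left_commute)
qed

lemma L2_fun_gaussian_modulated: "integrable lborel (\<lambda>\<xi>. gaussian \<xi> * cis (a * \<xi>))" "L2_fun (\<lambda>\<xi>. gaussian \<xi> * cis (a * \<xi>))"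
proof -
  show i: "integrable lborel (\<lambda>\<xi>. gaussian \<xi> * cis (a * \<xi>))" by (intro integrable_mult_cis integrable_gaussian)
  show "L2_fun (\<lambda>\<xi>. gaussian \<xi> * cis (a * \<xi>))"
    by (rule L2_fun_bounded_integrable[OF i]) (simp add: norm_mult norm_gaussian_le)
qed

lemma L2_fun_gaussian_shifted: "integrable lborel (\<lambda>\<xi>. gaussian (\<xi> - a))" "L2_fun (\<lambda>\<xi>. gaussian (\<xi> - a))"
proof -
  show i: "integrable lborel (\<lambda>\<xi>. gaussian (\<xi> - a))"
    using lborel_integrable_real_affine[OF integrable_gaussian, of 1 "-a"] by simp
  show "L2_fun (\<lambda>\<xi>. gaussian (\<xi> - a))"
    by (rule L2_fun_bounded_integrable[OF i]) (rule norm_gaussian_le)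
qed

text \<open>The Gaussian factor makes \<open>h\<close> integrable, and the hypothesis says that the transform of the product
  vanishes.\<close>

lemma AE_zero_if_gaussian_orthogonal:
  assumes h: "L2_fun h" and orth: "\<And>a. (LINT \<xi>|lborel. h \<xi> * (gaussian \<xi> * cis (a * \<xi>))) = 0"
  shows "AE \<xi> in lborel. h \<xi> = 0"
proof -
  have "L2_fun gaussian" using L2_fun_gaussian_shifted(2)[of 0] by simp
  hence "integrable lborel (\<lambda>\<xi>. h \<xi> * gaussian \<xi>)" by (rule integrable_mult_L2[OF h])
  hence "AE \<xi> in lborel. h \<xi> * gaussian \<xi> = 0"
    by (rule fourier_unique) (use orth in \<open>simp add: inv_fourier_def mult.assoc\<close>)
  thus ?thesis by eventually_elim (simp add: gaussian_nonzero)
qed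

text \<open>Modulated and shifted Gaussians are transforms of each other. By the two multiplication formulas,
  both sides therefore have the same integrals against all modulated Gaussians.\<close>

lemma fourier_L2_inv_fourier:
  assumes G: "integrable lborel G" "L2_fun G"
  shows "AE \<xi> in lborel. fourier_L2 (inv_fourier G) \<xi> = G \<xi>"
proof -
  define f where "f = inv_fourier G"
  have f: "L2_fun f" unfolding f_def by (rule L2_fun_inv_fourier[OF G])
  note g = L2_fun_fourier_L2[OF f]
  have "AE \<xi> in lborel. fourier_L2 f \<xi> - G \<xi> = 0"
  proof (rule AE_zero_if_gaussian_orthogonal[OF L2_fun_diff[OF g G(2)]])
    fix a
    note \<psi> = L2_fun_gaussian_modulated[of a]
    have hat: "inv_fourier (\<lambda>\<xi>. gaussian \<xi> * cis (a * \<xi>)) (- y) = gaussian (y - a)" for y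
      using gaussian_minus[of "y - a"] by (simp add: inv_fourier_modulate inv_fourier_gaussian)
    have "(LINT \<xi>|lborel. fourier_L2 f \<xi> * (gaussian \<xi> * cis (a * \<xi>))) = (LINT y|lborel. f y * gaussian (y - a))"
      using multiplication_formula_L2[OF f \<psi>] by (simp add: hat)
    also have "\<dots> = (LINT y|lborel. gaussian (y - a) * inv_fourier G y)"
      by (simp add: f_def mult.commute)
    also have "\<dots> = (LINT \<xi>|lborel. G \<xi> * inv_fourier (\<lambda>y. gaussian (y - a)) \<xi>)"
      by (rule multiplication_formula[OF L2_fun_gaussian_shifted(1) G(1)])
    also have "\<dots> = (LINT \<xi>|lborel. G \<xi> * (gaussian \<xi> * cis (a * \<xi>)))"
      by (simp add: inv_fourier_shift inv_fourier_gaussian mult.commute)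
    finally show "(LINT \<xi>|lborel. (fourier_L2 f \<xi> - G \<xi>) * (gaussian \<xi> * cis (a * \<xi>))) = 0"
      by (simp add: left_diff_distrib integrable_mult_L2[OF g \<psi>(2)] integrable_mult_L2[OF G(2) \<psi>(2)])
  qed
  thus ?thesis by eventually_elim (simp add: f_def)
qed

lemma AE_zero_continuous:
  fixes h :: "real \<Rightarrow> complex"
  assumes "AE x in lborel. h x = 0" "continuous_on UNIV h"
  shows "h x = 0"
proof -
  have "x \<in> h -` {0}"
  proof (rule mem_closed_if_AE_lebesgue)
    show "closed (h -` {0})" by (intro closed_vimage assms) auto
    show "AE x in lebesgue. x \<in> h -` {0}" using AE_completion[OF assms(1)] by simp
  qed
  thus ?thesis by simp
qed

text \<open>By \<open>fourier_L2_inv_fourier\<close> the two functions have the same transform almost everywhere, so their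
  difference is orthogonal to the transforms of all shifted Gaussians; and it is continuous.\<close>

lemma fourier_inversion:
  assumes f: "L2_fun f" "continuous_on UNIV f" and int: "integrable lborel (fourier_L2 f)"
  shows "f = inv_fourier (fourier_L2 f)"
proof
  fix x
  define g where "g = fourier_L2 f"
  note [measurable] = borel_measurable_integrable[OF int, folded g_def]
  have g: "L2_fun g" "integrable lborel g" unfolding g_def by (intro L2_fun_fourier_L2 f int)+
  define f' where "f' = inv_fourier g"
  have f': "L2_fun f'" unfolding f'_def by (intro L2_fun_inv_fourier g)
  have g': "AE \<xi> in lborel. fourier_L2 f' \<xi> = g \<xi>"
    unfolding f'_def by (intro fourier_L2_inv_fourier g)
  have [measurable]: "fourier_L2 f' \<in> borel_measurable borel" using L2_fun_fourier_L2[OF f'] by (simp add: L2_fun_def)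
  have "AE y in lborel. f y - f' y = 0"
  proof (rule AE_zero_if_gaussian_orthogonal[OF L2_fun_diff[OF f(1) f']])
    fix a
    \<comment> \<open>the multiplication formula evaluates the transform at \<open>- y\<close>, hence the shift by \<open>- a\<close>\<close>
    note \<psi> = L2_fun_gaussian_shifted[of "- a"]
    have [measurable]: "(\<lambda>\<xi>. gaussian (\<xi> - - a)) \<in> borel_measurable borel" by measurable
    have hat: "inv_fourier (\<lambda>\<xi>. gaussian (\<xi> - - a)) (- y) = gaussian y * cis (a * y)" for y
      unfolding inv_fourier_shift inv_fourier_gaussian by (simp add: gaussian_minus mult.commute)
    have "(LINT \<xi>|lborel. g \<xi> * gaussian (\<xi> - - a)) = (LINT \<xi>|lborel. fourier_L2 f' \<xi> * gaussian (\<xi> - - a))"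
      by (rule integral_cong_AE) (use g' in auto)
    hence "(LINT y|lborel. f y * (gaussian y * cis (a * y))) = (LINT y|lborel. f' y * (gaussian y * cis (a * y)))"
      using multiplication_formula_L2[OF f(1) \<psi>] multiplication_formula_L2[OF f' \<psi>] unfolding hat g_def by simp
    thus "(LINT y|lborel. (f y - f' y) * (gaussian y * cis (a * y))) = 0"
      using integrable_mult_L2[OF f(1) L2_fun_gaussian_modulated(2)] integrable_mult_L2[OF f' L2_fun_gaussian_modulated(2)]
      by (simp add: left_diff_distrib)
  qed
  moreover have "continuous_on UNIV (\<lambda>y. f y - f' y)"
    unfolding f'_def by (intro continuous_intros f continuous_on_inv_fourier g)
  ultimately have "f x - f' x = 0" by (rule AE_zero_continuous)
  thus "f x = inv_fourier (fourier_L2 f) x" by (simp add: f'_def g_def)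
qed

lemma norm_cis_minus_one_le: "cmod (cis t - 1) \<le> \<bar>t\<bar>"
  using iexp_approx1[of t 0] by (simp add: cis_conv_exp)

text \<open>Differentiation under the integral sign: by \<open>norm_cis_minus_one_le\<close> the difference quotients of the
  integrand are dominated by \<open>|\<xi> G \<xi>|\<close>.\<close>

lemma has_vector_derivative_inv_fourier:
  assumes G: "integrable lborel G" and G': "integrable lborel (\<lambda>\<xi>. \<i> * of_real \<xi> * G \<xi>)"
  shows "(inv_fourier G has_vector_derivative inv_fourier (\<lambda>\<xi>. \<i> * of_real \<xi> * G \<xi>) x) (at x)"
proof -
  let ?G' = "\<lambda>\<xi>. \<i> * of_real \<xi> * G \<xi>"
  let ?d = "\<lambda>\<xi> h. cis (h * \<xi>) - 1 - h *\<^sub>R (\<xi> *\<^sub>R \<i>)"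
  let ?r = "\<lambda>h. inv_fourier G (x + h) - inv_fourier G x - h *\<^sub>R inv_fourier (\<lambda>\<xi>. \<i> * of_real \<xi> * G \<xi>) x"
  let ?I = "\<lambda>H. LINT \<xi>|lborel. H \<xi> * cis (x * \<xi>)"
  have [measurable]: "G \<in> borel_measurable borel" using borel_measurable_integrable[OF G] by simp
  define c where "c = complex_of_real (1 / sqrt (2 * pi))"
  define R where "R = (\<lambda>h \<xi>. G \<xi> * cis (x * \<xi>) * ((cis (h * \<xi>) - 1) / of_real h - \<i> * of_real \<xi>))"
  have Rb: "cmod (R h \<xi>) \<le> 2 * cmod (\<i> * of_real \<xi> * G \<xi>)" if "h \<noteq> 0" for h \<xi>
  proof -
    have "cmod ((cis (h * \<xi>) - 1) / of_real h) \<le> \<bar>\<xi>\<bar>"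
      using norm_cis_minus_one_le[of "h * \<xi>"] that
      by (simp add: norm_divide divide_le_eq abs_mult mult.commute)
    hence "cmod ((cis (h * \<xi>) - 1) / of_real h - \<i> * of_real \<xi>) \<le> 2 * \<bar>\<xi>\<bar>"
      by (intro order_trans[OF norm_triangle_ineq4]) (simp add: norm_mult)
    from mult_left_mono[OF this norm_ge_zero[of "G \<xi>"]] show ?thesis
      by (simp add: R_def norm_mult mult_ac)
  qed
  have Rm: "R h \<in> borel_measurable lborel" for h unfolding R_def by measurable
  have Rlim: "(\<lambda>n. R (X n) \<xi>) \<longlonglongrightarrow> 0" if X: "\<And>n. X n \<noteq> 0" "X \<longlonglongrightarrow> 0" for X :: "nat \<Rightarrow> real" and \<xi>
  proof -
    have "((\<lambda>h. cis (h * \<xi>)) has_vector_derivative (\<xi> *\<^sub>R (\<i> * cis (0 * \<xi>)))) (at 0)"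
    proof -
      have "((\<lambda>h. cis (h * \<xi>)) has_derivative (\<lambda>t. (t * \<xi>) *\<^sub>R (\<i> * cis (0 * \<xi>)))) (at 0)"
        by (intro has_derivative_cis has_derivative_mult_left has_derivative_ident)
      thus ?thesis by (simp add: has_vector_derivative_def)
    qed
    hence "((\<lambda>h. norm (cis ((0 + h) * \<xi>) - cis (0 * \<xi>) - h *\<^sub>R (\<xi> *\<^sub>R (\<i> * cis (0 * \<xi>)))) / norm h) \<longlongrightarrow> 0) (at 0)"
      unfolding has_vector_derivative_def has_derivative_at by blast
    hence "((\<lambda>h. cmod (?d \<xi> h) / \<bar>h\<bar>) \<longlongrightarrow> 0) (at 0)"
      by simp
    hence "(\<lambda>n. cmod (?d \<xi> (X n)) / \<bar>X n\<bar>) \<longlonglongrightarrow> 0"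
      using X unfolding tendsto_at_iff_sequentially comp_def by blast
    hence "(\<lambda>n. cmod (G \<xi>) * (cmod (?d \<xi> (X n)) / \<bar>X n\<bar>)) \<longlonglongrightarrow> cmod (G \<xi>) * 0"
      by (intro tendsto_intros)
    moreover have "cmod (G \<xi>) * (cmod (?d \<xi> (X n)) / \<bar>X n\<bar>) = cmod (R (X n) \<xi>)" for n
    proof -
      have "(cis (X n * \<xi>) - 1) / of_real (X n) - \<i> * of_real \<xi> = (?d \<xi> (X n)) / of_real (X n)"
        using X(1)[of n] by (simp add: scaleR_conv_of_real divide_simps mult_ac)
      thus ?thesis by (simp only: R_def norm_mult norm_divide norm_of_real norm_cis mult_1_right)
    qed
    ultimately have "(\<lambda>n. cmod (R (X n) \<xi>)) \<longlonglongrightarrow> 0" by simp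
    thus ?thesis by (rule tendsto_norm_zero_cancel)
  qed
  have Rint: "?r h
      = of_real h * (c * (LINT \<xi>|lborel. R h \<xi>))" if "h \<noteq> 0" for h
  proof -
    note i = integrable_mult_cis[OF G] integrable_mult_cis[OF G']
    have "of_real h * (LINT \<xi>|lborel. R h \<xi>) = (LINT \<xi>|lborel. G \<xi> * cis ((x + h) * \<xi>) - G \<xi> * cis (x * \<xi>) - of_real h * (\<i> * of_real \<xi> * G \<xi> * cis (x * \<xi>)))"
      unfolding integral_mult_right_zero[symmetric] R_def
      by (intro Bochner_Integration.integral_cong refl)
         (use that in \<open>simp add: cis_mult[symmetric] distrib_right field_simps\<close>)
    also have "\<dots> = (LINT \<xi>|lborel. G \<xi> * cis ((x + h) * \<xi>)) - ?I G
         - of_real h * ?I ?G'"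
      by (simp add: i)
    finally have "c * (of_real h * (LINT \<xi>|lborel. R h \<xi>)) = c * ((LINT \<xi>|lborel. G \<xi> * cis ((x + h) * \<xi>)) - ?I G
         - of_real h * ?I ?G')" by simp
    thus ?thesis unfolding inv_fourier_def c_def[symmetric]
      by (simp add: scaleR_conv_of_real right_diff_distrib mult_ac)
  qed
  have "((\<lambda>h. norm (?r h) / norm h) \<longlongrightarrow> 0) (at 0)"
    unfolding tendsto_at_iff_sequentially comp_def
  proof (intro allI impI)
    fix X :: "nat \<Rightarrow> real" assume "\<forall>i. X i \<in> UNIV - {0}" and X: "X \<longlonglongrightarrow> 0"
    hence X0: "\<And>n. X n \<noteq> 0" by auto
    have "(\<lambda>n. LINT \<xi>|lborel. R (X n) \<xi>) \<longlonglongrightarrow> integral\<^sup>L lborel (\<lambda>\<xi>::real. 0::complex)"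
    proof (rule integral_dominated_convergence[where w = "\<lambda>\<xi>. 2 * cmod (\<i> * of_real \<xi> * G \<xi>)"])
      show "integrable lborel (\<lambda>\<xi>. 2 * cmod (\<i> * of_real \<xi> * G \<xi>))"
        by (intro integrable_mult_right integrable_norm G')
    qed (use Rb X0 Rm Rlim[OF X0 X] in auto)
    hence "(\<lambda>n. cmod (c * (LINT \<xi>|lborel. R (X n) \<xi>))) \<longlonglongrightarrow> cmod (c * 0)"
      by (intro tendsto_intros) simp
    moreover have "norm (?r (X n)) / norm (X n)
        = cmod (c * (LINT \<xi>|lborel. R (X n) \<xi>))" for n
      unfolding Rint[OF X0] using X0[of n] by (simp add: norm_mult)
    ultimately show "(\<lambda>n. norm (?r (X n)) / norm (X n)) \<longlonglongrightarrow> 0"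
      by simp
  qed
  thus ?thesis
    unfolding has_vector_derivative_def has_derivative_at
    by (auto intro: bounded_linear_scaleR_left)
qed

section \<open>Sobolev weights\<close>

lemma nn_integral_inverse_1_plus_square:
  "(\<integral>\<^sup>+x. ennreal (1 / (1 + x\<^sup>2)) \<partial>lborel) = ennreal pi"
proof -
  have i: "integrable lborel (\<lambda>x::real. 1 / (1 + x\<^sup>2))"
    using integrable_inverse_1_plus_square by (simp add: set_integrable_def inverse_eq_divide)
  have "(LINT x|lborel. 1 / (1 + x\<^sup>2)) = pi"
    using LBINT_inverse_1_plus_square
    by (simp add: interval_lebesgue_integral_def set_lebesgue_integral_def inverse_eq_divide)
  thus ?thesis by (subst nn_integral_eq_integral[OF i]) auto
qed

text \<open>The Japanese bracket \<open>(1 + \<xi>\<^sup>2)\<^sup>1\<^sup>/\<^sup>2\<close>, raised to the power \<open>s\<close>.\<close>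

definition japanese :: "real \<Rightarrow> real \<Rightarrow> real" where
  "japanese s \<xi> = (1 + \<xi>\<^sup>2) powr (s / 2)"

lemma japanese_measurable [measurable]: "japanese s \<in> borel_measurable borel"
  unfolding japanese_def by measurable

lemma one_plus_square_pos: "0 < 1 + (\<xi>::real)\<^sup>2"
  by (simp add: add_pos_nonneg)

lemma japanese_pos: "0 < japanese s \<xi>"
  unfolding japanese_def using one_plus_square_pos[of \<xi>] by simp

lemma japanese_mono: "s \<le> r \<Longrightarrow> japanese s \<xi> \<le> japanese r \<xi>"
  unfolding japanese_def by (intro powr_mono) auto

lemma japanese_ge_1: "0 \<le> s \<Longrightarrow> 1 \<le> japanese s \<xi>"
  unfolding japanese_def by (intro ge_one_powr_ge_zero) auto

lemma japanese_square: "(japanese s \<xi>)\<^sup>2 = (1 + \<xi>\<^sup>2) powr s"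
  unfolding japanese_def power2_eq_square powr_add[symmetric] by simp

lemma japanese_Suc: "japanese (s + 1) \<xi> = japanese s \<xi> * sqrt (1 + \<xi>\<^sup>2)"
  unfolding japanese_def using one_plus_square_pos[of \<xi>]
  by (simp add: add_divide_distrib powr_add powr_half_sqrt)

lemma abs_le_sqrt_one_plus_square: "\<bar>\<xi>\<bar> \<le> sqrt (1 + \<xi>\<^sup>2)"
  by (rule real_le_rsqrt) simp

lemma japanese_Suc_ge: "japanese s \<xi> * \<bar>\<xi>\<bar> \<le> japanese (s + 1) \<xi>"
  unfolding japanese_Suc using japanese_pos[of s \<xi>] abs_le_sqrt_one_plus_square[of \<xi>]
  by (intro mult_left_mono) auto

lemma inverse_japanese_square_le: "1 \<le> s \<Longrightarrow> (1 / japanese s \<xi>)\<^sup>2 \<le> 1 / (1 + \<xi>\<^sup>2)"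
proof -
  assume "1 \<le> s"
  hence "(1 + \<xi>\<^sup>2) powr 1 \<le> (1 + \<xi>\<^sup>2) powr s" by (intro powr_mono) auto
  hence "1 + \<xi>\<^sup>2 \<le> (japanese s \<xi>)\<^sup>2" using one_plus_square_pos[of \<xi>] by (simp add: japanese_square)
  thus ?thesis unfolding power_divide
    using one_plus_square_pos[of \<xi>] by (simp add: frac_le)
qed

lemma L2_sq_inverse_japanese_le:
  assumes "1 \<le> s"
  shows "L2_sq (\<lambda>\<xi>. complex_of_real (1 / japanese s \<xi>)) \<le> ennreal pi"
proof -
  have "L2_sq (\<lambda>\<xi>. complex_of_real (1 / japanese s \<xi>)) \<le> (\<integral>\<^sup>+\<xi>. ennreal (1 / (1 + \<xi>\<^sup>2)) \<partial>lborel)"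
    unfolding L2_sq_def norm_of_real power2_abs
    by (intro nn_integral_mono ennreal_leI inverse_japanese_square_le assms)
  thus ?thesis by (simp add: nn_integral_inverse_1_plus_square)
qed

lemma L2_fun_inverse_japanese: "1 \<le> s \<Longrightarrow> L2_fun (\<lambda>\<xi>. complex_of_real (1 / japanese s \<xi>))"
  using L2_sq_inverse_japanese_le[of s] by (auto simp: L2_fun_iff intro: le_less_trans)

text \<open>For \<open>s \<ge> 1\<close> the reciprocal of the weight is square integrable.\<close>

lemma weighted_L2_imp_integrable:
  assumes "1 \<le> s" and L2: "L2_fun (\<lambda>\<xi>. of_real (japanese s \<xi>) * G \<xi>)"
  shows "integrable lborel G"
proof -
  have "integrable lborel (\<lambda>\<xi>. of_real (japanese s \<xi>) * G \<xi> * of_real (1 / japanese s \<xi>))"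
    by (rule integrable_mult_L2[OF L2 L2_fun_inverse_japanese[OF assms(1)]])
  moreover have "of_real (japanese s \<xi>) * G \<xi> * of_real (1 / japanese s \<xi>) = G \<xi>" for \<xi>
    using japanese_pos[of s \<xi>] by simp
  ultimately show ?thesis by simp
qed

lemma weighted_L2_imp_L2:
  assumes "0 \<le> s" "G \<in> borel_measurable borel" "L2_fun (\<lambda>\<xi>. of_real (japanese s \<xi>) * G \<xi>)"
  shows "L2_fun G"
proof (rule L2_fun_mono[OF assms(3,2)])
  fix \<xi>
  show "cmod (G \<xi>) \<le> cmod (of_real (japanese s \<xi>) * G \<xi>)"
    using mult_right_mono[OF japanese_ge_1[OF assms(1)] norm_ge_zero[of "G \<xi>"]]
    using japanese_pos[of s \<xi>] by (simp add: norm_mult)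
qed

lemma L2_sq_scale: "F \<in> borel_measurable borel \<Longrightarrow> L2_sq (\<lambda>x. c * F x) = ennreal ((cmod c)\<^sup>2) * L2_sq F"
  unfolding L2_sq_def by (simp add: norm_mult power_mult_distrib ennreal_mult nn_integral_cmult)

lemma L2_sq_cong_AE:
  assumes "AE x in lborel. F x = G x"
  shows "L2_sq F = L2_sq G"
  unfolding L2_sq_def by (intro nn_integral_cong_AE) (use assms in eventually_elim, simp)

lemma L2_fun_cong_AE:
  assumes "AE x in lborel. F x = G x" "F \<in> borel_measurable borel" "L2_fun G"
  shows "L2_fun F"
  using assms L2_sq_cong_AE[OF assms(1)] by (simp add: L2_fun_iff)

section \<open>Spectral description of the spaces of analytic functions\<close>

definition taylor_weight :: "real \<Rightarrow> nat \<Rightarrow> real" where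
  "taylor_weight \<delta> k = \<delta> ^ k * (real k + 1)\<^sup>2 / fact k"

definition spectral_weight :: "real \<Rightarrow> real \<Rightarrow> nat \<Rightarrow> real \<Rightarrow> real" where
  "spectral_weight \<delta> s k \<xi> = taylor_weight \<delta> k * \<bar>\<xi>\<bar> ^ k * japanese s \<xi>"

text \<open>\<open>G\<close> is the Fourier transform of a function whose norm in \<open>E_cplx \<delta> s\<close> is at most \<open>p\<close>; see
  \<open>E_bound_iff_spectral\<close>.\<close>

definition spectral_bound :: "real \<Rightarrow> real \<Rightarrow> (real \<Rightarrow> complex) \<Rightarrow> real \<Rightarrow> bool" where
  "spectral_bound \<delta> s G p \<longleftrightarrow> G \<in> borel_measurable borel \<and> 0 \<le> p \<and>
     (\<forall>k. L2_sq (\<lambda>\<xi>. of_real (spectral_weight \<delta> s k \<xi>) * G \<xi>) \<le> ennreal (p\<^sup>2))"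

lemma spectral_weight_measurable [measurable]: "spectral_weight \<delta> s k \<in> borel_measurable borel"
  unfolding spectral_weight_def by measurable

lemma taylor_weight_pos: "0 < \<delta> \<Longrightarrow> 0 < taylor_weight \<delta> k"
  unfolding taylor_weight_def by simp

lemma spectral_weight_nonneg: "0 < \<delta> \<Longrightarrow> 0 \<le> spectral_weight \<delta> s k \<xi>"
  unfolding spectral_weight_def using taylor_weight_pos[of \<delta> k] japanese_pos[of s \<xi>] by simp

lemma spectral_boundD:
  assumes "spectral_bound \<delta> s G p"
  shows "G \<in> borel_measurable borel" "0 \<le> p"
    "L2_sq (\<lambda>\<xi>. of_real (spectral_weight \<delta> s k \<xi>) * G \<xi>) \<le> ennreal (p\<^sup>2)"
  using assms by (auto simp: spectral_bound_def)

text \<open>All Fourier multipliers below are estimated by comparing weights pointwise. The index \<open>k'\<close> may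
  differ from \<open>k\<close>: for the derivative it is \<open>k + 1\<close>.\<close>

lemma spectral_transfer:
  assumes G: "spectral_bound \<delta>' s' G p" and H: "H \<in> borel_measurable borel" and c: "0 \<le> c" and \<delta>: "0 < \<delta>"
    and le: "\<And>k. \<exists>k'. \<forall>\<xi>. spectral_weight \<delta> s k \<xi> * cmod (H \<xi>) \<le> c * (spectral_weight \<delta>' s' k' \<xi> * cmod (G \<xi>))"
  shows "spectral_bound \<delta> s H (c * p)"
  unfolding spectral_bound_def
proof (intro conjI allI)
  note [measurable] = spectral_boundD(1)[OF G]
  show "0 \<le> c * p" using c spectral_boundD(2)[OF G] by simp
  fix k
  obtain k' where k': "\<And>\<xi>. spectral_weight \<delta> s k \<xi> * cmod (H \<xi>) \<le> c * (spectral_weight \<delta>' s' k' \<xi> * cmod (G \<xi>))"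
    using le by blast
  have "L2_sq (\<lambda>\<xi>. of_real (spectral_weight \<delta> s k \<xi>) * H \<xi>)
      \<le> L2_sq (\<lambda>\<xi>. of_real c * (of_real (spectral_weight \<delta>' s' k' \<xi>) * G \<xi>))"
    unfolding L2_sq_def
  proof (intro nn_integral_mono ennreal_leI power_mono)
    fix \<xi>
    have "cmod (of_real (spectral_weight \<delta> s k \<xi>) * H \<xi>) = spectral_weight \<delta> s k \<xi> * cmod (H \<xi>)"
      using spectral_weight_nonneg[OF \<delta>] by (simp add: norm_mult)
    also have "\<dots> \<le> c * (spectral_weight \<delta>' s' k' \<xi> * cmod (G \<xi>))" by (rule k')
    also have "\<dots> \<le> c * (\<bar>spectral_weight \<delta>' s' k' \<xi>\<bar> * cmod (G \<xi>))"
      using c by (intro mult_left_mono mult_right_mono) auto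
    finally show "cmod (of_real (spectral_weight \<delta> s k \<xi>) * H \<xi>)
        \<le> cmod (of_real c * (of_real (spectral_weight \<delta>' s' k' \<xi>) * G \<xi>))"
      using c by (simp add: norm_mult)
  qed auto
  also have "\<dots> = ennreal (c\<^sup>2) * L2_sq (\<lambda>\<xi>. of_real (spectral_weight \<delta>' s' k' \<xi>) * G \<xi>)"
    by (subst L2_sq_scale) (auto simp: norm_of_real)
  also have "\<dots> \<le> ennreal (c\<^sup>2) * ennreal (p\<^sup>2)"
    by (intro mult_left_mono spectral_boundD(3)[OF G]) auto
  also have "\<dots> = ennreal ((c * p)\<^sup>2)" by (simp add: power_mult_distrib ennreal_mult)
  finally show "L2_sq (\<lambda>\<xi>. of_real (spectral_weight \<delta> s k \<xi>) * H \<xi>) \<le> ennreal ((c * p)\<^sup>2)" .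
qed (rule H)

lemma spectral_L2:
  assumes G: "spectral_bound \<delta> s G p" and \<delta>: "0 < \<delta>"
  shows "L2_fun (\<lambda>\<xi>. of_real (japanese s \<xi>) * ((\<i> * of_real \<xi>) ^ k * G \<xi>))"
proof -
  note [measurable] = spectral_boundD(1)[OF G]
  let ?F = "\<lambda>\<xi>. of_real (spectral_weight \<delta> s k \<xi>) * G \<xi>"
  have "L2_sq (\<lambda>\<xi>. of_real (1 / taylor_weight \<delta> k) * ?F \<xi>) \<le> ennreal ((cmod (of_real (1 / taylor_weight \<delta> k)))\<^sup>2) * ennreal (p\<^sup>2)"
    by (subst L2_sq_scale) (auto intro!: mult_left_mono spectral_boundD(3)[OF G])
  also have "\<dots> < \<infinity>" by (simp flip: ennreal_mult)
  finally have "L2_fun (\<lambda>\<xi>. of_real (1 / taylor_weight \<delta> k) * ?F \<xi>)" by (simp add: L2_fun_iff)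
  thus ?thesis
    by (rule L2_fun_mono)
       (use taylor_weight_pos[OF \<delta>, of k] japanese_pos[of s] in
         \<open>simp_all add: spectral_weight_def norm_mult norm_power norm_divide mult_ac\<close>)
qed

lemma spectral_integrable:
  assumes "spectral_bound \<delta> s G p" "0 < \<delta>" "1 \<le> s"
  shows "integrable lborel (\<lambda>\<xi>. (\<i> * of_real \<xi>) ^ k * G \<xi>)" "integrable lborel G"
    "L2_fun (\<lambda>\<xi>. (\<i> * of_real \<xi>) ^ k * G \<xi>)" "L2_fun G"
proof -
  note [measurable] = spectral_boundD(1)[OF assms(1)]
  show i: "integrable lborel (\<lambda>\<xi>. (\<i> * of_real \<xi>) ^ k * G \<xi>)" for k
    by (rule weighted_L2_imp_integrable[OF assms(3) spectral_L2[OF assms(1,2)]])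
  show "integrable lborel G" using i[of 0] by simp
  show L: "L2_fun (\<lambda>\<xi>. (\<i> * of_real \<xi>) ^ k * G \<xi>)" for k
    by (rule weighted_L2_imp_L2[OF _ _ spectral_L2[OF assms(1,2)]]) (use assms in auto)
  show "L2_fun G" using L[of 0] by simp
qed

lemma vderiv_inv_fourier:
  assumes "integrable lborel G" "integrable lborel (\<lambda>\<xi>. \<i> * of_real \<xi> * G \<xi>)"
  shows "vderiv (inv_fourier G) = inv_fourier (\<lambda>\<xi>. \<i> * of_real \<xi> * G \<xi>)"
  unfolding vderiv_def
  by (rule ext) (intro vector_derivative_at has_vector_derivative_inv_fourier assms)

lemma spectral_vderiv_power:
  assumes "spectral_bound \<delta> s G p" "0 < \<delta>" "1 \<le> s"
  shows "(vderiv ^^ k) (inv_fourier G) = inv_fourier (\<lambda>\<xi>. (\<i> * of_real \<xi>) ^ k * G \<xi>)"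
proof (induction k)
  case (Suc k)
  thus ?case
    using vderiv_inv_fourier[OF spectral_integrable(1)[OF assms, of k]] spectral_integrable(1)[OF assms, of "Suc k"]
    by (simp add: mult.assoc)
qed simp

lemma ennreal_sobolev_norm_square:
  assumes "in_sobolev s f"
  shows "ennreal ((sobolev_norm s f)\<^sup>2) = L2_sq (\<lambda>\<xi>. of_real (japanese s \<xi>) * fourier_L2 f \<xi>)"
proof -
  have "L2_fun (\<lambda>\<xi>. of_real (japanese s \<xi>) * fourier_L2 f \<xi>)"
    using assms by (simp add: in_sobolev_def japanese_def)
  hence i: "integrable lborel (\<lambda>\<xi>. (cmod (of_real (japanese s \<xi>) * fourier_L2 f \<xi>))\<^sup>2)"
    by (simp add: L2_fun_def)
  have "0 \<le> (LINT \<xi>|lborel. (cmod (of_real (japanese s \<xi>) * fourier_L2 f \<xi>))\<^sup>2)"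
    by (rule integral_nonneg_AE) auto
  thus ?thesis
    unfolding L2_sq_def using nn_integral_eq_integral[OF i]
    by (simp add: sobolev_norm_def japanese_def)
qed

lemma sobolev_norm_nonneg: "0 \<le> sobolev_norm s f"
  unfolding sobolev_norm_def by (intro real_sqrt_ge_zero integral_nonneg_AE) auto

lemma E_weight_eq: "E_weight \<delta> s f k = taylor_weight \<delta> k * sobolev_norm s ((vderiv ^^ k) f)"
  by (simp add: E_weight_def taylor_weight_def)

text \<open>Membership and bound form one predicate because \<open>E_norm\<close> alone means nothing outside \<open>E_cplx\<close>, where the
  supremum need not exist.\<close>

definition E_bound :: "real \<Rightarrow> real \<Rightarrow> (real \<Rightarrow> complex) \<Rightarrow> real \<Rightarrow> bool" where
  "E_bound \<delta> s f p \<longleftrightarrow> f \<in> E_cplx \<delta> s \<and> E_norm \<delta> s f \<le> p"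

lemma L2_sq_spectral_weight:
  assumes [measurable]: "G \<in> borel_measurable borel" and \<delta>: "0 < \<delta>"
  shows "L2_sq (\<lambda>\<xi>. of_real (spectral_weight \<delta> s k \<xi>) * G \<xi>)
     = ennreal ((taylor_weight \<delta> k)\<^sup>2) * L2_sq (\<lambda>\<xi>. of_real (japanese s \<xi>) * ((\<i> * of_real \<xi>) ^ k * G \<xi>))"
proof -
  have "L2_sq (\<lambda>\<xi>. of_real (spectral_weight \<delta> s k \<xi>) * G \<xi>)
     = L2_sq (\<lambda>\<xi>. of_real (taylor_weight \<delta> k) * (of_real (japanese s \<xi>) * ((\<i> * of_real \<xi>) ^ k * G \<xi>)))"
    unfolding L2_sq_def
    by (intro nn_integral_cong) (simp add: spectral_weight_def norm_mult norm_power mult_ac)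
  thus ?thesis by (subst (asm) L2_sq_scale) (auto simp: norm_of_real)
qed

lemma spectral_imp_fourier_L2:
  assumes "spectral_bound \<delta> s G p" "0 < \<delta>" "1 \<le> s"
  shows "AE \<xi> in lborel. fourier_L2 ((vderiv ^^ k) (inv_fourier G)) \<xi> = (\<i> * of_real \<xi>) ^ k * G \<xi>"
  unfolding spectral_vderiv_power[OF assms]
  by (intro fourier_L2_inv_fourier spectral_integrable[OF assms])

lemma spectral_imp_smooth:
  assumes "spectral_bound \<delta> s G p" "0 < \<delta>" "1 \<le> s"
  shows "smooth_fun (inv_fourier G)"
  unfolding smooth_fun_def spectral_vderiv_power[OF assms]
proof (intro allI)
  fix k x
  have "integrable lborel (\<lambda>\<xi>. \<i> * of_real \<xi> * ((\<i> * of_real \<xi>) ^ k * G \<xi>))"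
    using spectral_integrable(1)[OF assms, of "Suc k"] by (simp add: mult.assoc)
  from has_vector_derivative_inv_fourier[OF spectral_integrable(1)[OF assms] this]
  show "inv_fourier (\<lambda>\<xi>. (\<i> * of_real \<xi>) ^ k * G \<xi>) differentiable at x"
    by (rule differentiableI_vector)
qed

lemma spectral_imp_in_sobolev:
  assumes "spectral_bound \<delta> s G p" "0 < \<delta>" "1 \<le> s"
  shows "in_sobolev s ((vderiv ^^ k) (inv_fourier G))"
proof -
  note [measurable] = spectral_boundD(1)[OF assms(1)]
  have L: "L2_fun ((vderiv ^^ k) (inv_fourier G))"
    unfolding spectral_vderiv_power[OF assms] by (intro L2_fun_inv_fourier spectral_integrable[OF assms])
  have [measurable]: "fourier_L2 ((vderiv ^^ k) (inv_fourier G)) \<in> borel_measurable borel"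
    using L2_fun_fourier_L2[OF L] by (simp add: L2_fun_def)
  have "L2_fun (\<lambda>\<xi>. of_real (japanese s \<xi>) * fourier_L2 ((vderiv ^^ k) (inv_fourier G)) \<xi>)"
    by (rule L2_fun_cong_AE[OF _ _ spectral_L2[OF assms(1,2), of k]])
       (use spectral_imp_fourier_L2[OF assms, of k] in \<open>eventually_elim, simp\<close>, measurable)
  thus ?thesis using L by (simp add: in_sobolev_def japanese_def)
qed

lemma spectral_imp_E_bound:
  assumes "spectral_bound \<delta> s G p" "0 < \<delta>" "1 \<le> s"
  shows "E_bound \<delta> s (inv_fourier G) p"
proof -
  note [measurable] = spectral_boundD(1)[OF assms(1)]
  have W: "E_weight \<delta> s (inv_fourier G) k \<le> p" for k
  proof -
    let ?f = "(vderiv ^^ k) (inv_fourier G)"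
    have "ennreal ((E_weight \<delta> s (inv_fourier G) k)\<^sup>2) = ennreal ((taylor_weight \<delta> k)\<^sup>2) * ennreal ((sobolev_norm s ?f)\<^sup>2)"
      by (simp add: E_weight_eq power_mult_distrib ennreal_mult)
    also have "ennreal ((sobolev_norm s ?f)\<^sup>2) = L2_sq (\<lambda>\<xi>. of_real (japanese s \<xi>) * fourier_L2 ?f \<xi>)"
      by (rule ennreal_sobolev_norm_square[OF spectral_imp_in_sobolev[OF assms]])
    also have "\<dots> = L2_sq (\<lambda>\<xi>. of_real (japanese s \<xi>) * ((\<i> * of_real \<xi>) ^ k * G \<xi>))"
      by (rule L2_sq_cong_AE) (use spectral_imp_fourier_L2[OF assms, of k] in \<open>eventually_elim, simp\<close>)
    also have "ennreal ((taylor_weight \<delta> k)\<^sup>2) * \<dots> \<le> ennreal (p\<^sup>2)"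
      unfolding L2_sq_spectral_weight[OF spectral_boundD(1)[OF assms(1)] assms(2), symmetric] by (rule spectral_boundD(3)[OF assms(1)])
    finally have "(E_weight \<delta> s (inv_fourier G) k)\<^sup>2 \<le> p\<^sup>2" by (subst (asm) ennreal_le_iff) auto
    thus ?thesis using spectral_boundD(2)[OF assms(1)] by (rule power2_le_imp_le)
  qed
  have "E_norm \<delta> s (inv_fourier G) \<le> p" unfolding E_norm_def using W by (intro cSUP_least) auto
  moreover have "bdd_above (range (E_weight \<delta> s (inv_fourier G)))" using W by (auto intro!: bdd_aboveI)
  ultimately show ?thesis
    using spectral_imp_smooth[OF assms] spectral_imp_in_sobolev[OF assms] by (simp add: E_bound_def E_cplx_def)
qed

text \<open>The assumption \<open>s \<ge> 2\<close> leaves a weight of order at least 1 after multiplication by \<open>\<xi>\<close>, so both the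
  transform of \<open>f\<close> and its product with \<open>\<xi>\<close> are integrable.\<close>

lemma in_sobolev_imp_inv_fourier:
  assumes s: "2 \<le> s" and f: "in_sobolev s f" "continuous_on UNIV f"
  shows "f = inv_fourier (fourier_L2 f)" "integrable lborel (fourier_L2 f)" "L2_fun (fourier_L2 f)"
    "integrable lborel (\<lambda>\<xi>. \<i> * of_real \<xi> * fourier_L2 f \<xi>)" "L2_fun (\<lambda>\<xi>. \<i> * of_real \<xi> * fourier_L2 f \<xi>)"
proof -
  have L: "L2_fun f" "L2_fun (\<lambda>\<xi>. of_real (japanese s \<xi>) * fourier_L2 f \<xi>)"
    using f by (auto simp: in_sobolev_def japanese_def)
  show LG: "L2_fun (fourier_L2 f)" by (rule L2_fun_fourier_L2[OF L(1)])
  have [measurable]: "fourier_L2 f \<in> borel_measurable borel" using LG by (simp add: L2_fun_def)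
  show i: "integrable lborel (fourier_L2 f)" using s by (intro weighted_L2_imp_integrable[OF _ L(2)]) auto
  show "f = inv_fourier (fourier_L2 f)" by (rule fourier_inversion[OF L(1) f(2) i])
  have w: "L2_fun (\<lambda>\<xi>. of_real (japanese (s - 1) \<xi>) * (\<i> * of_real \<xi> * fourier_L2 f \<xi>))"
  proof (rule L2_fun_mono[OF L(2)])
    fix \<xi>
    show "cmod (of_real (japanese (s - 1) \<xi>) * (\<i> * of_real \<xi> * fourier_L2 f \<xi>))
       \<le> cmod (of_real (japanese s \<xi>) * fourier_L2 f \<xi>)"
      using mult_right_mono[OF japanese_Suc_ge[of "s - 1" \<xi>] norm_ge_zero[of "fourier_L2 f \<xi>"]]
        japanese_pos[of s \<xi>] japanese_pos[of "s - 1" \<xi>] by (simp add: norm_mult mult.assoc)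
  qed measurable
  show "integrable lborel (\<lambda>\<xi>. \<i> * of_real \<xi> * fourier_L2 f \<xi>)"
    using s by (intro weighted_L2_imp_integrable[OF _ w]) auto
  show "L2_fun (\<lambda>\<xi>. \<i> * of_real \<xi> * fourier_L2 f \<xi>)"
    using s by (intro weighted_L2_imp_L2[OF _ _ w]) auto
qed

lemma smooth_fun_vderiv_power: "smooth_fun f \<Longrightarrow> smooth_fun ((vderiv ^^ k) f)"
  unfolding smooth_fun_def by (metis comp_apply funpow_add)

lemma smooth_fun_continuous: "smooth_fun f \<Longrightarrow> continuous_on UNIV f"
  unfolding smooth_fun_def
  by (intro continuous_at_imp_continuous_on ballI differentiable_imp_continuous_within) (metis funpow_0)

text \<open>Every derivative of \<open>f\<close> lies in the Sobolev space, so it is the inverse transform of an integrable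
  function that may be multiplied by \<open>\<i> \<xi>\<close>. By induction, the transform of the \<open>k\<close>-th derivative is
  \<open>(\<i> \<xi>)\<^sup>k\<close> times that of \<open>f\<close>.\<close>

lemma E_bound_imp_spectral:
  assumes s: "2 \<le> s" and \<delta>: "0 < \<delta>" and f: "E_bound \<delta> s f p"
  shows "spectral_bound \<delta> s (fourier_L2 f) p" "f = inv_fourier (fourier_L2 f)"
proof -
  have sm: "smooth_fun f" and sob: "\<And>k. in_sobolev s ((vderiv ^^ k) f)"
    and bdd: "bdd_above (range (E_weight \<delta> s f))" and le: "E_norm \<delta> s f \<le> p"
    using f by (auto simp: E_bound_def E_cplx_def)
  have cont: "continuous_on UNIV ((vderiv ^^ k) f)" for k
    by (intro smooth_fun_continuous smooth_fun_vderiv_power sm)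
  note F = in_sobolev_imp_inv_fourier[OF s sob cont]
  have "f = inv_fourier (fourier_L2 f)" using F(1)[of 0] by simp
  thus "f = inv_fourier (fourier_L2 f)" .
  have [measurable]: "fourier_L2 ((vderiv ^^ k) f) \<in> borel_measurable borel" for k
    using F(3)[of k] by (simp add: L2_fun_def)
  have [measurable]: "fourier_L2 f \<in> borel_measurable borel"
    using F(3)[of 0] by (simp add: L2_fun_def)
  have G: "AE \<xi> in lborel. fourier_L2 ((vderiv ^^ k) f) \<xi> = (\<i> * of_real \<xi>) ^ k * fourier_L2 f \<xi>" for k
  proof (induction k)
    case (Suc k)
    have "(vderiv ^^ Suc k) f = vderiv ((vderiv ^^ k) f)" by simp
    also have "\<dots> = inv_fourier (\<lambda>\<xi>. \<i> * of_real \<xi> * fourier_L2 ((vderiv ^^ k) f) \<xi>)"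
      using vderiv_inv_fourier[OF F(2)[of k] F(4)[of k]] unfolding F(1)[of k, symmetric] .
    finally have "AE \<xi> in lborel. fourier_L2 ((vderiv ^^ Suc k) f) \<xi> = \<i> * of_real \<xi> * fourier_L2 ((vderiv ^^ k) f) \<xi>"
      using fourier_L2_inv_fourier[OF F(4,5)] by simp
    thus ?case using Suc by eventually_elim simp
  qed simp
  have W: "E_weight \<delta> s f k \<le> p" for k
    using cSUP_upper[OF UNIV_I bdd, of k] le unfolding E_norm_def by linarith
  have W0: "0 \<le> E_weight \<delta> s f k" for k
    unfolding E_weight_eq using taylor_weight_pos[OF \<delta>, of k] sobolev_norm_nonneg by simp
  have "L2_sq (\<lambda>\<xi>. of_real (spectral_weight \<delta> s k \<xi>) * fourier_L2 f \<xi>) \<le> ennreal (p\<^sup>2)" for k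
  proof -
    have "L2_sq (\<lambda>\<xi>. of_real (spectral_weight \<delta> s k \<xi>) * fourier_L2 f \<xi>)
      = ennreal ((taylor_weight \<delta> k)\<^sup>2) * L2_sq (\<lambda>\<xi>. of_real (japanese s \<xi>) * ((\<i> * of_real \<xi>) ^ k * fourier_L2 f \<xi>))"
      by (rule L2_sq_spectral_weight[OF _ \<delta>]) measurable
    also have "L2_sq (\<lambda>\<xi>. of_real (japanese s \<xi>) * ((\<i> * of_real \<xi>) ^ k * fourier_L2 f \<xi>))
       = L2_sq (\<lambda>\<xi>. of_real (japanese s \<xi>) * fourier_L2 ((vderiv ^^ k) f) \<xi>)"
      by (rule L2_sq_cong_AE) (use G[of k] in \<open>eventually_elim, simp\<close>)
    also have "\<dots> = ennreal ((sobolev_norm s ((vderiv ^^ k) f))\<^sup>2)"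
      by (rule ennreal_sobolev_norm_square[OF sob, symmetric])
    also have "ennreal ((taylor_weight \<delta> k)\<^sup>2) * \<dots> = ennreal ((E_weight \<delta> s f k)\<^sup>2)"
      by (simp add: E_weight_eq power_mult_distrib ennreal_mult)
    also have "\<dots> \<le> ennreal (p\<^sup>2)"
      using W W0 by (intro ennreal_leI power_mono) auto
    finally show ?thesis .
  qed
  moreover have "0 \<le> p" using W[of 0] W0[of 0] by linarith
  ultimately show "spectral_bound \<delta> s (fourier_L2 f) p" by (simp add: spectral_bound_def)
qed

lemma E_bound_iff_spectral:
  assumes "2 \<le> s" "0 < \<delta>"
  shows "E_bound \<delta> s f p \<longleftrightarrow> (\<exists>G. spectral_bound \<delta> s G p \<and> f = inv_fourier G)"
  using E_bound_imp_spectral[OF assms] spectral_imp_E_bound[of \<delta> s] assms by force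


section \<open>Fourier multipliers and series\<close>

lemma spectral_weight_mono:
  assumes "0 < \<delta>" "\<delta> \<le> \<delta>'"
  shows "spectral_weight \<delta> s k \<xi> \<le> spectral_weight \<delta>' s k \<xi>"
  unfolding spectral_weight_def taylor_weight_def
  using assms japanese_pos[of s \<xi>]
  by (intro mult_right_mono divide_right_mono power_mono) auto

lemma spectral_mono:
  assumes "spectral_bound \<delta>' s G p" "0 < \<delta>" "\<delta> \<le> \<delta>'"
  shows "spectral_bound \<delta> s G p"
proof -
  have "spectral_bound \<delta> s G (1 * p)"
    using spectral_weight_mono[OF assms(2,3)]
    by (intro spectral_transfer[OF assms(1) spectral_boundD(1)[OF assms(1)] _ assms(2)])
       (auto intro!: exI mult_right_mono)
  thus ?thesis by simp
qed

lemma spectral_order_mono: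
  assumes "spectral_bound \<delta> s G p" "0 < \<delta>" "r \<le> s"
  shows "spectral_bound \<delta> r G p"
proof -
  have "spectral_bound \<delta> r G (1 * p)"
  proof (rule spectral_transfer[OF assms(1) spectral_boundD(1)[OF assms(1)] _ assms(2)])
    fix k
    have "spectral_weight \<delta> r k \<xi> \<le> spectral_weight \<delta> s k \<xi>" for \<xi>
      unfolding spectral_weight_def using taylor_weight_pos[OF assms(2), of k]
      by (intro mult_left_mono japanese_mono assms) auto
    thus "\<exists>k'. \<forall>\<xi>. spectral_weight \<delta> r k \<xi> * cmod (G \<xi>) \<le> 1 * (spectral_weight \<delta> s k' \<xi> * cmod (G \<xi>))"
      by (auto intro!: exI[of _ k] mult_right_mono)
  qed simp
  thus ?thesis by simp
qed

lemma spectral_scale: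
  assumes "spectral_bound \<delta> s G p" "0 < \<delta>"
  shows "spectral_bound \<delta> s (\<lambda>\<xi>. c * G \<xi>) (cmod c * p)"
proof -
  note [measurable] = spectral_boundD(1)[OF assms(1)]
  show ?thesis
    by (rule spectral_transfer[OF assms(1) _ _ assms(2)]) (auto simp: norm_mult mult_ac intro!: exI)
qed

text \<open>Each of the \<open>k + 1\<close> terms of the factorization of \<open>\<delta>'\<^sup>k\<^sup>+\<^sup>1 - \<delta>\<^sup>k\<^sup>+\<^sup>1\<close> is at least \<open>\<delta>\<^sup>k\<close>.\<close>

lemma Suc_mult_power_diff_le:
  fixes \<delta> \<delta>' :: real
  assumes "0 \<le> \<delta>" "\<delta> \<le> \<delta>'"
  shows "real (Suc k) * \<delta> ^ k * (\<delta>' - \<delta>) \<le> \<delta>' ^ Suc k"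
proof -
  have "(\<Sum>i<Suc k. \<delta> ^ k) \<le> (\<Sum>i<Suc k. \<delta>' ^ i * \<delta> ^ (k - i))"
  proof (rule sum_mono)
    fix i assume "i \<in> {..<Suc k}"
    hence "\<delta> ^ k = \<delta> ^ i * \<delta> ^ (k - i)" by (simp add: power_add[symmetric])
    also have "\<dots> \<le> \<delta>' ^ i * \<delta> ^ (k - i)" using assms by (intro mult_right_mono power_mono) auto
    finally show "\<delta> ^ k \<le> \<delta>' ^ i * \<delta> ^ (k - i)" .
  qed
  hence "(\<delta>' - \<delta>) * (real (Suc k) * \<delta> ^ k) \<le> (\<delta>' - \<delta>) * (\<Sum>i<Suc k. \<delta>' ^ i * \<delta> ^ (k - i))"
    using assms by (intro mult_left_mono) auto
  also have "\<dots> = \<delta>' ^ Suc k - \<delta> ^ Suc k"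
    by (subst power_diff_sumr2) (simp add: mult.commute)
  also have "\<dots> \<le> \<delta>' ^ Suc k" using assms by simp
  finally show ?thesis by (simp add: mult_ac)
qed

text \<open>The Cauchy estimate: passing from the weight of index \<open>k\<close> for \<open>\<delta>\<close> to that of index \<open>k + 1\<close> for \<open>\<delta>'\<close>
  costs \<open>(k + 1) \<delta>\<^sup>k / \<delta>'\<^sup>k\<^sup>+\<^sup>1 \<le> 1 / (\<delta>' - \<delta>)\<close>.\<close>

lemma spectral_derivative:
  assumes G: "spectral_bound \<delta>' s G p" and \<delta>: "0 < \<delta>" "\<delta> < \<delta>'"
  shows "spectral_bound \<delta> s (\<lambda>\<xi>. \<i> * of_real \<xi> * G \<xi>) (1 / (\<delta>' - \<delta>) * p)"
proof (rule spectral_transfer[OF G _ _ \<delta>(1)])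
  note [measurable] = spectral_boundD(1)[OF G]
  show "(\<lambda>\<xi>. \<i> * of_real \<xi> * G \<xi>) \<in> borel_measurable borel" by measurable
  fix k
  have "taylor_weight \<delta> k \<le> 1 / (\<delta>' - \<delta>) * taylor_weight \<delta>' (Suc k)"
  proof -
    have "(real (Suc k) * \<delta> ^ k * (\<delta>' - \<delta>)) * (real k + 1)\<^sup>2 \<le> \<delta>' ^ Suc k * (real (Suc k) + 1)\<^sup>2"
      using \<delta> Suc_mult_power_diff_le[of \<delta> \<delta>' k] by (intro mult_mono power_mono) auto
    hence "(real (Suc k) * \<delta> ^ k * (\<delta>' - \<delta>)) * (real k + 1)\<^sup>2 / (fact (Suc k) * (\<delta>' - \<delta>))
       \<le> \<delta>' ^ Suc k * (real (Suc k) + 1)\<^sup>2 / (fact (Suc k) * (\<delta>' - \<delta>))"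
      using \<delta> by (intro divide_right_mono) auto
    moreover have "(real (Suc k) * \<delta> ^ k * (\<delta>' - \<delta>)) * (real k + 1)\<^sup>2 / (fact (Suc k) * (\<delta>' - \<delta>)) = taylor_weight \<delta> k"
      using \<delta> by (simp add: taylor_weight_def fact_Suc mult_ac del: of_nat_Suc)
    moreover have "\<delta>' ^ Suc k * (real (Suc k) + 1)\<^sup>2 / (fact (Suc k) * (\<delta>' - \<delta>)) = 1 / (\<delta>' - \<delta>) * taylor_weight \<delta>' (Suc k)"
      by (simp add: taylor_weight_def mult_ac)
    ultimately show ?thesis by simp
  qed
  hence "taylor_weight \<delta> k * (\<bar>\<xi>\<bar> ^ Suc k * japanese s \<xi> * cmod (G \<xi>))
      \<le> 1 / (\<delta>' - \<delta>) * taylor_weight \<delta>' (Suc k) * (\<bar>\<xi>\<bar> ^ Suc k * japanese s \<xi> * cmod (G \<xi>))" for \<xi>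
    using japanese_pos[of s \<xi>] by (intro mult_right_mono) auto
  thus "\<exists>k'. \<forall>\<xi>. spectral_weight \<delta> s k \<xi> * cmod (\<i> * of_real \<xi> * G \<xi>)
      \<le> 1 / (\<delta>' - \<delta>) * (spectral_weight \<delta>' s k' \<xi> * cmod (G \<xi>))"
    by (intro exI[of _ "Suc k"] allI) (simp add: spectral_weight_def norm_mult mult_ac)
qed (use \<delta> in auto)

lemma spectral_derivative_lower_order:
  assumes G: "spectral_bound \<delta> (s + 1) G p" and \<delta>: "0 < \<delta>"
  shows "spectral_bound \<delta> s (\<lambda>\<xi>. \<i> * of_real \<xi> * G \<xi>) p"
proof -
  note [measurable] = spectral_boundD(1)[OF G]
  have "spectral_bound \<delta> s (\<lambda>\<xi>. \<i> * of_real \<xi> * G \<xi>) (1 * p)"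
  proof (rule spectral_transfer[OF G _ _ \<delta>])
    fix k
    have "taylor_weight \<delta> k * \<bar>\<xi>\<bar> ^ k * cmod (G \<xi>) * (japanese s \<xi> * \<bar>\<xi>\<bar>)
      \<le> taylor_weight \<delta> k * \<bar>\<xi>\<bar> ^ k * cmod (G \<xi>) * japanese (s + 1) \<xi>" for \<xi>
      using taylor_weight_pos[OF \<delta>, of k] by (intro mult_left_mono japanese_Suc_ge) auto
    thus "\<exists>k'. \<forall>\<xi>. spectral_weight \<delta> s k \<xi> * cmod (\<i> * of_real \<xi> * G \<xi>)
      \<le> 1 * (spectral_weight \<delta> (s + 1) k' \<xi> * cmod (G \<xi>))"
      by (intro exI[of _ k] allI) (simp add: spectral_weight_def norm_mult mult_ac)
  qed measurable
  thus ?thesis by simp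
qed

text \<open>The multiplier is the symbol of the operator \<open>(1 - \<partial>\<^sub>x\<^sup>2)\<^sup>-\<^sup>1 \<partial>\<^sub>x\<close>, which is of order \<open>-1\<close>.\<close>

lemma spectral_smoothing:
  assumes G: "spectral_bound \<delta> s G p" and \<delta>: "0 < \<delta>"
  shows "spectral_bound \<delta> (s + 1) (\<lambda>\<xi>. \<i> * of_real \<xi> / of_real (1 + \<xi>\<^sup>2) * G \<xi>) p"
proof -
  note [measurable] = spectral_boundD(1)[OF G]
  have "spectral_bound \<delta> (s + 1) (\<lambda>\<xi>. \<i> * of_real \<xi> / of_real (1 + \<xi>\<^sup>2) * G \<xi>) (1 * p)"
  proof (rule spectral_transfer[OF G _ _ \<delta>])
    fix k
    have le: "sqrt (1 + \<xi>\<^sup>2) * \<bar>\<xi>\<bar> / (1 + \<xi>\<^sup>2) \<le> 1" for \<xi> :: real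
    proof -
      have "sqrt (1 + \<xi>\<^sup>2) * \<bar>\<xi>\<bar> \<le> sqrt (1 + \<xi>\<^sup>2) * sqrt (1 + \<xi>\<^sup>2)"
        by (intro mult_left_mono abs_le_sqrt_one_plus_square) auto
      thus ?thesis using one_plus_square_pos[of \<xi>] by (simp add: divide_simps)
    qed
    have "taylor_weight \<delta> k * \<bar>\<xi>\<bar> ^ k * japanese s \<xi> * cmod (G \<xi>) * (sqrt (1 + \<xi>\<^sup>2) * \<bar>\<xi>\<bar> / (1 + \<xi>\<^sup>2))
      \<le> taylor_weight \<delta> k * \<bar>\<xi>\<bar> ^ k * japanese s \<xi> * cmod (G \<xi>) * 1" for \<xi>
      using taylor_weight_pos[OF \<delta>, of k] japanese_pos[of s \<xi>] by (intro mult_left_mono le) auto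
    moreover have "cmod (of_real (1 + \<xi>\<^sup>2)) = 1 + \<xi>\<^sup>2" for \<xi> :: real
      unfolding norm_of_real using one_plus_square_pos[of \<xi>] by simp
    ultimately show "\<exists>k'. \<forall>\<xi>. spectral_weight \<delta> (s + 1) k \<xi> * cmod (\<i> * of_real \<xi> / of_real (1 + \<xi>\<^sup>2) * G \<xi>)
      \<le> 1 * (spectral_weight \<delta> s k' \<xi> * cmod (G \<xi>))"
      unfolding norm_mult norm_divide
      by (intro exI[of _ k] allI) (simp add: spectral_weight_def japanese_Suc mult_ac)
  qed measurable
  thus ?thesis by simp
qed

lemma spectral_L1_bound:
  assumes G: "spectral_bound \<delta> s G p" and \<delta>: "0 < \<delta>" and s: "1 \<le> s"
  shows "(LINT \<xi>|lborel. cmod (G \<xi>)) \<le> sqrt pi * p"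
proof -
  note [measurable] = spectral_boundD(1)[OF G]
  have "(\<integral>\<^sup>+\<xi>. ennreal (cmod (G \<xi>)) \<partial>lborel) ^ 2 =
      (\<integral>\<^sup>+\<xi>. ennreal (japanese s \<xi> * cmod (G \<xi>)) * ennreal (1 / japanese s \<xi>) \<partial>lborel) ^ 2"
    using japanese_pos[of s] by (simp add: less_imp_le[OF japanese_pos] less_imp_neq[OF japanese_pos, symmetric] flip: ennreal_mult)
  also have "\<dots> \<le> (\<integral>\<^sup>+\<xi>. ennreal (japanese s \<xi> * cmod (G \<xi>)) ^ 2 \<partial>lborel) * (\<integral>\<^sup>+\<xi>. ennreal (1 / japanese s \<xi>) ^ 2 \<partial>lborel)"
    by (intro nn_integral_Cauchy_Schwarz sigma_finite_lborel) auto
  also have "(\<integral>\<^sup>+\<xi>. ennreal (japanese s \<xi> * cmod (G \<xi>)) ^ 2 \<partial>lborel) = L2_sq (\<lambda>\<xi>. of_real (spectral_weight \<delta> s 0 \<xi>) * G \<xi>)"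
    unfolding L2_sq_def by (intro nn_integral_cong)
      (simp add: spectral_weight_def taylor_weight_def norm_mult ennreal_power less_imp_le[OF japanese_pos])
  also have "(\<integral>\<^sup>+\<xi>. ennreal (1 / japanese s \<xi>) ^ 2 \<partial>lborel) = L2_sq (\<lambda>\<xi>. complex_of_real (1 / japanese s \<xi>))"
    unfolding L2_sq_def by (intro nn_integral_cong)
      (simp add: ennreal_power norm_divide less_imp_le[OF japanese_pos])
  also have "L2_sq (\<lambda>\<xi>. of_real (spectral_weight \<delta> s 0 \<xi>) * G \<xi>) * \<dots> \<le> ennreal (p\<^sup>2) * ennreal pi"
    by (intro mult_mono spectral_boundD(3)[OF G] L2_sq_inverse_japanese_le s) auto
  also have "\<dots> = ennreal ((sqrt pi * p)\<^sup>2)" by (simp add: power_mult_distrib ennreal_mult mult.commute)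
  also have "\<dots> = ennreal (sqrt pi * p) ^ 2" using spectral_boundD(2)[OF G] by (simp add: ennreal_power)
  finally have "(\<integral>\<^sup>+\<xi>. ennreal (cmod (G \<xi>)) \<partial>lborel) ^ 2 \<le> ennreal (sqrt pi * p) ^ 2" .
  moreover have I: "(\<integral>\<^sup>+\<xi>. ennreal (cmod (G \<xi>)) \<partial>lborel) = ennreal (LINT \<xi>|lborel. cmod (G \<xi>))"
    by (intro nn_integral_eq_integral integrable_norm spectral_integrable(2)[OF G \<delta> s]) auto
  moreover have "0 \<le> (LINT \<xi>|lborel. cmod (G \<xi>))" by (rule integral_nonneg_AE) auto
  moreover have p: "0 \<le> sqrt pi * p" using spectral_boundD(2)[OF G] by simp
  ultimately have "(LINT \<xi>|lborel. cmod (G \<xi>))\<^sup>2 \<le> (sqrt pi * p)\<^sup>2"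
    by (simp only: ennreal_power) (subst (asm) ennreal_le_iff, auto)
  thus ?thesis using p by (rule power2_le_imp_le)
qed

text \<open>Completeness. Minkowski's inequality bounds the weighted norm of \<open>\<Sum>n. |G n|\<close>, so the series
  converges absolutely almost everywhere, and it may be integrated term by term.\<close>

lemma spectral_suminf:
  assumes G: "\<And>n. spectral_bound \<delta> s (G n) (p n)" and p: "summable p" and \<delta>: "0 < \<delta>" and s: "1 \<le> s"
  shows "spectral_bound \<delta> s (\<lambda>\<xi>. \<Sum>n. G n \<xi>) (\<Sum>n. p n)"
    "inv_fourier (\<lambda>\<xi>. \<Sum>n. G n \<xi>) x = (\<Sum>n. inv_fourier (G n) x)"
proof -
  let ?W = "spectral_weight \<delta> s"
  let ?I = "\<lambda>n. LINT \<xi>|lborel. G n \<xi> * cis (x * \<xi>)"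
  note [measurable] = spectral_boundD(1)[OF G]
  note p0 = spectral_boundD(2)[OF G]
  have maj: "(\<integral>\<^sup>+\<xi>. (\<Sum>n. ennreal (?W k \<xi> * cmod (G n \<xi>))) ^ 2 \<partial>lborel) \<le> ennreal ((suminf p)\<^sup>2)" for k
  proof (rule nn_integral_suminf_square_le[OF _ _ p0 p])
    fix n
    show "(\<integral>\<^sup>+\<xi>. ennreal (?W k \<xi> * cmod (G n \<xi>)) ^ 2 \<partial>lborel) \<le> ennreal ((p n)\<^sup>2)"
      using spectral_boundD(3)[OF G, of k n] spectral_weight_nonneg[OF \<delta>]
      by (simp add: L2_sq_def norm_mult ennreal_power)
  qed measurable
  have "(\<integral>\<^sup>+\<xi>. (\<Sum>n. ennreal (?W 0 \<xi> * cmod (G n \<xi>))) ^ 2 \<partial>lborel) \<noteq> \<infinity>"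
    using maj[of 0] by (auto simp: top_unique)
  hence "AE \<xi> in lborel. (\<Sum>n. ennreal (?W 0 \<xi> * cmod (G n \<xi>))) ^ 2 \<noteq> \<infinity>"
    by (intro nn_integral_PInf_AE) auto
  hence sm: "AE \<xi> in lborel. summable (\<lambda>n. cmod (G n \<xi>))"
  proof eventually_elim
    case (elim \<xi>)
    have w: "?W 0 \<xi> > 0"
      using japanese_pos[of s \<xi>] by (simp add: spectral_weight_def taylor_weight_def)
    have "(\<Sum>n. ennreal (?W 0 \<xi> * cmod (G n \<xi>))) \<noteq> top"
      using elim by (auto simp: power2_eq_square)
    hence "summable (\<lambda>n. ?W 0 \<xi> * cmod (G n \<xi>))"
      using w by (intro summable_suminf_not_top) auto
    thus ?case using w by (subst (asm) summable_cmult_iff) auto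
  qed
  show "spectral_bound \<delta> s (\<lambda>\<xi>. \<Sum>n. G n \<xi>) (\<Sum>n. p n)"
    unfolding spectral_bound_def
  proof (intro conjI allI)
    show "0 \<le> suminf p" by (intro suminf_nonneg p p0)
    fix k
    have "L2_sq (\<lambda>\<xi>. of_real (?W k \<xi>) * (\<Sum>n. G n \<xi>))
       \<le> (\<integral>\<^sup>+\<xi>. (\<Sum>n. ennreal (?W k \<xi> * cmod (G n \<xi>))) ^ 2 \<partial>lborel)"
      unfolding L2_sq_def
    proof (rule nn_integral_mono_AE, use sm in eventually_elim)
      case (elim \<xi>)
      have w: "0 \<le> ?W k \<xi>" by (rule spectral_weight_nonneg[OF \<delta>])
      have s': "summable (\<lambda>n. ?W k \<xi> * cmod (G n \<xi>))" using elim by (rule summable_mult)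
      have n0: "0 \<le> (\<Sum>n. ?W k \<xi> * cmod (G n \<xi>))" using s' w by (intro suminf_nonneg) auto
      have "cmod (of_real (?W k \<xi>) * (\<Sum>n. G n \<xi>)) \<le> ?W k \<xi> * (\<Sum>n. cmod (G n \<xi>))"
        using w summable_norm[OF elim] by (simp add: norm_mult mult_left_mono)
      also have "\<dots> = (\<Sum>n. ?W k \<xi> * cmod (G n \<xi>))" by (rule suminf_mult[OF elim, symmetric])
      finally have "(cmod (of_real (?W k \<xi>) * (\<Sum>n. G n \<xi>)))\<^sup>2 \<le> (\<Sum>n. ?W k \<xi> * cmod (G n \<xi>))\<^sup>2"
        by (intro power_mono) auto
      hence "ennreal ((cmod (of_real (?W k \<xi>) * (\<Sum>n. G n \<xi>)))\<^sup>2) \<le> ennreal (\<Sum>n. ?W k \<xi> * cmod (G n \<xi>)) ^ 2"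
        unfolding ennreal_power[OF n0] by (rule ennreal_leI)
      also have "ennreal (\<Sum>n. ?W k \<xi> * cmod (G n \<xi>)) = (\<Sum>n. ennreal (?W k \<xi> * cmod (G n \<xi>)))"
        using w s' by (intro suminf_ennreal2[symmetric]) auto
      finally show ?case .
    qed
    also have "\<dots> \<le> ennreal ((suminf p)\<^sup>2)" by (rule maj)
    finally show "L2_sq (\<lambda>\<xi>. of_real (?W k \<xi>) * (\<Sum>n. G n \<xi>)) \<le> ennreal ((suminf p)\<^sup>2)" .
  qed measurable
  note i = spectral_integrable(2)[OF G \<delta> s]
  have "(LINT \<xi>|lborel. (\<Sum>n. G n \<xi> * cis (x * \<xi>))) = (\<Sum>n. ?I n)"
  proof (rule integral_suminf)
    show "AE \<xi> in lborel. summable (\<lambda>n. norm (G n \<xi> * cis (x * \<xi>)))"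
      using sm by eventually_elim (simp add: norm_mult)
    show "summable (\<lambda>n. LINT \<xi>|lborel. norm (G n \<xi> * cis (x * \<xi>)))"
    proof (rule summable_comparison_test'[of "\<lambda>n. sqrt pi * p n" 0])
      fix n
      have "0 \<le> (LINT \<xi>|lborel. cmod (G n \<xi>))" by (rule integral_nonneg_AE) auto
      thus "norm (LINT \<xi>|lborel. norm (G n \<xi> * cis (x * \<xi>))) \<le> sqrt pi * p n"
        using spectral_L1_bound[OF G \<delta> s] by (simp add: norm_mult)
    qed (intro summable_mult p)
  qed (intro integrable_mult_cis i)
  moreover have "(LINT \<xi>|lborel. (\<Sum>n. G n \<xi>) * cis (x * \<xi>)) = (LINT \<xi>|lborel. (\<Sum>n. G n \<xi> * cis (x * \<xi>)))"
  proof (rule integral_cong_AE)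
    show "AE \<xi> in lborel. (\<Sum>n. G n \<xi>) * cis (x * \<xi>) = (\<Sum>n. G n \<xi> * cis (x * \<xi>))"
      using sm by eventually_elim (simp add: suminf_mult2 summable_norm_cancel)
  qed measurable
  moreover have "summable ?I"
  proof (rule summable_comparison_test'[of "\<lambda>n. sqrt pi * p n" 0])
    fix n
    have "cmod (?I n) \<le> (LINT \<xi>|lborel. cmod (G n \<xi> * cis (x * \<xi>)))"
      by (rule integral_norm_bound)
    also have "\<dots> \<le> sqrt pi * p n" using spectral_L1_bound[OF G \<delta> s] by (simp add: norm_mult)
    finally show "cmod (?I n) \<le> sqrt pi * p n" .
  qed (intro summable_mult p)
  ultimately show "inv_fourier (\<lambda>\<xi>. \<Sum>n. G n \<xi>) x = (\<Sum>n. inv_fourier (G n) x)"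
    by (simp add: inv_fourier_def suminf_divide)
qed

section \<open>Products\<close>

text \<open>Of the two frequencies \<open>\<xi> - \<eta>\<close> and \<open>\<eta>\<close> at least one is comparable with \<open>\<xi>\<close>:
  \<open>1 + \<xi>\<^sup>2 \<le> 4 max (1 + (\<xi> - \<eta>)\<^sup>2) (1 + \<eta>\<^sup>2)\<close>.\<close>

lemma japanese_convolution_le:
  assumes "1 \<le> s"
  shows "(japanese s \<xi>)\<^sup>2 * (1 / (japanese s (\<xi> - \<eta>) * japanese s \<eta>))\<^sup>2
     \<le> 4 powr s * (1 / (1 + \<eta>\<^sup>2) + 1 / (1 + (\<xi> - \<eta>)\<^sup>2))"
proof -
  define a b where "a = 1 + (\<xi> - \<eta>)\<^sup>2" and "b = 1 + \<eta>\<^sup>2"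
  have ab: "a > 0" "b > 0" using one_plus_square_pos by (auto simp: a_def b_def)
  have sq: "((\<xi> - \<eta>) + \<eta>)\<^sup>2 \<le> 2 * (\<xi> - \<eta>)\<^sup>2 + 2 * \<eta>\<^sup>2"
    using sum_squares_bound[of "\<xi> - \<eta>" \<eta>] by (simp only: power2_sum)
  have "1 + \<xi>\<^sup>2 \<le> 2 * a + 2 * b" using sq by (simp add: a_def b_def)
  also have "\<dots> \<le> 4 * max a b" by simp
  finally have "(1 + \<xi>\<^sup>2) powr s \<le> (4 * max a b) powr s"
    using assms by (intro powr_mono2) auto
  also have "\<dots> = 4 powr s * max (a powr s) (b powr s)"
    using ab assms by (cases "a \<le> b") (auto simp: powr_mult max_def powr_mono2 intro: antisym)
  also have "\<dots> \<le> 4 powr s * (a powr s + b powr s)" by (intro mult_left_mono) auto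
  finally have "(1 + \<xi>\<^sup>2) powr s / (a powr s * b powr s) \<le> 4 powr s * (a powr s + b powr s) / (a powr s * b powr s)"
    by (rule divide_right_mono) (simp add: ab)
  also have "\<dots> = 4 powr s * ((1 / japanese s \<eta>)\<^sup>2 + (1 / japanese s (\<xi> - \<eta>))\<^sup>2)"
    using ab by (simp add: power_divide japanese_square a_def[symmetric] b_def[symmetric] field_simps)
  also have "\<dots> \<le> 4 powr s * (1 / (1 + \<eta>\<^sup>2) + 1 / (1 + (\<xi> - \<eta>)\<^sup>2))"
    by (intro mult_left_mono add_mono inverse_japanese_square_le assms) auto
  finally show ?thesis
    by (simp add: power_divide power_mult_distrib japanese_square a_def b_def)
qed

definition convolution_const :: "real \<Rightarrow> real" where
  "convolution_const s = sqrt (2 * pi * 4 powr s)"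

text \<open>The algebra property of Sobolev spaces. The Cauchy--Schwarz inequality in \<open>\<eta>\<close> separates the weighted
  functions from the quotient of weights in \<open>japanese_convolution_le\<close>, whose integral over \<open>\<eta>\<close> is
  bounded uniformly in \<open>\<xi>\<close>; the rest is Tonelli's theorem.\<close>

lemma nn_convolution_weighted_le:
  fixes f g :: "real \<Rightarrow> ennreal"
  assumes s: "1 \<le> s" and [measurable]: "f \<in> borel_measurable borel" "g \<in> borel_measurable borel"
  shows "(\<integral>\<^sup>+\<xi>. (ennreal (japanese s \<xi>) * (\<integral>\<^sup>+\<eta>. f (\<xi> - \<eta>) * g \<eta> \<partial>lborel)) ^ 2 \<partial>lborel)
     \<le> ennreal ((convolution_const s)\<^sup>2) * ((\<integral>\<^sup>+\<xi>. (ennreal (japanese s \<xi>) * f \<xi>) ^ 2 \<partial>lborel)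
         * (\<integral>\<^sup>+\<xi>. (ennreal (japanese s \<xi>) * g \<xi>) ^ 2 \<partial>lborel))"
proof -
  let ?J = "japanese s"
  let ?c = "\<lambda>\<xi>. \<integral>\<^sup>+\<eta>. f (\<xi> - \<eta>) * g \<eta> \<partial>lborel"
  let ?C = "ennreal ((convolution_const s)\<^sup>2)"
  let ?k = "\<lambda>x::real. 1 / (1 + x\<^sup>2)"
  define f' g' where "f' = (\<lambda>\<xi>. ennreal (?J \<xi>) * f \<xi>)" and "g' = (\<lambda>\<xi>. ennreal (?J \<xi>) * g \<xi>)"
  have [measurable]: "f' \<in> borel_measurable borel" "g' \<in> borel_measurable borel" unfolding f'_def g'_def by measurable
  have shift: "(\<integral>\<^sup>+\<eta>. h (\<xi> - \<eta>) \<partial>lborel) = (\<integral>\<^sup>+\<eta>. h \<eta> \<partial>lborel)" if [measurable]: "h \<in> borel_measurable borel"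
    for h :: "real \<Rightarrow> ennreal" and \<xi>
    using nn_integral_real_affine[of h "-1" \<xi>] by simp
  have shift': "(\<integral>\<^sup>+\<xi>. h (\<xi> - \<eta>) \<partial>lborel) = (\<integral>\<^sup>+\<xi>. h \<xi> \<partial>lborel)" if [measurable]: "h \<in> borel_measurable borel"
    for h :: "real \<Rightarrow> ennreal" and \<eta>
    using nn_integral_real_affine[of h "1" "-\<eta>"] by simp
  have cs: "(ennreal (?J \<xi>) * ?c \<xi>) ^ 2
     \<le> ?C * (\<integral>\<^sup>+\<eta>. f' (\<xi> - \<eta>) ^ 2 * g' \<eta> ^ 2 \<partial>lborel)" for \<xi>
  proof -
    let ?b = "\<lambda>\<eta>. ennreal (1 / (?J (\<xi> - \<eta>) * ?J \<eta>))"
    have e: "f (\<xi> - \<eta>) * g \<eta> = (f' (\<xi> - \<eta>) * g' \<eta>) * ?b \<eta>" for \<eta>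
    proof -
      have "ennreal (?J (\<xi> - \<eta>)) * ennreal (?J \<eta>) * ?b \<eta> = 1"
        using japanese_pos[of s "\<xi> - \<eta>"] japanese_pos[of s \<eta>] by (simp flip: ennreal_mult)
      hence "f (\<xi> - \<eta>) * g \<eta> = f (\<xi> - \<eta>) * g \<eta> * (ennreal (?J (\<xi> - \<eta>)) * ennreal (?J \<eta>) * ?b \<eta>)" by simp
      thus ?thesis by (simp only: f'_def g'_def mult_ac)
    qed
    have "(\<integral>\<^sup>+\<eta>. ennreal (?J \<xi>) ^ 2 * ?b \<eta> ^ 2 \<partial>lborel)
       \<le> (\<integral>\<^sup>+\<eta>. ennreal (4 powr s) * (ennreal (?k \<eta>) + ennreal (?k (\<xi> - \<eta>))) \<partial>lborel)"
    proof (rule nn_integral_mono)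
      fix \<eta>
      have "ennreal (?J \<xi>) ^ 2 * ?b \<eta> ^ 2 = ennreal ((?J \<xi>)\<^sup>2 * (1 / (?J (\<xi> - \<eta>) * ?J \<eta>))\<^sup>2)"
        using japanese_pos[of s \<xi>] japanese_pos[of s "\<xi> - \<eta>"] japanese_pos[of s \<eta>]
        by (simp add: ennreal_power ennreal_mult)
      also have "\<dots> \<le> ennreal (4 powr s * (?k \<eta> + ?k (\<xi> - \<eta>)))"
        by (intro ennreal_leI japanese_convolution_le s)
      also have "\<dots> = ennreal (4 powr s) * (ennreal (?k \<eta>) + ennreal (?k (\<xi> - \<eta>)))"
        by (simp flip: ennreal_plus ennreal_mult)
      finally show "ennreal (?J \<xi>) ^ 2 * ?b \<eta> ^ 2 \<le> ennreal (4 powr s) * (ennreal (?k \<eta>) + ennreal (?k (\<xi> - \<eta>)))" .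
    qed
    also have "\<dots> = ennreal (4 powr s) * (ennreal pi + ennreal pi)"
      using shift[of "\<lambda>\<eta>. ennreal (?k \<eta>)" \<xi>]
      by (simp add: nn_integral_cmult nn_integral_add nn_integral_inverse_1_plus_square)
    also have "\<dots> = ?C"
      by (simp add: convolution_const_def mult_ac flip: ennreal_plus ennreal_mult)
    finally have bb: "(\<integral>\<^sup>+\<eta>. ennreal (?J \<xi>) ^ 2 * ?b \<eta> ^ 2 \<partial>lborel) \<le> ?C" .
    have "(ennreal (?J \<xi>) * ?c \<xi>) ^ 2
       \<le> ennreal (?J \<xi>) ^ 2 * ((\<integral>\<^sup>+\<eta>. (f' (\<xi> - \<eta>) * g' \<eta>) ^ 2 \<partial>lborel) * (\<integral>\<^sup>+\<eta>. ?b \<eta> ^ 2 \<partial>lborel))"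
      unfolding e power_mult_distrib[of "ennreal (?J \<xi>)"]
      by (intro mult_left_mono nn_integral_Cauchy_Schwarz sigma_finite_lborel) measurable
    also have "\<dots> = (\<integral>\<^sup>+\<eta>. (f' (\<xi> - \<eta>) * g' \<eta>) ^ 2 \<partial>lborel) * (\<integral>\<^sup>+\<eta>. ennreal (?J \<xi>) ^ 2 * ?b \<eta> ^ 2 \<partial>lborel)"
      by (subst nn_integral_cmult) (auto simp: mult_ac)
    also have "\<dots> \<le> (\<integral>\<^sup>+\<eta>. (f' (\<xi> - \<eta>) * g' \<eta>) ^ 2 \<partial>lborel) * ?C"
      by (intro mult_left_mono bb) auto
    finally show ?thesis by (simp only: power_mult_distrib mult.commute)
  qed
  have "(\<integral>\<^sup>+\<xi>. (ennreal (?J \<xi>) * ?c \<xi>) ^ 2 \<partial>lborel)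
     \<le> (\<integral>\<^sup>+\<xi>. ?C * (\<integral>\<^sup>+\<eta>. f' (\<xi> - \<eta>) ^ 2 * g' \<eta> ^ 2 \<partial>lborel) \<partial>lborel)"
    by (intro nn_integral_mono cs)
  also have "\<dots> = ?C * (\<integral>\<^sup>+\<xi>. \<integral>\<^sup>+\<eta>. f' (\<xi> - \<eta>) ^ 2 * g' \<eta> ^ 2 \<partial>lborel \<partial>lborel)"
    by (rule nn_integral_cmult) measurable
  also have "(\<integral>\<^sup>+\<xi>. \<integral>\<^sup>+\<eta>. f' (\<xi> - \<eta>) ^ 2 * g' \<eta> ^ 2 \<partial>lborel \<partial>lborel) = (\<integral>\<^sup>+\<eta>. \<integral>\<^sup>+\<xi>. f' (\<xi> - \<eta>) ^ 2 * g' \<eta> ^ 2 \<partial>lborel \<partial>lborel)"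
    by (rule lborel_pair.Fubini') (simp add: case_prod_unfold)
  also have "\<dots> = (\<integral>\<^sup>+\<eta>. (\<integral>\<^sup>+\<xi>. f' \<xi> ^ 2 \<partial>lborel) * g' \<eta> ^ 2 \<partial>lborel)"
    using shift'[of "\<lambda>\<xi>. f' \<xi> ^ 2"] by (simp add: nn_integral_multc)
  also have "\<dots> = (\<integral>\<^sup>+\<xi>. f' \<xi> ^ 2 \<partial>lborel) * (\<integral>\<^sup>+\<xi>. g' \<xi> ^ 2 \<partial>lborel)"
    by (rule nn_integral_cmult) measurable
  finally show ?thesis by (simp only: f'_def g'_def)
qed

definition fourier_convolution :: "(real \<Rightarrow> complex) \<Rightarrow> (real \<Rightarrow> complex) \<Rightarrow> real \<Rightarrow> complex" where
  "fourier_convolution G H \<xi> = of_real (1 / sqrt (2 * pi)) * (LINT \<eta>|lborel. G (\<xi> - \<eta>) * H \<eta>)"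

lemma convolution_measurable:
  assumes [measurable]: "G \<in> borel_measurable borel" "H \<in> borel_measurable borel"
  shows "fourier_convolution G H \<in> borel_measurable borel"
  unfolding fourier_convolution_def by measurable

lemma inv_fourier_convolution:
  assumes G: "integrable lborel G" and H: "integrable lborel H"
  shows "inv_fourier (fourier_convolution G H) x = inv_fourier G x * inv_fourier H x"
proof -
  have [measurable]: "G \<in> borel_measurable borel" "H \<in> borel_measurable borel"
    using borel_measurable_integrable[OF G] borel_measurable_integrable[OF H] by auto
  have sh: "integrable lborel (\<lambda>\<xi>. G (\<xi> - \<eta>))" for \<eta>
    using lborel_integrable_real_affine[OF G, of 1 "-\<eta>"] by simp
  let ?F = "\<lambda>\<eta> \<xi>. H \<eta> * (G (\<xi> - \<eta>) * cis (x * \<xi>))"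
  have "integrable (lborel \<Otimes>\<^sub>M lborel) (\<lambda>(\<eta>,\<xi>). ?F \<eta> \<xi>)"
  proof (rule lborel_pair.Fubini_integrable)
    have "(LINT \<xi>|lborel. cmod (G (\<xi> - \<eta>))) = (LINT \<xi>|lborel. cmod (G \<xi>))" for \<eta>
      using lborel_integral_real_affine[of 1 "\<lambda>\<xi>. cmod (G (\<xi> - \<eta>))" \<eta>] by simp
    thus "integrable lborel (\<lambda>\<eta>. LINT \<xi>|lborel. norm (case (\<eta>,\<xi>) of (\<eta>,\<xi>) \<Rightarrow> ?F \<eta> \<xi>))"
      using H by (simp add: norm_mult)
    show "AE \<eta> in lborel. integrable lborel (\<lambda>\<xi>. case (\<eta>,\<xi>) of (\<eta>,\<xi>) \<Rightarrow> ?F \<eta> \<xi>)"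
      using integrable_mult_cis[OF sh] by simp
  qed (simp add: case_prod_unfold)
  from lborel_pair.Fubini_integral[OF this]
  have fub: "(LINT \<xi>|lborel. LINT \<eta>|lborel. ?F \<eta> \<xi>) = (LINT \<eta>|lborel. LINT \<xi>|lborel. ?F \<eta> \<xi>)" by simp
  have 1: "(LINT \<eta>|lborel. ?F \<eta> \<xi>) = (LINT \<eta>|lborel. G (\<xi> - \<eta>) * H \<eta>) * cis (x * \<xi>)" for \<xi>
    by (subst integral_mult_left_zero[symmetric]) (simp add: mult_ac)
  have 2: "(LINT \<xi>|lborel. ?F \<eta> \<xi>) = H \<eta> * (cis (\<eta> * x) * (LINT \<xi>|lborel. G \<xi> * cis (x * \<xi>)))" for \<eta>
    using inv_fourier_shift[of G \<eta> x] by (simp add: inv_fourier_def)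
  have 3: "(LINT \<eta>|lborel. H \<eta> * (cis (\<eta> * x) * (LINT \<xi>|lborel. G \<xi> * cis (x * \<xi>))))
      = (LINT \<eta>|lborel. H \<eta> * cis (x * \<eta>)) * (LINT \<xi>|lborel. G \<xi> * cis (x * \<xi>))"
    by (subst integral_mult_left_zero[symmetric]) (simp add: mult_ac)
  show ?thesis
    using fub[unfolded 1 2 3] by (simp add: inv_fourier_def fourier_convolution_def mult.assoc)
qed


text \<open>A Bochner integral that does not exist has the value 0.\<close>

lemma ennreal_norm_integral_le:
  fixes f :: "'a \<Rightarrow> complex"
  shows "ennreal (cmod (integral\<^sup>L M f)) \<le> (\<integral>\<^sup>+x. ennreal (cmod (f x)) \<partial>M)"
  by (cases "integrable M f") (auto simp: integral_norm_bound_ennreal not_integrable_integral_eq)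

text \<open>The Leibniz rule on the Fourier side: the binomial theorem for \<open>\<xi> = (\<xi> - \<eta>) + \<eta>\<close>. The factorials in
  the weights cancel the binomial coefficients, and only the quotient of the factors
  \<open>(k + 1)\<^sup>2\<close> remains.\<close>

lemma taylor_weight_binomial_le:
  assumes "0 < \<delta>"
  shows "taylor_weight \<delta> k * \<bar>\<xi>\<bar> ^ k \<le> (\<Sum>j\<le>k. (real k + 1)\<^sup>2 * (1 / ((real j + 1)\<^sup>2 * (real (k - j) + 1)\<^sup>2))
     * ((taylor_weight \<delta> j * \<bar>\<xi> - \<eta>\<bar> ^ j) * (taylor_weight \<delta> (k - j) * \<bar>\<eta>\<bar> ^ (k - j))))"
proof -
  have "\<bar>\<xi>\<bar> ^ k \<le> (\<bar>\<xi> - \<eta>\<bar> + \<bar>\<eta>\<bar>) ^ k" by (intro power_mono) auto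
  also have "\<dots> = (\<Sum>j\<le>k. real (k choose j) * \<bar>\<xi> - \<eta>\<bar> ^ j * \<bar>\<eta>\<bar> ^ (k - j))" by (rule binomial_ring)
  finally have "taylor_weight \<delta> k * \<bar>\<xi>\<bar> ^ k \<le> taylor_weight \<delta> k * (\<Sum>j\<le>k. real (k choose j) * \<bar>\<xi> - \<eta>\<bar> ^ j * \<bar>\<eta>\<bar> ^ (k - j))"
    using taylor_weight_pos[OF assms, of k] by (intro mult_left_mono) auto
  also have "\<dots> = (\<Sum>j\<le>k. (taylor_weight \<delta> k * real (k choose j)) * (\<bar>\<xi> - \<eta>\<bar> ^ j * \<bar>\<eta>\<bar> ^ (k - j)))"
    by (simp add: sum_distrib_left mult_ac)
  also have "\<dots> = (\<Sum>j\<le>k. (real k + 1)\<^sup>2 * (1 / ((real j + 1)\<^sup>2 * (real (k - j) + 1)\<^sup>2))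
     * ((taylor_weight \<delta> j * \<bar>\<xi> - \<eta>\<bar> ^ j) * (taylor_weight \<delta> (k - j) * \<bar>\<eta>\<bar> ^ (k - j))))"
  proof (rule sum.cong)
    fix j assume "j \<in> {..k}"
    hence j: "j \<le> k" by simp
    have nz: "real j + 1 \<noteq> 0" "real (k - j) + 1 \<noteq> 0" by linarith+
    have "taylor_weight \<delta> k * real (k choose j) = \<delta> ^ j * \<delta> ^ (k - j) * (real k + 1)\<^sup>2 / (fact j * fact (k - j))"
      using j by (simp add: taylor_weight_def binomial_fact power_add[symmetric])
    also have "\<dots> = (real k + 1)\<^sup>2 * (1 / ((real j + 1)\<^sup>2 * (real (k - j) + 1)\<^sup>2)) * (taylor_weight \<delta> j * taylor_weight \<delta> (k - j))"
      using nz unfolding taylor_weight_def by (simp del: of_nat_diff)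
    finally show "(taylor_weight \<delta> k * real (k choose j)) * (\<bar>\<xi> - \<eta>\<bar> ^ j * \<bar>\<eta>\<bar> ^ (k - j))
      = (real k + 1)\<^sup>2 * (1 / ((real j + 1)\<^sup>2 * (real (k - j) + 1)\<^sup>2))
     * ((taylor_weight \<delta> j * \<bar>\<xi> - \<eta>\<bar> ^ j) * (taylor_weight \<delta> (k - j) * \<bar>\<eta>\<bar> ^ (k - j)))"
      by (simp only: mult_ac)
  qed simp
  finally show ?thesis .
qed

definition algebra_const :: "real \<Rightarrow> real" where
  "algebra_const s = 8 * convolution_const s"

lemma algebra_const_pos: "0 < algebra_const s"
  by (simp add: algebra_const_def convolution_const_def)

text \<open>The spaces are algebras: each term of the Leibniz sum is bounded by the algebra property of Sobolev
  spaces, and \<open>convolution_inverse_squares\<close> sums the bounds independently of \<open>k\<close>.\<close>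

lemma spectral_convolution:
  assumes G: "spectral_bound \<delta> s G p" and H: "spectral_bound \<delta> s H q" and \<delta>: "0 < \<delta>" and s: "1 \<le> s"
  shows "spectral_bound \<delta> s (fourier_convolution G H) (algebra_const s * (p * q))"
  unfolding spectral_bound_def
proof (intro conjI allI)
  let ?W = "spectral_weight \<delta> s"
  let ?w = "taylor_weight \<delta>"
  let ?F = "fourier_convolution G H"
  let ?GH = "\<lambda>\<xi> \<eta>. G (\<xi> - \<eta>) * H \<eta>"
  note [measurable] = spectral_boundD(1)[OF G] spectral_boundD(1)[OF H]
  note [measurable] = convolution_measurable[OF spectral_boundD(1)[OF G] spectral_boundD(1)[OF H]]
  show "?F \<in> borel_measurable borel" by measurable
  have pq: "0 \<le> p" "0 \<le> q" using spectral_boundD(2) G H by auto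
  show "0 \<le> algebra_const s * (p * q)" using pq algebra_const_pos[of s] by simp
  fix k
  define gf where "gf = (\<lambda>F j \<xi>. ennreal (?w j * \<bar>\<xi>\<bar> ^ j * cmod (F \<xi> :: complex)))"
  have [measurable]: "gf G j \<in> borel_measurable borel" "gf H j \<in> borel_measurable borel" for j
    unfolding gf_def by measurable
  define a where "a = (\<lambda>j. (real k + 1)\<^sup>2 * (1 / ((real j + 1)\<^sup>2 * (real (k - j) + 1)\<^sup>2)))"
  have a0: "0 \<le> a j" for j by (simp add: a_def)
  define cv where "cv = (\<lambda>j \<xi>. ennreal (japanese s \<xi>) * (\<integral>\<^sup>+\<eta>. gf G j (\<xi> - \<eta>) * gf H (k - j) \<eta> \<partial>lborel))"
  have [measurable]: "cv j \<in> borel_measurable borel" for j unfolding cv_def by measurable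
  have tw0: "0 \<le> ?w j" for j using taylor_weight_pos[OF \<delta>, of j] by simp
  have gf_sq: "(\<integral>\<^sup>+\<xi>. (ennreal (japanese s \<xi>) * gf F j \<xi>) ^ 2 \<partial>lborel) = L2_sq (\<lambda>\<xi>. of_real (?W j \<xi>) * F \<xi>)" for F j
    unfolding L2_sq_def
  proof (intro nn_integral_cong)
    fix \<xi>
    have "(ennreal (japanese s \<xi>) * gf F j \<xi>) = ennreal (cmod (of_real (?W j \<xi>) * F \<xi>))"
      using tw0[of j] japanese_pos[of s \<xi>]
      by (simp add: gf_def spectral_weight_def norm_mult norm_power mult_ac abs_mult flip: ennreal_mult)
    thus "(ennreal (japanese s \<xi>) * gf F j \<xi>) ^ 2 = ennreal ((cmod (of_real (?W j \<xi>) * F \<xi>))\<^sup>2)"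
      by (simp only: ennreal_power norm_ge_zero)
  qed
  define h where "h = (\<lambda>j \<xi>. if j \<le> k then ennreal (a j) * cv j \<xi> else 0)"
  have [measurable]: "h j \<in> borel_measurable borel" for j unfolding h_def by measurable
  define r where "r = (\<lambda>j. if j \<le> k then a j * (convolution_const s * (p * q)) else 0)"
  have cc: "0 \<le> convolution_const s" by (simp add: convolution_const_def)
  have pw: "ennreal (?W k \<xi> * cmod (?F \<xi>)) \<le> (\<Sum>j. h j \<xi>)" for \<xi>
  proof -
    have "cmod (?F \<xi>) \<le> cmod (LINT \<eta>|lborel. ?GH \<xi> \<eta>)"
    proof -
      have "1 \<le> sqrt (2 * pi)" using pi_ge_two by simp
      hence "1 / sqrt (2 * pi) \<le> 1" by simp
      from mult_right_mono[OF this norm_ge_zero[of "LINT \<eta>|lborel. ?GH \<xi> \<eta>"]]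
      show ?thesis by (simp add: fourier_convolution_def norm_mult norm_divide)
    qed
    hence "ennreal (cmod (?F \<xi>)) \<le> (\<integral>\<^sup>+\<eta>. ennreal (cmod (?GH \<xi> \<eta>)) \<partial>lborel)"
      by (rule order_trans[OF ennreal_leI ennreal_norm_integral_le])
    hence "ennreal (?W k \<xi>) * ennreal (cmod (?F \<xi>))
       \<le> ennreal (?W k \<xi>) * (\<integral>\<^sup>+\<eta>. ennreal (cmod (?GH \<xi> \<eta>)) \<partial>lborel)"
      by (intro mult_left_mono) auto
    also have "\<dots> = (\<integral>\<^sup>+\<eta>. ennreal (japanese s \<xi>) * ennreal (?w k * \<bar>\<xi>\<bar> ^ k * cmod (?GH \<xi> \<eta>)) \<partial>lborel)"
      using tw0[of k] japanese_pos[of s \<xi>]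
      by (subst nn_integral_cmult[symmetric]) (auto simp: spectral_weight_def mult_ac simp flip: ennreal_mult intro!: nn_integral_cong)
    also have "\<dots> \<le> (\<integral>\<^sup>+\<eta>. (\<Sum>j\<le>k. ennreal (a j) * (ennreal (japanese s \<xi>) * (gf G j (\<xi> - \<eta>) * gf H (k - j) \<eta>))) \<partial>lborel)"
    proof (rule nn_integral_mono)
      fix \<eta>
      have "?w k * \<bar>\<xi>\<bar> ^ k * cmod (?GH \<xi> \<eta>)
        \<le> (\<Sum>j\<le>k. a j * ((?w j * \<bar>\<xi> - \<eta>\<bar> ^ j) * (?w (k - j) * \<bar>\<eta>\<bar> ^ (k - j)))) * cmod (?GH \<xi> \<eta>)"
        unfolding a_def by (intro mult_right_mono taylor_weight_binomial_le \<delta>) auto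
      also have "\<dots> = (\<Sum>j\<le>k. a j * ((?w j * \<bar>\<xi> - \<eta>\<bar> ^ j * cmod (G (\<xi> - \<eta>))) * (?w (k - j) * \<bar>\<eta>\<bar> ^ (k - j) * cmod (H \<eta>))))"
        unfolding sum_distrib_right by (intro sum.cong refl) (simp add: norm_mult mult_ac)
      finally have "ennreal (?w k * \<bar>\<xi>\<bar> ^ k * cmod (?GH \<xi> \<eta>))
         \<le> ennreal (\<Sum>j\<le>k. a j * ((?w j * \<bar>\<xi> - \<eta>\<bar> ^ j * cmod (G (\<xi> - \<eta>))) * (?w (k - j) * \<bar>\<eta>\<bar> ^ (k - j) * cmod (H \<eta>))))"
        by (rule ennreal_leI)
      also have "\<dots> = (\<Sum>j\<le>k. ennreal (a j) * (gf G j (\<xi> - \<eta>) * gf H (k - j) \<eta>))"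
        using a0 tw0 by (subst sum_ennreal[symmetric]) (auto simp: gf_def ennreal_mult intro!: sum.cong)
      finally have "ennreal (japanese s \<xi>) * ennreal (?w k * \<bar>\<xi>\<bar> ^ k * cmod (?GH \<xi> \<eta>))
        \<le> ennreal (japanese s \<xi>) * (\<Sum>j\<le>k. ennreal (a j) * (gf G j (\<xi> - \<eta>) * gf H (k - j) \<eta>))"
        by (intro mult_left_mono) auto
      thus "ennreal (japanese s \<xi>) * ennreal (?w k * \<bar>\<xi>\<bar> ^ k * cmod (?GH \<xi> \<eta>))
        \<le> (\<Sum>j\<le>k. ennreal (a j) * (ennreal (japanese s \<xi>) * (gf G j (\<xi> - \<eta>) * gf H (k - j) \<eta>)))"
        unfolding sum_distrib_left by (simp only: mult.left_commute)
    qed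
    also have "\<dots> = (\<Sum>j\<le>k. ennreal (a j) * cv j \<xi>)"
      by (subst nn_integral_sum) (auto simp: cv_def nn_integral_cmult)
    also have "\<dots> = (\<Sum>j\<le>k. h j \<xi>)" by (intro sum.cong) (auto simp: h_def)
    also have "\<dots> = (\<Sum>j. h j \<xi>)" by (rule suminf_finite[symmetric]) (auto simp: h_def)
    finally show ?thesis using spectral_weight_nonneg[OF \<delta>] by (simp add: ennreal_mult)
  qed
  have "L2_sq (\<lambda>\<xi>. of_real (?W k \<xi>) * ?F \<xi>) = (\<integral>\<^sup>+\<xi>. ennreal (?W k \<xi> * cmod (?F \<xi>)) ^ 2 \<partial>lborel)"
    unfolding L2_sq_def using spectral_weight_nonneg[OF \<delta>]
    by (intro nn_integral_cong) (simp add: norm_mult ennreal_power)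
  also have "\<dots> \<le> (\<integral>\<^sup>+\<xi>. (\<Sum>j. h j \<xi>) ^ 2 \<partial>lborel)"
    by (intro nn_integral_mono power_mono pw) auto
  also have "\<dots> \<le> ennreal ((suminf r)\<^sup>2)"
  proof (rule nn_integral_suminf_square_le)
    fix j
    show "(\<integral>\<^sup>+\<xi>. h j \<xi> ^ 2 \<partial>lborel) \<le> ennreal ((r j)\<^sup>2)"
    proof (cases "j \<le> k")
      case True
      have "(\<integral>\<^sup>+\<xi>. h j \<xi> ^ 2 \<partial>lborel) = ennreal (a j) ^ 2 * (\<integral>\<^sup>+\<xi>. cv j \<xi> ^ 2 \<partial>lborel)"
        using True by (simp add: h_def power_mult_distrib nn_integral_cmult)
      also have "\<dots> \<le> ennreal (a j) ^ 2 * (ennreal ((convolution_const s)\<^sup>2) * (ennreal (p\<^sup>2) * ennreal (q\<^sup>2)))"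
      proof (intro mult_left_mono)
        have "(\<integral>\<^sup>+\<xi>. cv j \<xi> ^ 2 \<partial>lborel) \<le> ennreal ((convolution_const s)\<^sup>2) *
           (L2_sq (\<lambda>\<xi>. of_real (?W j \<xi>) * G \<xi>) * L2_sq (\<lambda>\<xi>. of_real (?W (k - j) \<xi>) * H \<xi>))"
          unfolding cv_def gf_sq[symmetric] by (rule nn_convolution_weighted_le[OF s]) measurable
        also have "\<dots> \<le> ennreal ((convolution_const s)\<^sup>2) * (ennreal (p\<^sup>2) * ennreal (q\<^sup>2))"
          by (intro mult_left_mono mult_mono spectral_boundD(3)[OF G] spectral_boundD(3)[OF H]) auto
        finally show "(\<integral>\<^sup>+\<xi>. cv j \<xi> ^ 2 \<partial>lborel) \<le> ennreal ((convolution_const s)\<^sup>2) * (ennreal (p\<^sup>2) * ennreal (q\<^sup>2))" .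
      qed auto
      also have "\<dots> = ennreal ((r j)\<^sup>2)"
        using True a0[of j] by (simp add: r_def power_mult_distrib ennreal_power ennreal_mult)
      finally show ?thesis .
    qed (simp add: h_def)
    show "0 \<le> r j" using a0 cc pq by (simp add: r_def)
  next
    show "summable r" by (rule summable_finite[of "{..k}"]) (auto simp: r_def)
  qed measurable
  also have "\<dots> \<le> ennreal ((algebra_const s * (p * q))\<^sup>2)"
  proof (intro ennreal_leI power_mono)
    have "suminf r = (\<Sum>j\<le>k. r j)" by (rule suminf_finite) (auto simp: r_def)
    also have "\<dots> = (\<Sum>j\<le>k. a j * (convolution_const s * (p * q)))" by (intro sum.cong) (auto simp: r_def)
    also have "\<dots> = (real k + 1)\<^sup>2 * (\<Sum>j\<le>k. 1 / ((real j + 1)\<^sup>2 * (real (k - j) + 1)\<^sup>2)) * (convolution_const s * (p * q))"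
      unfolding a_def sum_distrib_left sum_distrib_right by simp
    also have "\<dots> \<le> (real k + 1)\<^sup>2 * (8 / (real k + 1)\<^sup>2) * (convolution_const s * (p * q))"
      using cc pq by (intro mult_right_mono mult_left_mono convolution_inverse_squares) auto
    also have "\<dots> = algebra_const s * (p * q)" by (simp add: algebra_const_def)
    finally show "suminf r \<le> algebra_const s * (p * q)" .
    show "0 \<le> suminf r"
      by (rule suminf_nonneg[OF summable_finite[of "{..k}"]]) (use a0 cc pq in \<open>auto simp: r_def\<close>)
  qed
  finally show "L2_sq (\<lambda>\<xi>. of_real (?W k \<xi>) * ?F \<xi>) \<le> ennreal ((algebra_const s * (p * q))\<^sup>2)" .
qed

section \<open>The scale of spaces and its operators\<close>

lemma E_bound_mult:
  assumes "2 \<le> s" "0 < \<delta>" "E_bound \<delta> s f p" "E_bound \<delta> s g q"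
  shows "E_bound \<delta> s (\<lambda>x. f x * g x) (algebra_const s * (p * q))"
proof -
  obtain G where G: "spectral_bound \<delta> s G p" "f = inv_fourier G" using assms E_bound_iff_spectral by blast
  obtain H where H: "spectral_bound \<delta> s H q" "g = inv_fourier H" using assms E_bound_iff_spectral by blast
  have "E_bound \<delta> s (inv_fourier (fourier_convolution G H)) (algebra_const s * (p * q))"
    by (intro spectral_imp_E_bound spectral_convolution G H) (use assms in auto)
  moreover have "inv_fourier (fourier_convolution G H) = (\<lambda>x. f x * g x)"
    using assms G H by (intro ext) (simp add: inv_fourier_convolution[OF spectral_integrable(2)[OF G(1)] spectral_integrable(2)[OF H(1)]])
  ultimately show ?thesis by simp
qed

lemma vderiv_spectral:
  assumes "spectral_bound \<delta> s G p" "0 < \<delta>" "1 \<le> s"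
  shows "vderiv (inv_fourier G) = inv_fourier (\<lambda>\<xi>. \<i> * of_real \<xi> * G \<xi>)"
  using spectral_vderiv_power[OF assms, of 1] by simp

lemma E_bound_vderiv:
  assumes "2 \<le> s" "0 < \<delta>" "\<delta> < \<delta>'" "E_bound \<delta>' s f p"
  shows "E_bound \<delta> s (vderiv f) (1 / (\<delta>' - \<delta>) * p)"
proof -
  have \<delta>': "0 < \<delta>'" using assms by simp
  obtain G where G: "spectral_bound \<delta>' s G p" "f = inv_fourier G" using assms \<delta>' E_bound_iff_spectral by blast
  have "vderiv f = inv_fourier (\<lambda>\<xi>. \<i> * of_real \<xi> * G \<xi>)"
    unfolding G(2) using assms \<delta>' by (intro vderiv_spectral[OF G(1)]) auto
  thus ?thesis
    using spectral_imp_E_bound[OF spectral_derivative[OF G(1) assms(2,3)] assms(2)] assms(1) by simp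
qed

lemma E_bound_vderiv_lower_order:
  assumes "2 \<le> s" "0 < \<delta>" "E_bound \<delta> (s + 1) f p"
  shows "E_bound \<delta> s (vderiv f) p"
proof -
  obtain G where G: "spectral_bound \<delta> (s + 1) G p" "f = inv_fourier G" using assms E_bound_iff_spectral[of "s + 1" \<delta>] by auto
  have "vderiv f = inv_fourier (\<lambda>\<xi>. \<i> * of_real \<xi> * G \<xi>)"
    unfolding G(2) using assms by (intro vderiv_spectral[OF G(1)]) auto
  thus ?thesis
    using spectral_imp_E_bound[OF spectral_derivative_lower_order[OF G(1) assms(2)] assms(2)] assms(1) by simp
qed

lemma E_bound_eval:
  assumes "2 \<le> s" "0 < \<delta>" "E_bound \<delta> s f p"
  shows "cmod (f x) \<le> sqrt pi * p"
proof -
  obtain G where G: "spectral_bound \<delta> s G p" "f = inv_fourier G" using assms E_bound_iff_spectral by blast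
  have "cmod (f x) \<le> (LINT \<xi>|lborel. cmod (G \<xi>))"
    unfolding G(2) using assms by (intro norm_inv_fourier_le spectral_integrable(2)[OF G(1)]) auto
  also have "\<dots> \<le> sqrt pi * p" using assms by (intro spectral_L1_bound[OF G(1)]) auto
  finally show ?thesis .
qed

lemma E_bound_nonneg: "E_bound \<delta> s f p \<Longrightarrow> 0 \<le> p"
proof -
  assume f: "E_bound \<delta> s f p"
  hence "E_weight \<delta> s f 0 \<le> E_norm \<delta> s f"
    unfolding E_norm_def by (intro cSUP_upper) (auto simp: E_bound_def E_cplx_def)
  moreover have "0 \<le> E_weight \<delta> s f 0" by (simp add: E_weight_eq taylor_weight_def sobolev_norm_nonneg)
  ultimately show ?thesis using f by (auto simp: E_bound_def)
qed

lemma E_bound_mono: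
  assumes "2 \<le> s" "0 < \<delta>" "\<delta> \<le> \<delta>'" "E_bound \<delta>' s f p"
  shows "E_bound \<delta> s f p"
proof -
  have \<delta>': "0 < \<delta>'" using assms by simp
  show ?thesis using assms spectral_mono unfolding E_bound_iff_spectral[OF assms(1,2)] E_bound_iff_spectral[OF assms(1) \<delta>'] by blast
qed

lemma E_bound_order_mono:
  assumes "2 \<le> r" "r \<le> s" "0 < \<delta>" "E_bound \<delta> s f p"
  shows "E_bound \<delta> r f p"
proof -
  have s: "2 \<le> s" using assms by simp
  show ?thesis using assms spectral_order_mono unfolding E_bound_iff_spectral[OF assms(1,3)] E_bound_iff_spectral[OF s assms(3)] by blast
qed

lemma E_bound_suminf:
  assumes s: "2 \<le> s" and \<delta>: "0 < \<delta>" and a: "\<And>n. E_bound \<delta> s (a n) (r n)" and r: "summable r"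
  shows "E_bound \<delta> s (\<lambda>x. \<Sum>n. a n x) (\<Sum>n. r n)"
proof -
  define G where "G = (\<lambda>n. fourier_L2 (a n))"
  have G: "\<And>n. spectral_bound \<delta> s (G n) (r n)" "\<And>n. a n = inv_fourier (G n)"
    unfolding G_def by (rule E_bound_imp_spectral[OF s \<delta> a])+
  have s1: "1 \<le> s" using s by simp
  have "(\<lambda>x. \<Sum>n. a n x) = inv_fourier (\<lambda>\<xi>. \<Sum>n. G n \<xi>)"
    using spectral_suminf(2)[OF G(1) r \<delta> s1] by (intro ext) (simp add: G(2))
  thus ?thesis using spectral_suminf(1)[OF G(1) r \<delta> s1] s1 \<delta> by (simp add: spectral_imp_E_bound)
qed

lemma E_bound_scale:
  assumes "2 \<le> s" "0 < \<delta>" "E_bound \<delta> s f p"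
  shows "E_bound \<delta> s (\<lambda>x. c * f x) (cmod c * p)"
proof -
  obtain G where G: "spectral_bound \<delta> s G p" "f = inv_fourier G" using assms E_bound_iff_spectral by blast
  have "E_bound \<delta> s (inv_fourier (\<lambda>\<xi>. c * G \<xi>)) (cmod c * p)"
    using assms by (intro spectral_imp_E_bound spectral_scale G) auto
  moreover have "inv_fourier (\<lambda>\<xi>. c * G \<xi>) = (\<lambda>x. c * f x)"
    by (simp add: inv_fourier_scale[abs_def] G(2))
  ultimately show ?thesis by simp
qed

lemma banach_scale_E_bound:
  assumes s: "2 \<le> s" and \<Delta>: "0 < \<Delta>"
  shows "banach_scale (\<lambda>d. E_bound (\<Delta> * d) s)"
proof
  show "E_bound (\<Delta> * d) s f p \<Longrightarrow> p \<le> q \<Longrightarrow> E_bound (\<Delta> * d) s f q" for d f p q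
    by (auto simp: E_bound_def)
  show "E_bound (\<Delta> * d) s f p" if "\<And>e. 0 < e \<Longrightarrow> E_bound (\<Delta> * d) s f (p + e)" for d f p
    using that[of 1] that by (auto simp: E_bound_def intro: field_le_epsilon)
  show "E_bound (\<Delta> * d) s f p" if "0 < d" "d \<le> d'" "d' < 1" "E_bound (\<Delta> * d') s f p" for d d' f p
    using that \<Delta> by (intro E_bound_mono[OF s _ _ that(4)]) auto
  show "\<exists>K. \<forall>f p. E_bound (\<Delta> * d) s f p \<longrightarrow> cmod (f x) \<le> K * p" if "0 < d" "d < 1" for d x
    using E_bound_eval[OF s, of "\<Delta> * d"] that \<Delta> by (intro exI[of _ "sqrt pi"]) auto
qed (use s \<Delta> E_bound_nonneg E_bound_scale E_bound_suminf in auto)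

lemma E_bound_add:
  assumes "2 \<le> s" "0 < \<delta>" "E_bound \<delta> s f p" "E_bound \<delta> s g q"
  shows "E_bound \<delta> s (\<lambda>x. f x + g x) (p + q)"
proof -
  interpret banach_scale "\<lambda>d. E_bound (2 * \<delta> * d) s" using assms by (intro banach_scale_E_bound) auto
  show ?thesis using bnd_add[of "1/2" f p g q] assms by simp
qed


section \<open>The Helmholtz operator\<close>

lemma smooth_fun_has_vderiv:
  assumes "smooth_fun f"
  shows "(f has_vector_derivative vderiv f x) (at x)" "(vderiv f has_vector_derivative vderiv (vderiv f) x) (at x)"
proof -
  have "(vderiv ^^ 0) f differentiable at x" "(vderiv ^^ 1) f differentiable at x"
    using assms unfolding smooth_fun_def by blast+
  thus "(f has_vector_derivative vderiv f x) (at x)" "(vderiv f has_vector_derivative vderiv (vderiv f) x) (at x)"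
    by (simp_all add: vderiv_def vector_derivative_works)
qed

lemma E_bound_smooth: "E_bound \<delta> s f p \<Longrightarrow> smooth_fun f"
  by (simp add: E_bound_def E_cplx_def)

lemma E_bound_in_sobolev: "E_bound \<delta> s f p \<Longrightarrow> in_sobolev s f"
  unfolding E_bound_def E_cplx_def by (metis (mono_tags, lifting) funpow_0 mem_Collect_eq)

lemma vderiv_add:
  assumes "smooth_fun f" "smooth_fun g"
  shows "vderiv (\<lambda>x. f x + g x) = (\<lambda>x. vderiv f x + vderiv g x)"
proof
  fix x
  have "((\<lambda>x. f x + g x) has_vector_derivative vderiv f x + vderiv g x) (at x)"
    by (intro has_vector_derivative_add smooth_fun_has_vderiv assms)
  thus "vderiv (\<lambda>x. f x + g x) x = vderiv f x + vderiv g x"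
    unfolding vderiv_def[of "\<lambda>x. f x + g x"] by (rule vector_derivative_at)
qed

lemma vderiv_scale:
  assumes "smooth_fun f"
  shows "vderiv (\<lambda>x. c * f x) = (\<lambda>x. c * vderiv f x)"
proof
  fix x
  have "((\<lambda>x. c * f x) has_vector_derivative c * vderiv f x) (at x)"
    by (intro has_vector_derivative_mult_right smooth_fun_has_vderiv assms)
  thus "vderiv (\<lambda>x. c * f x) x = c * vderiv f x"
    unfolding vderiv_def[of "\<lambda>x. c * f x"] by (rule vector_derivative_at)
qed

lemma vderiv_real:
  assumes f: "smooth_fun f" and real: "\<And>y. f y \<in> \<real>"
  shows "vderiv f x \<in> \<real>"
proof -
  have "((\<lambda>y. Im (f y)) has_vector_derivative Im (vderiv f x)) (at x)"
    by (rule bounded_linear.has_vector_derivative[OF bounded_linear_Im smooth_fun_has_vderiv(1)[OF f]])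
  moreover have "(\<lambda>y. Im (f y)) = (\<lambda>y. 0)" using real by (auto simp: complex_is_Real_iff)
  ultimately have "((\<lambda>y. 0::real) has_vector_derivative Im (vderiv f x)) (at x)" by simp
  from vector_derivative_unique_at[OF this has_vector_derivative_const]
  show ?thesis by (simp add: complex_is_Real_iff)
qed

text \<open>The function \<open>exp (- x) * (z x + z' x)\<close> has derivative 0 and tends to 0 at infinity, so \<open>z + z' = 0\<close>.
  Reflection in the origin gives \<open>z - z' = 0\<close>.\<close>

lemma bounded_kernel_of_helmholtz_zero:
  fixes z z' :: "real \<Rightarrow> complex"
  assumes z: "\<And>x. (z has_vector_derivative z' x) (at x)" and z': "\<And>x. (z' has_vector_derivative z x) (at x)"
    and K: "\<And>x. cmod (z x) \<le> K" "\<And>x. cmod (z' x) \<le> K"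
  shows "z x = 0"
proof -
  have first: "w x + w' x = 0"
    if w: "\<And>x. (w has_vector_derivative w' x) (at x)" "\<And>x. (w' has_vector_derivative w x) (at x)"
      and wK: "\<And>x. cmod (w x) \<le> K" "\<And>x. cmod (w' x) \<le> K" for w w' :: "real \<Rightarrow> complex" and x
  proof -
    define g where "g = (\<lambda>x. exp (- x) *\<^sub>R (w x + w' x))"
    have "(g has_vector_derivative exp (- x) *\<^sub>R (w' x + w x) + (- exp (- x)) *\<^sub>R (w x + w' x)) (at x)" for x
      unfolding g_def
      by (intro has_vector_derivative_scaleR has_vector_derivative_add w) (auto intro!: derivative_eq_intros)
    hence "(g has_vector_derivative 0) (at x within UNIV)" for x
      by (simp add: add.commute scaleR_minus_left)
    then obtain c where c: "\<And>x. g x = c"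
      using has_vector_derivative_zero_constant[of UNIV g] by auto
    have "((\<lambda>x. exp (- x) * (2 * K)) \<longlongrightarrow> 0 * (2 * K)) at_top"
      by (intro tendsto_mult tendsto_const filterlim_compose[OF exp_at_bot filterlim_uminus_at_bot_at_top])
    moreover have "\<forall>\<^sub>F x in at_top. cmod c \<le> exp (- x) * (2 * K)"
    proof (intro always_eventually allI)
      fix x :: real
      have "cmod c = exp (- x) * cmod (w x + w' x)" by (simp add: c[of x, symmetric] g_def)
      also have "\<dots> \<le> exp (- x) * (2 * K)"
        using wK[of x] by (intro mult_left_mono order_trans[OF norm_triangle_ineq]) auto
      finally show "cmod c \<le> exp (- x) * (2 * K)" .
    qed
    ultimately have "cmod c \<le> 0 * (2 * K)" by (intro tendsto_lowerbound) auto
    hence "g x = 0" using c[of x] by simp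
    thus ?thesis by (simp add: g_def)
  qed
  have plus: "z x + z' x = 0" by (rule first[OF z z' K])
  have m: "((\<lambda>x::real. - x) has_vector_derivative - 1) (at x)" for x
    by (intro has_vector_derivative_minus has_vector_derivative_id)
  have r: "((\<lambda>x. z (- x)) has_vector_derivative - z' (- x)) (at x)" for x
    using vector_diff_chain_at[OF m z] by (simp add: o_def)
  have r': "((\<lambda>x. - z' (- x)) has_vector_derivative z (- x)) (at x)" for x
    using has_vector_derivative_minus[OF vector_diff_chain_at[OF m z']] by (simp add: o_def)
  have "z (- (- x)) + - z' (- (- x)) = 0" by (rule first[OF r r']) (use K in auto)
  hence "z x - z' x = 0" by simp
  with plus have "(z x + z' x) + (z x - z' x) = 0" by (simp only: add_0)
  thus ?thesis by simp
qed

text \<open>Both functions are inverse transforms of integrable functions.\<close>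

lemma in_sobolev_2_bounded:
  assumes w: "smooth_fun w" "in_sobolev 2 w"
  shows "\<exists>K. \<forall>x. cmod (w x) \<le> K \<and> cmod (vderiv w x) \<le> K"
proof -
  note F = in_sobolev_imp_inv_fourier[OF order_refl w(2) smooth_fun_continuous[OF w(1)]]
  define G where "G = fourier_L2 w"
  have wG: "w = inv_fourier G" unfolding G_def by (rule F(1))
  have "vderiv w = inv_fourier (\<lambda>\<xi>. \<i> * of_real \<xi> * G \<xi>)"
    unfolding wG by (rule vderiv_inv_fourier[OF F(2,4), folded G_def])
  thus ?thesis
    using norm_inv_fourier_le[OF F(2), folded G_def] norm_inv_fourier_le[OF F(4), folded G_def] wG
    by (intro exI[of _ "max (LINT \<xi>|lborel. cmod (G \<xi>)) (LINT \<xi>|lborel. cmod (\<i> * of_real \<xi> * G \<xi>))"])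
       (auto simp: le_max_iff_disj)
qed

text \<open>By \<open>in_sobolev_2_bounded\<close>, the difference of two functions with the same image is a bounded element of
  the kernel with bounded derivative.\<close>

lemma inj_on_helmholtz: "inj_on helmholtz {w. smooth_fun w \<and> in_sobolev 2 w}"
proof (intro inj_onI ext)
  fix v w x
  assume "v \<in> {w. smooth_fun w \<and> in_sobolev 2 w}" "w \<in> {w. smooth_fun w \<and> in_sobolev 2 w}"
    and eq: "helmholtz v = helmholtz w"
  hence v: "smooth_fun v" "in_sobolev 2 v" and w: "smooth_fun w" "in_sobolev 2 w" by auto
  obtain K where K: "\<And>x. cmod (v x) \<le> K" "\<And>x. cmod (vderiv v x) \<le> K" using in_sobolev_2_bounded[OF v] by blast
  obtain M where M: "\<And>x. cmod (w x) \<le> M" "\<And>x. cmod (vderiv w x) \<le> M" using in_sobolev_2_bounded[OF w] by blast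
  have eq': "vderiv (vderiv v) y - vderiv (vderiv w) y = v y - w y" for y
    using fun_cong[OF eq, of y] by (simp add: helmholtz_def numeral_2_eq_2 algebra_simps)
  have "v x - w x = 0"
  proof (rule bounded_kernel_of_helmholtz_zero[where z = "\<lambda>x. v x - w x" and z' = "\<lambda>x. vderiv v x - vderiv w x" and K = "K + M"])
    fix x
    show "((\<lambda>x. v x - w x) has_vector_derivative vderiv v x - vderiv w x) (at x)"
      by (intro has_vector_derivative_diff smooth_fun_has_vderiv v w)
    show "((\<lambda>x. vderiv v x - vderiv w x) has_vector_derivative v x - w x) (at x)"
      unfolding eq'[symmetric] by (intro has_vector_derivative_diff smooth_fun_has_vderiv v w)
    show "cmod (v x - w x) \<le> K + M" "cmod (vderiv v x - vderiv w x) \<le> K + M"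
      using K[of x] M[of x] norm_triangle_ineq4[of "v x" "w x"] norm_triangle_ineq4[of "vderiv v x" "vderiv w x"] by linarith+
  qed
  thus "v x = w x" by simp
qed

lemma in_sobolev_mono:
  assumes f: "in_sobolev s f" and r: "r \<le> s"
  shows "in_sobolev r f"
proof -
  have L: "L2_fun f" "L2_fun (\<lambda>\<xi>. of_real (japanese s \<xi>) * fourier_L2 f \<xi>)"
    using f by (auto simp: in_sobolev_def japanese_def)
  have [measurable]: "fourier_L2 f \<in> borel_measurable borel" using L2_fun_fourier_L2[OF L(1)] by (simp add: L2_fun_def)
  have "L2_fun (\<lambda>\<xi>. of_real (japanese r \<xi>) * fourier_L2 f \<xi>)"
    by (rule L2_fun_mono[OF L(2)])
       (use japanese_mono[OF r] japanese_pos in \<open>auto simp: norm_mult abs_of_pos intro!: mult_right_mono\<close>)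
  thus ?thesis using L(1) by (simp add: in_sobolev_def japanese_def)
qed

lemma helmholtz_inv_eqI:
  assumes s: "2 \<le> s" and w: "E_bound \<delta> s w p" and eq: "\<And>x. w x - vderiv (vderiv w) x = g x"
  shows "helmholtz_inv g = w"
proof -
  have "helmholtz w = g" using eq by (intro ext) (simp add: helmholtz_def numeral_2_eq_2)
  moreover have "w \<in> {w. smooth_fun w \<and> in_sobolev 2 w}"
    using E_bound_smooth[OF w] in_sobolev_mono[OF E_bound_in_sobolev[OF w] s] by simp
  ultimately show ?thesis
    unfolding helmholtz_inv_def using inv_into_f_f[OF inj_on_helmholtz] by blast
qed

text \<open>The operator \<open>(1 - \<partial>\<^sub>x\<^sup>2)\<^sup>-\<^sup>1 \<partial>\<^sub>x\<close>.\<close>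

definition nonlocal_op :: "(real \<Rightarrow> complex) \<Rightarrow> real \<Rightarrow> complex" where
  "nonlocal_op h = helmholtz_inv (vderiv h)"

lemma nonlocal_op:
  assumes s: "2 \<le> s" and \<delta>: "0 < \<delta>" and h: "E_bound \<delta> s h p"
  shows "E_bound \<delta> (s + 1) (nonlocal_op h) p"
    "nonlocal_op h x - vderiv (vderiv (nonlocal_op h)) x = vderiv h x"
proof -
  have s1: "1 \<le> s" "1 \<le> s + 1" "2 \<le> s + 1" using s by auto
  obtain H where H: "spectral_bound \<delta> s H p" "h = inv_fourier H" using assms E_bound_iff_spectral by blast
  define W where "W = (\<lambda>\<xi>. \<i> * of_real \<xi> / of_real (1 + \<xi>\<^sup>2) * H \<xi>)"
  have W: "spectral_bound \<delta> (s + 1) W p" unfolding W_def by (rule spectral_smoothing[OF H(1) \<delta>])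
  define w where "w = inv_fourier W"
  have w: "E_bound \<delta> (s + 1) w p" unfolding w_def by (rule spectral_imp_E_bound[OF W \<delta> s1(2)])
  have eq: "w x - vderiv (vderiv w) x = vderiv h x" for x
  proof -
    note i = spectral_integrable[OF W \<delta> s1(2)]
    have "vderiv (vderiv w) = inv_fourier (\<lambda>\<xi>. (\<i> * of_real \<xi>) ^ 2 * W \<xi>)"
      using spectral_vderiv_power[OF W \<delta> s1(2), of 2] by (simp add: w_def numeral_2_eq_2)
    hence "w x - vderiv (vderiv w) x = inv_fourier (\<lambda>\<xi>. W \<xi> - (\<i> * of_real \<xi>) ^ 2 * W \<xi>) x"
      unfolding w_def by (simp only: inv_fourier_diff[OF i(2) i(1)])
    also have "(\<lambda>\<xi>. W \<xi> - (\<i> * of_real \<xi>) ^ 2 * W \<xi>) = (\<lambda>\<xi>. \<i> * of_real \<xi> * H \<xi>)"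
    proof
      fix \<xi> :: real
      have nz: "complex_of_real (1 + \<xi>\<^sup>2) \<noteq> 0" using one_plus_square_pos[of \<xi>] unfolding of_real_eq_0_iff by simp
      have "W \<xi> - (\<i> * of_real \<xi>) ^ 2 * W \<xi> = of_real (1 + \<xi>\<^sup>2) * W \<xi>"
        by (simp add: power_mult_distrib algebra_simps)
      thus "W \<xi> - (\<i> * of_real \<xi>) ^ 2 * W \<xi> = \<i> * of_real \<xi> * H \<xi>" using nz by (simp add: W_def)
    qed
    also have "inv_fourier (\<lambda>\<xi>. \<i> * of_real \<xi> * H \<xi>) = vderiv h"
      unfolding H(2) by (rule vderiv_spectral[OF H(1) \<delta> s1(1), symmetric])
    finally show ?thesis .
  qed
  have "nonlocal_op h = w" unfolding nonlocal_op_def by (rule helmholtz_inv_eqI[OF s1(3) w eq])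
  thus "E_bound \<delta> (s + 1) (nonlocal_op h) p" "nonlocal_op h x - vderiv (vderiv (nonlocal_op h)) x = vderiv h x"
    using w eq by simp_all
qed

lemma smooth_fun_vderiv: "smooth_fun f \<Longrightarrow> smooth_fun (vderiv f)"
  using smooth_fun_vderiv_power[of f 1] by simp

lemma nonlocal_op_add:
  assumes s: "2 \<le> s" and \<delta>: "0 < \<delta>" and f: "E_bound \<delta> s f p" and g: "E_bound \<delta> s g q"
  shows "nonlocal_op (\<lambda>x. f x + g x) = (\<lambda>x. nonlocal_op f x + nonlocal_op g x)"
  unfolding nonlocal_op_def[of "\<lambda>x. f x + g x"]
proof (rule helmholtz_inv_eqI)
  note Nf = nonlocal_op[OF s \<delta> f] and Ng = nonlocal_op[OF s \<delta> g]
  note sm = E_bound_smooth[OF Nf(1)] E_bound_smooth[OF Ng(1)]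
  show "E_bound \<delta> (s + 1) (\<lambda>x. nonlocal_op f x + nonlocal_op g x) (p + q)"
    using s by (intro E_bound_add \<delta> Nf Ng) auto
  show "nonlocal_op f x + nonlocal_op g x - vderiv (vderiv (\<lambda>x. nonlocal_op f x + nonlocal_op g x)) x = vderiv (\<lambda>x. f x + g x) x" for x
    using Nf(2)[of x] Ng(2)[of x]
    by (simp add: vderiv_add sm smooth_fun_vderiv E_bound_smooth[OF f] E_bound_smooth[OF g] algebra_simps)
qed (use s in auto)

lemma nonlocal_op_scale:
  assumes s: "2 \<le> s" and \<delta>: "0 < \<delta>" and f: "E_bound \<delta> s f p"
  shows "nonlocal_op (\<lambda>x. c * f x) = (\<lambda>x. c * nonlocal_op f x)"
  unfolding nonlocal_op_def[of "\<lambda>x. c * f x"]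
proof (rule helmholtz_inv_eqI)
  note Nf = nonlocal_op[OF s \<delta> f]
  note sm = E_bound_smooth[OF Nf(1)]
  show "E_bound \<delta> (s + 1) (\<lambda>x. c * nonlocal_op f x) (cmod c * p)"
    using s by (intro E_bound_scale \<delta> Nf) auto
  show "c * nonlocal_op f x - vderiv (vderiv (\<lambda>x. c * nonlocal_op f x)) x = vderiv (\<lambda>x. c * f x) x" for x
    using Nf(2)[of x]
    by (simp add: vderiv_scale sm smooth_fun_vderiv E_bound_smooth[OF f] right_diff_distrib[symmetric])
qed (use s in auto)

text \<open>The imaginary part of the image is bounded and lies in the kernel of \<open>1 - \<partial>\<^sub>x\<^sup>2\<close>.\<close>

lemma nonlocal_op_real:
  assumes s: "2 \<le> s" and \<delta>: "0 < \<delta>" and f: "E_bound \<delta> s f p" and real: "\<And>y. f y \<in> \<real>"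
  shows "nonlocal_op f x \<in> \<real>"
proof -
  define w where "w = nonlocal_op f"
  have w: "E_bound \<delta> (s + 1) w p" and eq: "\<And>x. w x - vderiv (vderiv w) x = vderiv f x"
    using nonlocal_op[OF s \<delta> f] by (auto simp: w_def)
  note sm = E_bound_smooth[OF w]
  have "in_sobolev 2 w" using in_sobolev_mono[OF E_bound_in_sobolev[OF w], of 2] s by simp
  then obtain K where K: "\<And>x. cmod (w x) \<le> K" "\<And>x. cmod (vderiv w x) \<le> K"
    using in_sobolev_2_bounded[OF sm] by blast
  have cnjd: "((\<lambda>x. cnj (g x)) has_vector_derivative cnj g') (at x)"
    if "(g has_vector_derivative g') (at x)" for g g' and x :: real
    by (rule bounded_linear.has_vector_derivative[OF bounded_linear_cnj that])
  have eq': "vderiv (vderiv w) y - cnj (vderiv (vderiv w) y) = w y - cnj (w y)" for y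
  proof -
    have "cnj (vderiv f y) = vderiv f y" using vderiv_real[OF E_bound_smooth[OF f] real] by (rule Reals_cnj_iff[THEN iffD1])
    hence "cnj (w y - vderiv (vderiv w) y) = w y - vderiv (vderiv w) y" by (simp only: eq)
    thus ?thesis by (simp add: algebra_simps)
  qed
  have "w x - cnj (w x) = 0"
  proof (rule bounded_kernel_of_helmholtz_zero[where z = "\<lambda>x. w x - cnj (w x)" and z' = "\<lambda>x. vderiv w x - cnj (vderiv w x)" and K = "K + K"])
    fix x
    show "((\<lambda>x. w x - cnj (w x)) has_vector_derivative vderiv w x - cnj (vderiv w x)) (at x)"
      by (intro has_vector_derivative_diff smooth_fun_has_vderiv sm cnjd)
    show "((\<lambda>x. vderiv w x - cnj (vderiv w x)) has_vector_derivative w x - cnj (w x)) (at x)"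
      unfolding eq'[symmetric] by (intro has_vector_derivative_diff smooth_fun_has_vderiv sm cnjd)
    show "cmod (w x - cnj (w x)) \<le> K + K" "cmod (vderiv w x - cnj (vderiv w x)) \<le> K + K"
      using K[of x] norm_triangle_ineq4[of "w x" "cnj (w x)"] norm_triangle_ineq4[of "vderiv w x" "cnj (vderiv w x)"]
      by simp_all
  qed
  thus ?thesis by (simp add: w_def Reals_cnj_iff)
qed

section \<open>The Cauchy problem as a quadratic evolution equation\<close>

text \<open>The polarization of the quadratic terms in \<open>nonlocal_term\<close>.\<close>

definition flux :: "real \<Rightarrow> (real \<Rightarrow> complex) \<Rightarrow> (real \<Rightarrow> complex) \<Rightarrow> (real \<Rightarrow> complex) \<Rightarrow> (real \<Rightarrow> complex) \<Rightarrow> real \<Rightarrow> complex" where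
  "flux \<beta> u v u' v' = (\<lambda>x. complex_of_real ((3 - \<beta>) / 2) * (u x * u' x)
      + complex_of_real (\<beta> / 2) * (vderiv u x * vderiv u' x) + 1 / 2 * (v x * v' x))"

definition flux_const :: "real \<Rightarrow> real \<Rightarrow> real" where
  "flux_const \<beta> s = \<bar>(3 - \<beta>) / 2\<bar> * algebra_const (s + 1) + \<bar>\<beta> / 2\<bar> * algebra_const s + 1 / 2 * algebra_const (s + 1)"

text \<open>The derivatives cost one order of smoothness, \<open>s + 1\<close> to \<open>s\<close>, but nothing in \<open>\<delta>\<close>. The nonlocal operator
  restores this order, so \<open>u\<^sub>x\<^sup>2\<close> causes no loss in the scale.\<close>

lemma flux_bound:
  assumes s: "2 \<le> s" and \<delta>: "0 < \<delta>"
    and u: "E_bound \<delta> (s + 1) u p" "E_bound \<delta> (s + 1) v p" and u': "E_bound \<delta> (s + 1) u' q" "E_bound \<delta> (s + 1) v' q"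
  shows "E_bound \<delta> s (flux \<beta> u v u' v') (flux_const \<beta> s * (p * q))"
proof -
  have s1: "2 \<le> s + 1" "s \<le> s + 1" using s by auto
  have "E_bound \<delta> s (flux \<beta> u v u' v') (cmod (complex_of_real ((3 - \<beta>) / 2)) * (algebra_const (s + 1) * (p * q))
      + cmod (complex_of_real (\<beta> / 2)) * (algebra_const s * (p * q)) + cmod (1 / 2) * (algebra_const (s + 1) * (p * q)))"
    unfolding flux_def
    by (intro E_bound_add E_bound_scale E_bound_order_mono[OF s s1(2)] E_bound_mult
        E_bound_vderiv_lower_order s s1 \<delta> u u')
  thus ?thesis unfolding norm_of_real by (simp add: flux_const_def algebra_simps)
qed

lemma flux_add_left:
  assumes "smooth_fun u" "smooth_fun w"
  shows "flux \<beta> (\<lambda>x. u x + w x) (\<lambda>x. v x + z x) u' v' = (\<lambda>x. flux \<beta> u v u' v' x + flux \<beta> w z u' v' x)"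
  by (simp add: flux_def vderiv_add[OF assms] algebra_simps)

lemma flux_add_right:
  assumes "smooth_fun u" "smooth_fun w"
  shows "flux \<beta> u' v' (\<lambda>x. u x + w x) (\<lambda>x. v x + z x) = (\<lambda>x. flux \<beta> u' v' u v x + flux \<beta> u' v' w z x)"
  by (simp add: flux_def vderiv_add[OF assms] algebra_simps)

lemma flux_scale:
  assumes "smooth_fun u" "smooth_fun w"
  shows "flux \<beta> (\<lambda>x. c * u x) (\<lambda>x. c * v x) (\<lambda>x. e * w x) (\<lambda>x. e * z x) = (\<lambda>x. c * e * flux \<beta> u v w z x)"
  by (simp add: flux_def vderiv_scale assms algebra_simps)

text \<open>The unknowns \<open>u\<close> and \<open>v\<close> form one function on the disjoint union \<open>real + real\<close>, so that pairs are again
  complex-valued functions. Signs are written as factors \<open>- 1\<close> so that the rules for sums and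
  scalar multiples apply.\<close>

definition linear_part :: "real \<Rightarrow> (real + real \<Rightarrow> complex) \<Rightarrow> real + real \<Rightarrow> complex" where
  "linear_part \<alpha> V = case_sum
     (\<lambda>x. complex_of_real \<alpha> * nonlocal_op (V \<circ> Inl) x + - 1 * nonlocal_op (V \<circ> Inr) x)
     (\<lambda>x. - 1 * vderiv (V \<circ> Inl) x)"

definition quadratic_part :: "real \<Rightarrow> (real + real \<Rightarrow> complex) \<Rightarrow> (real + real \<Rightarrow> complex) \<Rightarrow> real + real \<Rightarrow> complex" where
  "quadratic_part \<beta> V W = case_sum
     (\<lambda>x. complex_of_real (- \<beta>) * ((V \<circ> Inl) x * vderiv (W \<circ> Inl) x)
        + - 1 * nonlocal_op (flux \<beta> (V \<circ> Inl) (V \<circ> Inr) (W \<circ> Inl) (W \<circ> Inr)) x)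
     (\<lambda>x. - 1 * vderiv (\<lambda>y. (V \<circ> Inl) y * (W \<circ> Inr) y) x)"

definition pair_bound :: "real \<Rightarrow> real \<Rightarrow> real \<Rightarrow> (real + real \<Rightarrow> complex) \<Rightarrow> real \<Rightarrow> bool" where
  "pair_bound \<Delta> s d V p \<longleftrightarrow> E_bound (\<Delta> * d) s (V \<circ> Inl) p \<and> E_bound (\<Delta> * d) s (V \<circ> Inr) p"

lemma sum_fun_eqI:
  assumes "f \<circ> Inl = g \<circ> Inl" "f \<circ> Inr = g \<circ> Inr"
  shows "f = g"
proof
  fix i show "f i = g i"
    using fun_cong[OF assms(1)] fun_cong[OF assms(2)] by (cases i) auto
qed

lemma banach_scale_pair_bound:
  assumes s: "2 \<le> s" and \<Delta>: "0 < \<Delta>"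
  shows "banach_scale (pair_bound \<Delta> s)"
proof -
  interpret E: banach_scale "\<lambda>d. E_bound (\<Delta> * d) s" by (rule banach_scale_E_bound[OF s \<Delta>])
  show ?thesis
  proof
    show "pair_bound \<Delta> s d f p \<Longrightarrow> 0 \<le> p" for d f p
      using E.bnd_nonneg by (auto simp: pair_bound_def)
    show "pair_bound \<Delta> s d f p \<Longrightarrow> p \<le> q \<Longrightarrow> pair_bound \<Delta> s d f q" for d f p q
      using E.bnd_weaken by (auto simp: pair_bound_def)
    show "(\<And>e. 0 < e \<Longrightarrow> pair_bound \<Delta> s d f (p + e)) \<Longrightarrow> pair_bound \<Delta> s d f p" for d f p
      using E.bnd_closed by (auto simp: pair_bound_def)
    show "0 < d \<Longrightarrow> d \<le> d' \<Longrightarrow> d' < 1 \<Longrightarrow> pair_bound \<Delta> s d' f p \<Longrightarrow> pair_bound \<Delta> s d f p" for d d' f p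
      using E.bnd_mono by (auto simp: pair_bound_def)
    show "pair_bound \<Delta> s d (\<lambda>i. c * f i) (cmod c * p)" if "0 < d" "d < 1" "pair_bound \<Delta> s d f p" for d f p c
      using that E.bnd_scale[of d "f \<circ> Inl" p c] E.bnd_scale[of d "f \<circ> Inr" p c] by (auto simp: pair_bound_def o_def)
    show "pair_bound \<Delta> s d (\<lambda>i. \<Sum>n. a n i) (\<Sum>n. r n)"
      if "0 < d" "d < 1" "\<And>n. pair_bound \<Delta> s d (a n) (r n)" "summable r" for d a r
      using that E.bnd_suminf[of d "\<lambda>n. a n \<circ> Inl" r] E.bnd_suminf[of d "\<lambda>n. a n \<circ> Inr" r]
      by (auto simp: pair_bound_def o_def)
    show "\<exists>K. \<forall>f p. pair_bound \<Delta> s d f p \<longrightarrow> cmod (f i) \<le> K * p" if "0 < d" "d < 1" for d and i :: "real + real"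
    proof (cases i)
      case (Inl x)
      thus ?thesis using E.bnd_eval[OF that, of x] by (auto simp: pair_bound_def o_def)
    next
      case (Inr x)
      thus ?thesis using E.bnd_eval[OF that, of x] by (auto simp: pair_bound_def o_def)
    qed
  qed
qed

definition equation_const :: "real \<Rightarrow> real \<Rightarrow> real \<Rightarrow> real \<Rightarrow> real" where
  "equation_const \<alpha> \<beta> \<Delta> s = (\<bar>\<alpha>\<bar> + 1) + 1 / \<Delta> + (\<bar>\<beta>\<bar> + 1) * algebra_const (s + 1) / \<Delta> + flux_const \<beta> s"

lemma flux_const_pos: "0 < flux_const \<beta> s"
  unfolding flux_const_def using algebra_const_pos[of s] algebra_const_pos[of "s + 1"]
  by (intro add_nonneg_pos add_nonneg_nonneg mult_nonneg_nonneg) auto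

lemma E_bound_weaken: "E_bound \<delta> s f p \<Longrightarrow> p \<le> q \<Longrightarrow> E_bound \<delta> s f q"
  by (simp add: E_bound_def)

text \<open>The nonlocal terms are bounded; since \<open>d' - d < 1\<close>, they too satisfy a bound of the form required in
  \<open>cauchy_kovalevskaya\<close>.\<close>

lemma linear_part_bound:
  assumes s: "2 \<le> s" and \<Delta>: "0 < \<Delta>" and d: "0 < d" "d < d'" "d' < 1"
    and V: "pair_bound \<Delta> (s + 1) d' V p"
  shows "pair_bound \<Delta> (s + 1) d (linear_part \<alpha> V) (equation_const \<alpha> \<beta> \<Delta> s / (d' - d) * p)"
proof -
  let ?K = "equation_const \<alpha> \<beta> \<Delta> s"
  have s1: "2 \<le> s + 1" "s \<le> s + 1" using s by auto
  have \<delta>: "0 < \<Delta> * d" "\<Delta> * d < \<Delta> * d'" "0 < \<Delta> * d'" using \<Delta> d by auto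
  have u: "E_bound (\<Delta> * d') (s + 1) (V \<circ> Inl) p" and v: "E_bound (\<Delta> * d') (s + 1) (V \<circ> Inr) p"
    using V by (auto simp: pair_bound_def)
  note lower = E_bound_mono[OF s1(1) \<delta>(1) less_imp_le[OF \<delta>(2)]]
  have p: "0 \<le> p" by (rule E_bound_nonneg[OF u])
  have dd: "0 < d' - d" "d' - d < 1" using d by auto
  have N: "E_bound (\<Delta> * d) (s + 1) (nonlocal_op (V \<circ> Inl)) p" "E_bound (\<Delta> * d) (s + 1) (nonlocal_op (V \<circ> Inr)) p"
    by (intro nonlocal_op(1)[OF s \<delta>(1)] E_bound_order_mono[OF s s1(2) \<delta>(1)] lower u v)+
  have 1: "E_bound (\<Delta> * d) (s + 1) (linear_part \<alpha> V \<circ> Inl) (cmod (of_real \<alpha>) * p + cmod (- 1) * p)"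
    unfolding linear_part_def case_sum_o_inj
    by (intro E_bound_add E_bound_scale s1 \<delta> N)
  have 2: "E_bound (\<Delta> * d) (s + 1) (linear_part \<alpha> V \<circ> Inr) (cmod (- 1) * (1 / (\<Delta> * d' - \<Delta> * d) * p))"
    unfolding linear_part_def case_sum_o_inj
    by (intro E_bound_scale E_bound_vderiv s1 \<delta> u)
  have C: "\<bar>\<alpha>\<bar> + 1 \<le> ?K" "1 / \<Delta> \<le> ?K"
    unfolding equation_const_def using \<Delta> flux_const_pos[of \<beta> s] algebra_const_pos[of "s + 1"] by auto
  have "(\<bar>\<alpha>\<bar> + 1) * 1 \<le> ?K * (1 / (d' - d))"
    using dd C by (intro mult_mono) auto
  from mult_right_mono[OF this p] have bd1: "cmod (of_real \<alpha>) * p + cmod (- 1) * p \<le> ?K / (d' - d) * p"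
    by (simp add: distrib_right)
  have "1 / \<Delta> * (1 / (d' - d)) \<le> ?K * (1 / (d' - d))"
    using dd C by (intro mult_right_mono) auto
  from mult_right_mono[OF this p] have bd2: "cmod (- 1) * (1 / (\<Delta> * d' - \<Delta> * d) * p) \<le> ?K / (d' - d) * p"
    by (simp add: right_diff_distrib[symmetric])
  show ?thesis unfolding pair_bound_def
    using E_bound_weaken[OF 1 bd1] E_bound_weaken[OF 2 bd2] by blast
qed

lemma quadratic_part_bound:
  assumes s: "2 \<le> s" and \<Delta>: "0 < \<Delta>" and d: "0 < d" "d < d'" "d' < 1"
    and V: "pair_bound \<Delta> (s + 1) d' V p" and W: "pair_bound \<Delta> (s + 1) d' W q"
  shows "pair_bound \<Delta> (s + 1) d (quadratic_part \<beta> V W) (equation_const \<alpha> \<beta> \<Delta> s / (d' - d) * (p * q))"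
proof -
  let ?K = "equation_const \<alpha> \<beta> \<Delta> s"
  have s1: "2 \<le> s + 1" "s \<le> s + 1" using s by auto
  have \<delta>: "0 < \<Delta> * d" "\<Delta> * d < \<Delta> * d'" "0 < \<Delta> * d'" using \<Delta> d by auto
  have u: "E_bound (\<Delta> * d') (s + 1) (V \<circ> Inl) p" and v: "E_bound (\<Delta> * d') (s + 1) (V \<circ> Inr) p"
    using V by (auto simp: pair_bound_def)
  have u': "E_bound (\<Delta> * d') (s + 1) (W \<circ> Inl) q" and v': "E_bound (\<Delta> * d') (s + 1) (W \<circ> Inr) q"
    using W by (auto simp: pair_bound_def)
  note lower = E_bound_mono[OF s1(1) \<delta>(1) less_imp_le[OF \<delta>(2)]]
  have p: "0 \<le> p * q" using E_bound_nonneg[OF u] E_bound_nonneg[OF u'] by simp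
  have dd: "0 < d' - d" "d' - d < 1" using d by auto
  define A where "A = algebra_const (s + 1)"
  have A: "A > 0" unfolding A_def by (rule algebra_const_pos)
  have 1: "E_bound (\<Delta> * d) (s + 1) (quadratic_part \<beta> V W \<circ> Inl)
     (cmod (of_real (- \<beta>)) * (A * (p * (1 / (\<Delta> * d' - \<Delta> * d) * q))) + cmod (- 1) * (flux_const \<beta> s * (p * q)))"
    unfolding quadratic_part_def case_sum_o_inj A_def
    by (intro E_bound_add E_bound_scale E_bound_mult E_bound_vderiv nonlocal_op(1)[OF s] flux_bound s s1 \<delta> lower[OF u] lower[OF v] lower[OF u'] lower[OF v'] u')
  have 2: "E_bound (\<Delta> * d) (s + 1) (quadratic_part \<beta> V W \<circ> Inr) (cmod (- 1) * (1 / (\<Delta> * d' - \<Delta> * d) * (A * (p * q))))"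
    unfolding quadratic_part_def case_sum_o_inj A_def
    by (intro E_bound_scale E_bound_vderiv E_bound_mult s1 \<delta> u v')
  have diff: "\<Delta> * d' - \<Delta> * d = \<Delta> * (d' - d)" by (simp add: right_diff_distrib)
  have e: "cmod (of_real (- \<beta>)) * (A * (p * (1 / (\<Delta> * d' - \<Delta> * d) * q))) + cmod (- 1) * (flux_const \<beta> s * (p * q))
      = (\<bar>\<beta>\<bar> * A / \<Delta> * (1 / (d' - d)) + flux_const \<beta> s * 1) * (p * q)"
    unfolding diff norm_of_real by (simp add: algebra_simps)
  have Cdef: "?K = (\<bar>\<alpha>\<bar> + 1) + 1 / \<Delta> + (\<bar>\<beta>\<bar> * A / \<Delta> + A / \<Delta>) + flux_const \<beta> s"
    by (simp add: equation_const_def A_def distrib_right add_divide_distrib)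
  have nn: "0 \<le> \<bar>\<beta>\<bar> * A / \<Delta>" "0 \<le> A / \<Delta>" "0 < 1 / \<Delta>" "0 \<le> \<bar>\<alpha>\<bar>" "0 \<le> flux_const \<beta> s"
    using A \<Delta> flux_const_pos[of \<beta> s] by auto
  have "\<bar>\<beta>\<bar> * A / \<Delta> * (1 / (d' - d)) + flux_const \<beta> s * 1 \<le> \<bar>\<beta>\<bar> * A / \<Delta> * (1 / (d' - d)) + flux_const \<beta> s * (1 / (d' - d))"
    using dd nn by (intro add_left_mono mult_left_mono) auto
  also have "\<dots> = (\<bar>\<beta>\<bar> * A / \<Delta> + flux_const \<beta> s) * (1 / (d' - d))" by (simp only: distrib_right)
  also have "\<dots> \<le> ?K * (1 / (d' - d))"
    using dd nn by (intro mult_right_mono) (simp_all only: Cdef, simp_all)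
  finally have "\<bar>\<beta>\<bar> * A / \<Delta> * (1 / (d' - d)) + flux_const \<beta> s * 1 \<le> ?K / (d' - d)" by simp
  from mult_right_mono[OF this p] have bd1: "cmod (of_real (- \<beta>)) * (A * (p * (1 / (\<Delta> * d' - \<Delta> * d) * q))) + cmod (- 1) * (flux_const \<beta> s * (p * q))
     \<le> ?K / (d' - d) * (p * q)" by (simp only: e)
  have "A / \<Delta> * (1 / (d' - d)) \<le> ?K * (1 / (d' - d))"
    using dd nn by (intro mult_right_mono) (simp_all only: Cdef, simp_all)
  from mult_right_mono[OF this p] have bd2: "cmod (- 1) * (1 / (\<Delta> * d' - \<Delta> * d) * (A * (p * q))) \<le> ?K / (d' - d) * (p * q)"
    unfolding diff by (simp add: mult_ac)
  show ?thesis unfolding pair_bound_def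
    using E_bound_weaken[OF 1 bd1] E_bound_weaken[OF 2 bd2] by blast
qed

lemma mult_has_vderiv:
  assumes "smooth_fun f" "smooth_fun g"
  shows "((\<lambda>x. f x * g x) has_vector_derivative vderiv (\<lambda>x. f x * g x) x) (at x)"
proof -
  have "(\<lambda>x. f x * g x) differentiable at x"
    by (rule differentiableI_vector[OF has_vector_derivative_mult[OF smooth_fun_has_vderiv(1)[OF assms(1)] smooth_fun_has_vderiv(1)[OF assms(2)]]])
  thus ?thesis by (simp add: vderiv_def vector_derivative_works)
qed

lemma vderiv_mult_add:
  assumes f: "smooth_fun f" and g: "smooth_fun g" and h: "smooth_fun h"
  shows "vderiv (\<lambda>x. (f x + g x) * h x) = (\<lambda>x. vderiv (\<lambda>x. f x * h x) x + vderiv (\<lambda>x. g x * h x) x)"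
    "vderiv (\<lambda>x. h x * (f x + g x)) = (\<lambda>x. vderiv (\<lambda>x. h x * f x) x + vderiv (\<lambda>x. h x * g x) x)"
proof -
  have "((\<lambda>x. (f x + g x) * h x) has_vector_derivative vderiv (\<lambda>x. f x * h x) x + vderiv (\<lambda>x. g x * h x) x) (at x)" for x
    using has_vector_derivative_add[OF mult_has_vderiv[OF f h, of x] mult_has_vderiv[OF g h, of x]] by (simp add: distrib_right)
  thus "vderiv (\<lambda>x. (f x + g x) * h x) = (\<lambda>x. vderiv (\<lambda>x. f x * h x) x + vderiv (\<lambda>x. g x * h x) x)"
    unfolding vderiv_def[of "\<lambda>x. (f x + g x) * h x"] by (intro ext vector_derivative_at)
  have "((\<lambda>x. h x * (f x + g x)) has_vector_derivative vderiv (\<lambda>x. h x * f x) x + vderiv (\<lambda>x. h x * g x) x) (at x)" for x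
    using has_vector_derivative_add[OF mult_has_vderiv[OF h f, of x] mult_has_vderiv[OF h g, of x]] by (simp add: distrib_left)
  thus "vderiv (\<lambda>x. h x * (f x + g x)) = (\<lambda>x. vderiv (\<lambda>x. h x * f x) x + vderiv (\<lambda>x. h x * g x) x)"
    unfolding vderiv_def[of "\<lambda>x. h x * (f x + g x)"] by (intro ext vector_derivative_at)
qed

lemma cauchy_kovalevskaya_pair:
  assumes s: "2 \<le> s" and \<Delta>: "0 < \<Delta>"
  shows "cauchy_kovalevskaya (pair_bound \<Delta> (s + 1)) (linear_part \<alpha>) (quadratic_part \<beta>) (equation_const \<alpha> \<beta> \<Delta> s)"
proof -
  let ?P = "pair_bound \<Delta> (s + 1)"
  have s1: "2 \<le> s + 1" "s \<le> s + 1" using s by auto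
  interpret banach_scale "?P" by (rule banach_scale_pair_bound[OF s1(1) \<Delta>])
  have comp: "E_bound (\<Delta> * d) (s + 1) (V \<circ> Inl) p" "E_bound (\<Delta> * d) (s + 1) (V \<circ> Inr) p"
    "E_bound (\<Delta> * d) s (V \<circ> Inl) p" "E_bound (\<Delta> * d) s (V \<circ> Inr) p"
    "smooth_fun (V \<circ> Inl)" "smooth_fun (V \<circ> Inr)" "0 < \<Delta> * d"
    if "?P d V p" "0 < d" for d V p
    using that \<Delta> E_bound_order_mono[OF s s1(2), of "\<Delta> * d"] E_bound_smooth by (auto simp: pair_bound_def)
  show ?thesis
  proof
    show "0 < equation_const \<alpha> \<beta> \<Delta> s"
      unfolding equation_const_def using \<Delta> flux_const_pos[of \<beta> s] algebra_const_pos[of "s + 1"]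
      by (intro add_nonneg_pos add_nonneg_nonneg) auto
    show "?P d (linear_part \<alpha> f) (equation_const \<alpha> \<beta> \<Delta> s / (d' - d) * p)"
      if "0 < d" "d < d'" "d' < 1" "?P d' f p" for d d' f p
      by (rule linear_part_bound[OF s \<Delta> that])
    show "?P d (quadratic_part \<beta> f g) (equation_const \<alpha> \<beta> \<Delta> s / (d' - d) * (p * q))"
      if "0 < d" "d < d'" "d' < 1" "?P d' f p" "?P d' g q" for d d' f g p q
      by (rule quadratic_part_bound[OF s \<Delta> that])
    show "linear_part \<alpha> (\<lambda>i. f i + g i) = (\<lambda>i. linear_part \<alpha> f i + linear_part \<alpha> g i)"
      if d: "0 < d" "d < 1" and fg: "?P d f p" "?P d g q" for d f g p q
    proof -
      note f = comp[OF fg(1) d(1)] and g = comp[OF fg(2) d(1)]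
      note f' = f[unfolded o_def] and g' = g[unfolded o_def]
      show ?thesis
        by (rule sum_fun_eqI)
           (auto simp: linear_part_def fun_eq_iff o_def nonlocal_op_add[OF s f'(7,3) g'(3)] nonlocal_op_add[OF s f'(7,4) g'(4)]
              vderiv_add[OF f'(5) g'(5)] algebra_simps)
    qed
    show "linear_part \<alpha> (\<lambda>i. c * f i) = (\<lambda>i. c * linear_part \<alpha> f i)"
      if d: "0 < d" "d < 1" and fp: "?P d f p" for d f p c
    proof -
      note f' = comp[OF fp d(1), unfolded o_def]
      show ?thesis
        by (rule sum_fun_eqI)
           (auto simp: linear_part_def fun_eq_iff o_def nonlocal_op_scale[OF s f'(7,3)] nonlocal_op_scale[OF s f'(7,4)]
              vderiv_scale[OF f'(5)] algebra_simps)
    qed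
    show "quadratic_part \<beta> (\<lambda>i. f i + g i) h = (\<lambda>i. quadratic_part \<beta> f h i + quadratic_part \<beta> g h i)"
      if d: "0 < d" "d < 1" and fgh: "?P d f p" "?P d g q" "?P d h r" for d f g h p q r
    proof -
      note f' = comp[OF fgh(1) d(1), unfolded o_def] and g' = comp[OF fgh(2) d(1), unfolded o_def]
        and h' = comp[OF fgh(3) d(1), unfolded o_def]
      note N = nonlocal_op_add[OF s f'(7) flux_bound[OF s f'(7) f'(1,2) h'(1,2)] flux_bound[OF s f'(7) g'(1,2) h'(1,2)]]
      show ?thesis
        by (rule sum_fun_eqI)
           (auto simp: quadratic_part_def fun_eq_iff o_def flux_add_left[OF f'(5) g'(5)] N
              vderiv_mult_add(1)[OF f'(5) g'(5) h'(6), unfolded distrib_right] algebra_simps)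
    qed
    show "quadratic_part \<beta> h (\<lambda>i. f i + g i) = (\<lambda>i. quadratic_part \<beta> h f i + quadratic_part \<beta> h g i)"
      if d: "0 < d" "d < 1" and fgh: "?P d f p" "?P d g q" "?P d h r" for d f g h p q r
    proof -
      note f' = comp[OF fgh(1) d(1), unfolded o_def] and g' = comp[OF fgh(2) d(1), unfolded o_def]
        and h' = comp[OF fgh(3) d(1), unfolded o_def]
      note N = nonlocal_op_add[OF s f'(7) flux_bound[OF s f'(7) h'(1,2) f'(1,2)] flux_bound[OF s f'(7) h'(1,2) g'(1,2)]]
      show ?thesis
        by (rule sum_fun_eqI)
           (auto simp: quadratic_part_def fun_eq_iff o_def flux_add_right[OF f'(5) g'(5)] N vderiv_add[OF f'(5) g'(5)]
              vderiv_mult_add(1)[OF f'(6) g'(6) h'(5), unfolded distrib_right]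
              vderiv_mult_add(2)[OF f'(6) g'(6) h'(5), unfolded distrib_left] algebra_simps)
    qed
    show "quadratic_part \<beta> (\<lambda>i. c * f i) (\<lambda>i. e * g i) = (\<lambda>i. c * e * quadratic_part \<beta> f g i)"
      if d: "0 < d" "d < 1" and fg: "?P d f p" "?P d g q" for d f g p q c e
    proof -
      note f' = comp[OF fg(1) d(1), unfolded o_def] and g' = comp[OF fg(2) d(1), unfolded o_def]
      note N = nonlocal_op_scale[OF s f'(7) flux_bound[OF s f'(7) f'(1,2) g'(1,2)], of "c * e", unfolded mult.assoc]
      have sm: "smooth_fun (\<lambda>x. f (Inl x) * g (Inr x))"
        by (rule E_bound_smooth[OF E_bound_mult[OF s1(1) f'(7) f'(1) g'(2)]])
      note v = vderiv_scale[OF sm, of "c * e", unfolded mult.assoc]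
      show ?thesis
        by (rule sum_fun_eqI)
           (auto simp: quadratic_part_def fun_eq_iff o_def flux_scale[OF f'(5) g'(5)] N vderiv_scale[OF g'(5)] v algebra_simps)
    qed
  qed
qed


section \<open>Translation between the two notions of solution\<close>

lemma E_norm_tendsto_0_iff:
  assumes ev: "\<forall>\<^sub>F \<tau> in F. f \<tau> \<in> E_cplx \<delta> s"
  shows "((\<lambda>\<tau>. E_norm \<delta> s (f \<tau>)) \<longlongrightarrow> 0) F \<longleftrightarrow> (\<forall>\<epsilon>>0. \<forall>\<^sub>F \<tau> in F. E_bound \<delta> s (f \<tau>) \<epsilon>)"
proof
  assume lim: "((\<lambda>\<tau>. E_norm \<delta> s (f \<tau>)) \<longlongrightarrow> 0) F"
  show "\<forall>\<epsilon>>0. \<forall>\<^sub>F \<tau> in F. E_bound \<delta> s (f \<tau>) \<epsilon>"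
  proof (intro allI impI)
    fix \<epsilon> :: real assume "0 < \<epsilon>"
    hence "\<forall>\<^sub>F \<tau> in F. E_norm \<delta> s (f \<tau>) < \<epsilon>" by (rule order_tendstoD(2)[OF lim])
    with ev show "\<forall>\<^sub>F \<tau> in F. E_bound \<delta> s (f \<tau>) \<epsilon>"
      by eventually_elim (simp add: E_bound_def)
  qed
next
  assume bd: "\<forall>\<epsilon>>0. \<forall>\<^sub>F \<tau> in F. E_bound \<delta> s (f \<tau>) \<epsilon>"
  show "((\<lambda>\<tau>. E_norm \<delta> s (f \<tau>)) \<longlongrightarrow> 0) F"
  proof (rule tendstoI)
    fix \<epsilon> :: real assume "0 < \<epsilon>"
    hence "\<forall>\<^sub>F \<tau> in F. E_bound \<delta> s (f \<tau>) (\<epsilon> / 2)" using bd by simp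
    thus "\<forall>\<^sub>F \<tau> in F. dist (E_norm \<delta> s (f \<tau>)) 0 < \<epsilon>"
    proof eventually_elim
      case (elim \<tau>)
      hence "E_bound \<delta> s (f \<tau>) (E_norm \<delta> s (f \<tau>))" by (simp add: E_bound_def)
      from E_bound_nonneg[OF this] elim \<open>0 < \<epsilon>\<close> show ?case by (simp add: E_bound_def)
    qed
  qed
qed

lemma E_cplx_iff: "f \<in> E_cplx \<delta> s \<longleftrightarrow> (\<exists>p. E_bound \<delta> s f p)"
  by (auto simp: E_bound_def)

lemma E_cplx_quotient:
  assumes s: "2 \<le> s" and \<delta>: "0 < \<delta>" and "f \<in> E_cplx \<delta> s" "g \<in> E_cplx \<delta> s" "w \<in> E_cplx \<delta> s"
  shows "(\<lambda>x. (f x - g x) / c - w x) \<in> E_cplx \<delta> s"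
proof -
  obtain p q r where b: "E_bound \<delta> s f p" "E_bound \<delta> s g q" "E_bound \<delta> s w r"
    using assms by (auto simp: E_cplx_iff)
  have "E_bound \<delta> s (\<lambda>x. (1 / c) * (f x + (- 1) * g x) + (- 1) * w x) (cmod (1 / c) * (p + cmod (- 1) * q) + cmod (- 1) * r)"
    by (intro E_bound_add E_bound_scale s \<delta> b)
  moreover have "(\<lambda>x. (1 / c) * (f x + (- 1) * g x) + (- 1) * w x) = (\<lambda>x. (f x - g x) / c - w x)"
    by (simp add: diff_divide_distrib algebra_simps)
  ultimately show ?thesis by (auto simp: E_cplx_iff)
qed

lemma right_hand_side_eq:
  assumes s: "2 \<le> s" and \<Delta>: "0 < \<Delta>" and d: "0 < d" and V: "pair_bound \<Delta> (s + 1) d V p"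
  shows "linear_part \<alpha> V (Inl x) + quadratic_part \<beta> V V (Inl x) =
      - (complex_of_real \<beta> * V (Inl x) * vderiv (V \<circ> Inl) x
         + helmholtz_inv (vderiv (nonlocal_term \<alpha> \<beta> (V \<circ> Inl) (V \<circ> Inr))) x)"
    "linear_part \<alpha> V (Inr x) + quadratic_part \<beta> V V (Inr x) =
      - (vderiv (V \<circ> Inl) x + vderiv (\<lambda>y. (V \<circ> Inl) y * (V \<circ> Inr) y) x)"
proof -
  have s1: "s \<le> s + 1" by simp
  have \<delta>: "0 < \<Delta> * d" using \<Delta> d by simp
  define u v where "u = V \<circ> Inl" and "v = V \<circ> Inr"
  have b: "E_bound (\<Delta> * d) (s + 1) u p" "E_bound (\<Delta> * d) (s + 1) v p" using V by (auto simp: pair_bound_def u_def v_def)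
  note bs = b[THEN E_bound_order_mono[OF s s1 \<delta>]]
  note bu = E_bound_scale[OF s \<delta> bs(1), of "- complex_of_real \<alpha>"]
  note bf = flux_bound[OF s \<delta> b b, of \<beta>]
  have "nonlocal_term \<alpha> \<beta> u v = (\<lambda>x. (- complex_of_real \<alpha> * u x + flux \<beta> u v u v x) + v x)"
    by (simp add: nonlocal_term_def flux_def fun_eq_iff power2_eq_square)
  hence "helmholtz_inv (vderiv (nonlocal_term \<alpha> \<beta> u v)) = nonlocal_op (\<lambda>x. (- complex_of_real \<alpha> * u x + flux \<beta> u v u v x) + v x)"
    by (simp add: nonlocal_op_def)
  also have "\<dots> = (\<lambda>x. (- complex_of_real \<alpha> * nonlocal_op u x + nonlocal_op (flux \<beta> u v u v) x) + nonlocal_op v x)"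
    unfolding nonlocal_op_add[OF s \<delta> E_bound_add[OF s \<delta> bu bf] bs(2)] nonlocal_op_add[OF s \<delta> bu bf] nonlocal_op_scale[OF s \<delta> bs(1)] ..
  finally show "linear_part \<alpha> V (Inl x) + quadratic_part \<beta> V V (Inl x) =
      - (complex_of_real \<beta> * V (Inl x) * vderiv (V \<circ> Inl) x
         + helmholtz_inv (vderiv (nonlocal_term \<alpha> \<beta> (V \<circ> Inl) (V \<circ> Inr))) x)"
    unfolding u_def[symmetric] v_def[symmetric]
    by (simp add: linear_part_def quadratic_part_def u_def[symmetric] v_def[symmetric] algebra_simps) (simp add: u_def)
  show "linear_part \<alpha> V (Inr x) + quadratic_part \<beta> V V (Inr x) =
      - (vderiv (V \<circ> Inl) x + vderiv (\<lambda>y. (V \<circ> Inl) y * (V \<circ> Inr) y) x)"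
    by (simp add: linear_part_def quadratic_part_def)
qed

lemma ex_scale_parameter:
  fixes T r :: real
  assumes "0 < T" "0 \<le> r" "r < T"
  shows "\<exists>d. 0 < d \<and> d < 1 \<and> r < T * (1 - d)"
proof (intro exI conjI)
  have "0 \<le> r / T" "r / T < 1" using assms by auto
  thus "0 < (1 - r / T) / 2" "(1 - r / T) / 2 < 1" by auto
  have eq: "T * (1 - (1 - r / T) / 2) = (T + r) / 2" using assms by (simp add: field_simps)
  show "r < T * (1 - (1 - r / T) / 2)" unfolding eq using assms by simp
qed

text \<open>The norms dominate point evaluations, so the derivative in the norm is the pointwise derivative, and
  the pointwise equations determine it. The system then says that it equals \<open>L V + B(V, V)\<close>.\<close>

lemma holomorphic_solution_iff:
  fixes \<alpha> \<beta> \<Delta> s T :: real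
  assumes s: "2 \<le> s" and \<Delta>: "0 < \<Delta>" and T: "0 < T"
  shows "holomorphic_solution \<alpha> \<beta> \<Delta> s u\<^sub>0 v\<^sub>0 T (\<lambda>t. V t \<circ> Inl) (\<lambda>t. V t \<circ> Inr) \<longleftrightarrow>
     cauchy_kovalevskaya.solution (pair_bound \<Delta> (s + 1)) (linear_part \<alpha>) (quadratic_part \<beta>) T
       (case_sum (\<lambda>x. of_real (u\<^sub>0 x)) (\<lambda>x. of_real (v\<^sub>0 x))) V"
proof -
  let ?X = "\<lambda>d. E_cplx (\<Delta> * d) (s + 1)"
  let ?E = "\<lambda>d. E_bound (\<Delta> * d) (s + 1)"
  let ?P = "pair_bound \<Delta> (s + 1)"
  let ?D = "\<lambda>d. E_has_derivative (\<Delta> * d) (s + 1)"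
  let ?u = "\<lambda>t. V t \<circ> Inl"
  let ?v = "\<lambda>t. V t \<circ> Inr"
  let ?N = "\<lambda>t x. helmholtz_inv (vderiv (nonlocal_term \<alpha> \<beta> (V t \<circ> Inl) (V t \<circ> Inr))) x"
  let ?F = "\<lambda>t i. linear_part \<alpha> (V t) i + quadratic_part \<beta> (V t) (V t) i"
  interpret cauchy_kovalevskaya "?P" "linear_part \<alpha>" "quadratic_part \<beta>" "equation_const \<alpha> \<beta> \<Delta> s"
    by (rule cauchy_kovalevskaya_pair[OF s \<Delta>])
  have s1: "2 \<le> s + 1" using s by simp
  let ?V0 = "case_sum (\<lambda>x. complex_of_real (u\<^sub>0 x)) (\<lambda>x. complex_of_real (v\<^sub>0 x))"
  have init: "V 0 = ?V0 \<longleftrightarrow> (\<forall>x. (?u 0) x = complex_of_real (u\<^sub>0 x)) \<and> (\<forall>x. (?v 0) x = complex_of_real (v\<^sub>0 x))"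
    by (auto simp: fun_eq_iff split: sum.split)
  have deriv_iff: "has_deriv d V W t \<longleftrightarrow> ?D d ?u (W \<circ> Inl) t
       \<and> ?D d ?v (W \<circ> Inr) t"
    if d: "0 < d" "d < 1" and ball: "\<And>\<tau>. cmod \<tau> < T * (1 - d) \<Longrightarrow> ?u \<tau> \<in> ?X d \<and> ?v \<tau> \<in> ?X d"
      and t: "cmod t < T * (1 - d)" for d t W
  proof -
    have \<delta>: "0 < \<Delta> * d" using \<Delta> d by simp
    have near: "\<forall>\<^sub>F \<tau> in at t. cmod \<tau> < T * (1 - d)"
      by (rule order_tendstoD[OF tendsto_norm[OF tendsto_ident_at]]) (use t in auto)
    have W_iff: "(\<exists>p. ?P d W p) \<longleftrightarrow> W \<circ> Inl \<in> ?X d \<and> W \<circ> Inr \<in> ?X d"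
    proof
      assume "W \<circ> Inl \<in> ?X d \<and> W \<circ> Inr \<in> ?X d"
      then obtain p q where "?E d (W \<circ> Inl) p" "?E d (W \<circ> Inr) q"
        by (auto simp: E_cplx_iff)
      hence "?P d W (max p q)"
        unfolding pair_bound_def by (auto intro: E_bound_weaken)
      thus "\<exists>p. ?P d W p" ..
    qed (auto simp: pair_bound_def E_cplx_iff)
    have lim: "((\<lambda>\<tau>. E_norm (\<Delta> * d) (s + 1) (\<lambda>x. ((V \<tau> \<circ> c) x - (V t \<circ> c) x) / (\<tau> - t) - (W \<circ> c) x)) \<longlongrightarrow> 0) (at t) \<longleftrightarrow>
        (\<forall>\<epsilon>>0. \<forall>\<^sub>F \<tau> in at t. ?E d (\<lambda>x. ((V \<tau> \<circ> c) x - (V t \<circ> c) x) / (\<tau> - t) - (W \<circ> c) x) \<epsilon>)"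
      if W: "W \<circ> c \<in> ?X d" and c: "c = Inl \<or> c = Inr" for c :: "real \<Rightarrow> real + real"
    proof (rule E_norm_tendsto_0_iff)
      show "\<forall>\<^sub>F \<tau> in at t. (\<lambda>x. ((V \<tau> \<circ> c) x - (V t \<circ> c) x) / (\<tau> - t) - (W \<circ> c) x) \<in> ?X d"
        using near
      proof eventually_elim
        case (elim \<tau>)
        have "V \<tau> \<circ> c \<in> ?X d" "V t \<circ> c \<in> ?X d"
          using ball[OF elim] ball[OF t] c by auto
        thus ?case by (rule E_cplx_quotient[OF s1 \<delta> _ _ W])
      qed
    qed
    show ?thesis
      unfolding has_deriv_def E_has_derivative_def W_iff
      using lim[of Inl] lim[of Inr]
      by (auto simp: pair_bound_def o_def eventually_conj_iff)
  qed
  show ?thesis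
  proof
    assume hol: "holomorphic_solution \<alpha> \<beta> \<Delta> s u\<^sub>0 v\<^sub>0 T ?u ?v"
    have E: "?u \<tau> \<in> ?X d \<and> ?v \<tau> \<in> ?X d"
      "\<exists>w. ?D d ?u w \<tau>"
      "\<exists>w. ?D d ?v w \<tau>"
      if "0 < d" "d < 1" "cmod \<tau> < T * (1 - d)" for d \<tau>
      using hol that unfolding holomorphic_solution_def E_holomorphic_on_def by auto
    show "solution T ?V0 V"
      unfolding solution_def
    proof (intro conjI allI impI)
      show "V 0 = ?V0" using hol unfolding init holomorphic_solution_def solves_cauchy_problem_def by blast
      fix d t assume d: "0 < d" "d < 1" and t: "cmod t < T * (1 - d)"
      obtain p q where "?E d (?u t) p" "?E d (?v t) q"
        using E(1)[OF d t] by (auto simp: E_cplx_iff)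
      hence p: "?P d (V t) (max p q)"
        unfolding pair_bound_def by (auto intro: E_bound_weaken)
      thus "\<exists>p. ?P d (V t) p" ..
      obtain w\<^sub>1 w\<^sub>2 where w: "?D d ?u w\<^sub>1 t"
        "?D d ?v w\<^sub>2 t" using E(2,3)[OF d t] by auto
      define W where "W = case_sum w\<^sub>1 w\<^sub>2"
      have W: "has_deriv d V W t"
        using deriv_iff[OF d E(1)[OF d] t, of W] w by (simp add: W_def case_sum_o_inj)
      have "T * (1 - d) \<le> T * 1" using T d by (intro mult_left_mono) auto
      hence tb: "t \<in> ball 0 T" using t by simp
      have "W = (?F t)"
      proof
        fix i
        have D: "deriv (\<lambda>\<tau>. V \<tau> i) t = W i"
          by (rule DERIV_imp_deriv[OF has_deriv_imp_field_derivative[OF d W]])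
        show "W i = ?F t i"
        proof (cases i)
          case (Inl x)
          have "deriv (\<lambda>\<tau>. (?u \<tau>) x) t + complex_of_real \<beta> * (?u t) x * vderiv (?u t) x
            + ?N t x = 0"
            using hol tb unfolding holomorphic_solution_def solves_cauchy_problem_def by blast
          hence e: "deriv (\<lambda>\<tau>. V \<tau> (Inl x)) t = - (complex_of_real \<beta> * V t (Inl x) * vderiv (?u t) x
            + ?N t x)"
            by (simp only: o_apply eq_neg_iff_add_eq_0 add.assoc)
          show ?thesis unfolding Inl right_hand_side_eq(1)[OF s \<Delta> d(1) p] e[symmetric] D[unfolded Inl] ..
        next
          case (Inr x)
          have "deriv (\<lambda>\<tau>. (?v \<tau>) x) t + vderiv (?u t) x + vderiv (\<lambda>y. (?u t) y * (?v t) y) x = 0"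
            using hol tb unfolding holomorphic_solution_def solves_cauchy_problem_def by blast
          hence e: "deriv (\<lambda>\<tau>. V \<tau> (Inr x)) t = - (vderiv (?u t) x + vderiv (\<lambda>y. (?u t) y * (?v t) y) x)"
            by (simp only: o_apply eq_neg_iff_add_eq_0 add.assoc)
          show ?thesis unfolding Inr right_hand_side_eq(2)[OF s \<Delta> d(1) p] e[symmetric] D[unfolded Inr] ..
        qed
      qed
      thus "has_deriv d V (?F t) t"
        using W by simp
    qed
  next
    assume sol: "solution T ?V0 V"
    have S: "\<exists>p. ?P d (V t) p" "has_deriv d V (?F t) t"
      if "0 < d" "d < 1" "cmod t < T * (1 - d)" for d t
      using sol that unfolding solution_def by blast+
    have E: "?u \<tau> \<in> ?X d \<and> ?v \<tau> \<in> ?X d"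
      if "0 < d" "d < 1" "cmod \<tau> < T * (1 - d)" for d \<tau>
      using S(1)[OF that] by (auto simp: pair_bound_def E_cplx_iff)
    have hol: "E_holomorphic_on (\<Delta> * d) (s + 1) ?u (ball 0 (T * (1 - d)))
         \<and> E_holomorphic_on (\<Delta> * d) (s + 1) ?v (ball 0 (T * (1 - d)))"
      if d: "0 < d" "d < 1" for d
      unfolding E_holomorphic_on_def
      using E[OF d] S(2)[OF d] deriv_iff[OF d E[OF d]] by (auto simp: mem_ball_0) blast+
    have eq: "deriv (\<lambda>\<tau>. V \<tau> i) t = ?F t i"
      "\<exists>d p. 0 < d \<and> ?P d (V t) p" if t: "cmod t < T" for t i
    proof -
      obtain d where d: "0 < d" "d < 1" "cmod t < T * (1 - d)" using ex_scale_parameter[OF T norm_ge_zero t] by blast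
      show "deriv (\<lambda>\<tau>. V \<tau> i) t = ?F t i"
        by (rule DERIV_imp_deriv[OF has_deriv_imp_field_derivative[OF d(1,2) S(2)[OF d]]])
      show "\<exists>d p. 0 < d \<and> ?P d (V t) p" using S(1)[OF d] d by blast
    qed
    show "holomorphic_solution \<alpha> \<beta> \<Delta> s u\<^sub>0 v\<^sub>0 T ?u ?v"
      unfolding holomorphic_solution_def solves_cauchy_problem_def
    proof (intro conjI ballI allI)
      fix t :: complex and x assume "t \<in> ball 0 T"
      hence t: "cmod t < T" by simp
      obtain d p where d: "0 < d" and p: "?P d (V t) p" using eq(2)[OF t] by blast
      show "deriv (\<lambda>\<tau>. (?u \<tau>) x) t + complex_of_real \<beta> * (?u t) x * vderiv (?u t) x
            + ?N t x = 0"
        using eq(1)[OF t, of "Inl x"] unfolding right_hand_side_eq(1)[OF s \<Delta> d p] by simp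
      show "deriv (\<lambda>\<tau>. (?v \<tau>) x) t + vderiv (?u t) x + vderiv (\<lambda>y. (?u t) y * (?v t) y) x = 0"
        using eq(1)[OF t, of "Inr x"] unfolding right_hand_side_eq(2)[OF s \<Delta> d p] by simp
    next
      fix x
      show "(?u 0) x = complex_of_real (u\<^sub>0 x)" "(?v 0) x = complex_of_real (v\<^sub>0 x)"
        using sol init unfolding solution_def by auto
    qed (use hol in auto)
  qed
qed

section \<open>Existence and uniqueness\<close>

theorem theorem9:
  fixes \<alpha> \<beta> \<Delta> s :: real and u\<^sub>0 v\<^sub>0 :: "real \<Rightarrow> real"
  assumes "0 < \<Delta>" and "\<Delta> \<le> 1" and "s \<ge> 2"
    and "u\<^sub>0 \<in> E_real \<Delta> (s + 1)" and "v\<^sub>0 \<in> E_real \<Delta> (s + 1)"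
  shows "\<exists>T>0. \<exists>u v.
           holomorphic_solution \<alpha> \<beta> \<Delta> s u\<^sub>0 v\<^sub>0 T u v \<and>
           (\<forall>t\<in>ball 0 T. t \<in> \<real> \<longrightarrow> (\<forall>x. u t x \<in> \<real> \<and> v t x \<in> \<real>)) \<and>
           (\<forall>u' v'. holomorphic_solution \<alpha> \<beta> \<Delta> s u\<^sub>0 v\<^sub>0 T u' v' \<longrightarrow>
              (\<forall>t\<in>ball 0 T. u' t = u t \<and> v' t = v t))"
proof -
  note \<Delta> = assms(1) and s = assms(3)
  have s1: "2 \<le> s + 1" using s by simp
  interpret cauchy_kovalevskaya "pair_bound \<Delta> (s + 1)" "linear_part \<alpha>" "quadratic_part \<beta>" "equation_const \<alpha> \<beta> \<Delta> s"
    by (rule cauchy_kovalevskaya_pair[OF s \<Delta>])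
  define V\<^sub>0 where "V\<^sub>0 = case_sum (\<lambda>x. complex_of_real (u\<^sub>0 x)) (\<lambda>x. complex_of_real (v\<^sub>0 x))"
  \<comment> \<open>the summand 1 keeps \<open>K\<close> positive for vanishing initial values\<close>
  define K where "K = \<bar>E_norm \<Delta> (s + 1) (V\<^sub>0 \<circ> Inl)\<bar> + \<bar>E_norm \<Delta> (s + 1) (V\<^sub>0 \<circ> Inr)\<bar> + 1"
  have K: "0 < K" by (simp add: K_def)
  have "E_bound \<Delta> (s + 1) (V\<^sub>0 \<circ> Inl) K" "E_bound \<Delta> (s + 1) (V\<^sub>0 \<circ> Inr) K"
    using assms(4,5) by (auto simp: E_bound_def K_def V\<^sub>0_def E_real_def case_sum_o_inj)
  hence V0: "pair_bound \<Delta> (s + 1) d V\<^sub>0 K" if "0 < d" "d < 1" for d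
    unfolding pair_bound_def using that \<Delta> mult_left_mono[of d 1 \<Delta>]
    by (auto intro!: E_bound_mono[OF s1, of "\<Delta> * d" \<Delta>])
  define M where "M = 24 * equation_const \<alpha> \<beta> \<Delta> s * (1 + 8 * K)"
  have M: "0 < M" unfolding M_def using C_pos K by simp
  define V where "V = (\<lambda>t i. \<Sum>n. t ^ n * coeffs V\<^sub>0 n i)"
  have sol: "solution (1 / M) V\<^sub>0 V" unfolding V_def by (rule power_series_solution[OF K V0 M_def])
  have T: "0 < 1 / M" using M by simp
  have real_coeffs: "coeffs V\<^sub>0 n i \<in> \<real>" for n i
  proof (rule coeffs_in_real_subspace[of "1/2", OF _ _ K V0])
    show "V\<^sub>0 i \<in> \<real>" for i by (auto simp: V\<^sub>0_def split: sum.split)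
    have \<delta>: "0 < \<Delta> * (1/2)" using \<Delta> by simp
    note om = E_bound_order_mono[OF s, of "s + 1" "\<Delta> * (1/2)"]
    show "linear_part \<alpha> f i \<in> \<real>" if f: "pair_bound \<Delta> (s + 1) (1/2) f p" and real: "\<And>i. f i \<in> \<real>" for f p i
    proof -
      have b: "E_bound (\<Delta> * (1/2)) (s + 1) (f \<circ> Inl) p" "E_bound (\<Delta> * (1/2)) (s + 1) (f \<circ> Inr) p"
        using f by (auto simp: pair_bound_def)
      have r: "\<And>x. (f \<circ> Inl) x \<in> \<real>" "\<And>x. (f \<circ> Inr) x \<in> \<real>" using real by auto
      have bs: "E_bound (\<Delta> * (1/2)) s (f \<circ> Inl) p" "E_bound (\<Delta> * (1/2)) s (f \<circ> Inr) p"
        by (rule om[OF _ \<delta> b(1)], simp, rule om[OF _ \<delta> b(2)], simp)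
      have "nonlocal_op (f \<circ> Inl) x \<in> \<real>" "nonlocal_op (f \<circ> Inr) x \<in> \<real>" "vderiv (f \<circ> Inl) x \<in> \<real>" for x
        using nonlocal_op_real[OF s \<delta> bs(1) r(1)] nonlocal_op_real[OF s \<delta> bs(2) r(2)] vderiv_real[OF E_bound_smooth[OF b(1)] r(1)]
        by blast+
      thus ?thesis unfolding linear_part_def by (cases i) (auto intro!: Reals_add Reals_mult Reals_minus)
    qed
    show "quadratic_part \<beta> f g i \<in> \<real>"
      if fg: "pair_bound \<Delta> (s + 1) (1/2) f p" "pair_bound \<Delta> (s + 1) (1/2) g q"
        and real: "\<And>i. f i \<in> \<real>" "\<And>i. g i \<in> \<real>" for f p g q i
    proof -
      have b: "E_bound (\<Delta> * (1/2)) (s + 1) (f \<circ> Inl) p" "E_bound (\<Delta> * (1/2)) (s + 1) (f \<circ> Inr) p"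
         "E_bound (\<Delta> * (1/2)) (s + 1) (g \<circ> Inl) q" "E_bound (\<Delta> * (1/2)) (s + 1) (g \<circ> Inr) q"
        using fg by (auto simp: pair_bound_def)
      have r: "\<And>x. (f \<circ> Inl) x \<in> \<real>" "\<And>x. (f \<circ> Inr) x \<in> \<real>" "\<And>x. (g \<circ> Inl) x \<in> \<real>" "\<And>x. (g \<circ> Inr) x \<in> \<real>" using real by auto
      have vr: "vderiv (f \<circ> Inl) x \<in> \<real>" "vderiv (g \<circ> Inl) x \<in> \<real>" for x
        using vderiv_real[OF E_bound_smooth[OF b(1)] r(1)] vderiv_real[OF E_bound_smooth[OF b(3)] r(3)] by blast+
      have "flux \<beta> (f \<circ> Inl) (f \<circ> Inr) (g \<circ> Inl) (g \<circ> Inr) x \<in> \<real>" for x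
        unfolding flux_def using vr r by (intro Reals_add Reals_mult Reals_divide Reals_of_real) auto
      hence N: "nonlocal_op (flux \<beta> (f \<circ> Inl) (f \<circ> Inr) (g \<circ> Inl) (g \<circ> Inr)) x \<in> \<real>" for x
        by (rule nonlocal_op_real[OF s \<delta> flux_bound[OF s \<delta> b]])
      have "vderiv (\<lambda>y. (f \<circ> Inl) y * (g \<circ> Inr) y) x \<in> \<real>" for x
        by (rule vderiv_real[OF E_bound_smooth[OF E_bound_mult[OF s1 \<delta> b(1,4)]]]) (use r in \<open>auto intro!: Reals_mult\<close>)
      thus ?thesis unfolding quadratic_part_def using N vr r
        by (cases i) (auto intro!: Reals_add Reals_mult Reals_minus Reals_diff)
    qed
  qed auto
  have real: "V t i \<in> \<real>" if t: "cmod t < 1 / M" "t \<in> \<real>" for t i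
  proof -
    have "(\<lambda>n. Im (t ^ n * coeffs V\<^sub>0 n i)) sums Im (V t i)"
      unfolding V_def by (rule sums_Im[OF summable_sums[OF coeffs_summable[OF K V0 M_def t(1)]]])
    moreover have "Im (t ^ n * coeffs V\<^sub>0 n i) = 0" for n
      using t(2) real_coeffs[of n i] by (metis Reals_mult Reals_power complex_is_Real_iff)
    ultimately have "Im (V t i) = 0" by (simp add: sums_iff)
    thus ?thesis by (simp add: complex_is_Real_iff)
  qed
  show ?thesis
  proof (rule exI[of _ "1 / M"], rule conjI[OF T], rule exI[of _ "\<lambda>t. V t \<circ> Inl"],
      rule exI[of _ "\<lambda>t. V t \<circ> Inr"], intro conjI)
    show "holomorphic_solution \<alpha> \<beta> \<Delta> s u\<^sub>0 v\<^sub>0 (1 / M) (\<lambda>t. V t \<circ> Inl) (\<lambda>t. V t \<circ> Inr)"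
      unfolding holomorphic_solution_iff[OF s \<Delta> T] using sol by (simp only: V\<^sub>0_def)
    show "\<forall>t\<in>ball 0 (1 / M). t \<in> \<real> \<longrightarrow> (\<forall>x. (V t \<circ> Inl) x \<in> \<real> \<and> (V t \<circ> Inr) x \<in> \<real>)"
      using real by auto
    show "\<forall>u' v'. holomorphic_solution \<alpha> \<beta> \<Delta> s u\<^sub>0 v\<^sub>0 (1 / M) u' v' \<longrightarrow>
              (\<forall>t\<in>ball 0 (1 / M). u' t = V t \<circ> Inl \<and> v' t = V t \<circ> Inr)"
    proof (intro allI impI ballI)
      fix u' v' and t :: complex assume hol: "holomorphic_solution \<alpha> \<beta> \<Delta> s u\<^sub>0 v\<^sub>0 (1 / M) u' v'" and "t \<in> ball 0 (1 / M)"
      hence t: "cmod t < 1 / M" by simp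
      define V' where "V' = (\<lambda>t. case_sum (u' t) (v' t))"
      have c: "(\<lambda>t. V' t \<circ> Inl) = u'" "(\<lambda>t. V' t \<circ> Inr) = v'" by (auto simp: V'_def case_sum_o_inj)
      have "solution (1 / M) V\<^sub>0 V'"
        using holomorphic_solution_iff[OF s \<Delta> T, of \<alpha> \<beta> u\<^sub>0 v\<^sub>0 V'] hol unfolding c V\<^sub>0_def by simp
      hence "V t = V' t" by (rule solution_unique[OF T sol _ t])
      thus "u' t = V t \<circ> Inl \<and> v' t = V t \<circ> Inr" by (simp add: V'_def case_sum_o_inj)
    qed
  qed
qed

end
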